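(* Let $H$ be a finite-dimensional pointed Hopf algebra over a field $k$ such that $H_{\mathrm{ab}}$ is (isomorphic as a Hopf algebra to) a group algebra. Then $\mathcal{B}_H$ is isomorphic to a localization $T^{-1}k[x_1,\dots,x_m]$ of a polynomial algebra in finitely many variables.
   Context: A Hopf algebra is pointed if every simple subcoalgebra is one-dimensional. $H_{\mathrm{ab}}$ denotes the largest commutative Hopf algebra quotient of $H$. Sweedler notation $\Delta(x)=x_1\otimes x_2$. Let $t_H=\{t_x: x\in H\}$ be a copy of the vector space $H$ ($x\mapsto t_x$ linear isomorphism), $S(t_H)$ its symmetric algebra, and $x\mapsto t^{-1}_x$ the unique linear map from $H$ to $\mathrm{Frac}\,S(t_H)$ with $t_{x_1}t^{-1}_{x_2}=t^{-1}_{x_1}t_{x_2}=\varepsilon(x)1$. The generic base algebra $\mathcal{B}_H$ is the subalgebra of $\mathrm{Frac}\,S(t_H)$ generated by all $\sigma(x,y)=t_{x_1}t_{y_1}t^{-1}_{x_2y_2}$ and $\sigma^{-1}(x,y)=t_{x_1y_1}t^{-1}_{x_2}t^{-1}_{y_2}$, $x,y\in H$. *)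

theory Defs
  imports "HOL-Library.Function_Algebras" "HOL-Library.Poly_Mapping" "HOL-Computational_Algebra.Fraction_Field" "HOL-Algebra.Group"
begin

text \<open>A finite-dimensional Hopf algebra H over a field 'k is given by a basis indexed by a
finite linearly ordered type 'b and its structure constants:
  e_i e_j = sum_l mu i j l e_l,  1 = sum_l eta l e_l,
  Delta e_i = sum_(a,b) dl i a b e_a (x) e_b,  eps(e_i) = ep i,  S e_i = sum_l an i l e_l.
Elements of H are coefficient vectors 'b => 'k, elements of H (x) H are 'b * 'b => 'k.\<close>

definition hopf_algebra ::
  "('b::finite \<Rightarrow> 'b \<Rightarrow> 'b \<Rightarrow> 'k::field) \<Rightarrow> ('b \<Rightarrow> 'k) \<Rightarrow> ('b \<Rightarrow> 'b \<Rightarrow> 'b \<Rightarrow> 'k)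
   \<Rightarrow> ('b \<Rightarrow> 'k) \<Rightarrow> ('b \<Rightarrow> 'b \<Rightarrow> 'k) \<Rightarrow> bool" where
  "hopf_algebra mu eta dl ep an \<longleftrightarrow>
     \<comment> \<open>associativity\<close>
     (\<forall>i j k l. (\<Sum>p\<in>UNIV. mu i j p * mu p k l) = (\<Sum>p\<in>UNIV. mu j k p * mu i p l)) \<and>
     \<comment> \<open>unit\<close>
     (\<forall>i l. (\<Sum>p\<in>UNIV. eta p * mu p i l) = (if i = l then 1 else 0)) \<and>
     (\<forall>i l. (\<Sum>p\<in>UNIV. eta p * mu i p l) = (if i = l then 1 else 0)) \<and>
     \<comment> \<open>coassociativity\<close>
     (\<forall>i a b c. (\<Sum>p\<in>UNIV. dl i p c * dl p a b) = (\<Sum>p\<in>UNIV. dl i a p * dl p b c)) \<and>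
     \<comment> \<open>counit\<close>
     (\<forall>i l. (\<Sum>p\<in>UNIV. ep p * dl i p l) = (if i = l then 1 else 0)) \<and>
     (\<forall>i l. (\<Sum>p\<in>UNIV. dl i l p * ep p) = (if i = l then 1 else 0)) \<and>
     \<comment> \<open>comultiplication is an algebra map\<close>
     (\<forall>i j a b. (\<Sum>p\<in>UNIV. mu i j p * dl p a b) =
        (\<Sum>a1\<in>UNIV. \<Sum>b1\<in>UNIV. \<Sum>a2\<in>UNIV. \<Sum>b2\<in>UNIV.
            dl i a1 b1 * dl j a2 b2 * mu a1 a2 a * mu b1 b2 b)) \<and>
     (\<forall>a b. (\<Sum>p\<in>UNIV. eta p * dl p a b) = eta a * eta b) \<and>
     \<comment> \<open>counit is an algebra map\<close>
     (\<forall>i j. (\<Sum>p\<in>UNIV. mu i j p * ep p) = ep i * ep j) \<and>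
     (\<Sum>p\<in>UNIV. eta p * ep p) = 1 \<and>
     \<comment> \<open>antipode: S(x_1) x_2 = eps(x) 1 = x_1 S(x_2)\<close>
     (\<forall>i l. (\<Sum>a\<in>UNIV. \<Sum>b\<in>UNIV. \<Sum>c\<in>UNIV. dl i a b * an a c * mu c b l) = ep i * eta l) \<and>
     (\<forall>i l. (\<Sum>a\<in>UNIV. \<Sum>b\<in>UNIV. \<Sum>c\<in>UNIV. dl i a b * an b c * mu a c l) = ep i * eta l)"

definition h_mult :: "('b::finite \<Rightarrow> 'b \<Rightarrow> 'b \<Rightarrow> 'k::field) \<Rightarrow> ('b \<Rightarrow> 'k) \<Rightarrow> ('b \<Rightarrow> 'k) \<Rightarrow> ('b \<Rightarrow> 'k)" where
  "h_mult mu x y = (\<lambda>l. \<Sum>i\<in>UNIV. \<Sum>j\<in>UNIV. x i * y j * mu i j l)"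

definition h_comult :: "('b::finite \<Rightarrow> 'b \<Rightarrow> 'b \<Rightarrow> 'k::field) \<Rightarrow> ('b \<Rightarrow> 'k) \<Rightarrow> ('b \<times> 'b \<Rightarrow> 'k)" where
  "h_comult dl x = (\<lambda>(a, b). \<Sum>i\<in>UNIV. x i * dl i a b)"

definition h_basis :: "'b \<Rightarrow> ('b \<Rightarrow> 'k::field)" where
  "h_basis i = (\<lambda>j. if j = i then 1 else 0)"

definition vscale :: "'k::field \<Rightarrow> ('a \<Rightarrow> 'k) \<Rightarrow> ('a \<Rightarrow> 'k)" where
  "vscale c v = (\<lambda>a. c * v a)"

definition tens :: "('b \<Rightarrow> 'k::field) \<Rightarrow> ('b \<Rightarrow> 'k) \<Rightarrow> ('b \<times> 'b \<Rightarrow> 'k)" where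
  "tens u v = (\<lambda>(a, b). u a * v b)"

definition lin_span :: "('a \<Rightarrow> 'k::field) set \<Rightarrow> ('a \<Rightarrow> 'k) set" where
  "lin_span S = {x. \<exists>F c. finite F \<and> F \<subseteq> S \<and> x = (\<Sum>v\<in>F. vscale (c v) v)}"

definition subspace_of :: "('a \<Rightarrow> 'k::field) set \<Rightarrow> bool" where
  "subspace_of C \<longleftrightarrow> 0 \<in> C \<and> (\<forall>x\<in>C. \<forall>y\<in>C. x + y \<in> C) \<and> (\<forall>c. \<forall>x\<in>C. vscale c x \<in> C)"

definition subcoalgebra :: "('b::finite \<Rightarrow> 'b \<Rightarrow> 'b \<Rightarrow> 'k::field) \<Rightarrow> ('b \<Rightarrow> 'k) set \<Rightarrow> bool" where
  "subcoalgebra dl C \<longleftrightarrow> subspace_of C \<and>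
     (\<forall>x\<in>C. h_comult dl x \<in> lin_span {tens u v | u v. u \<in> C \<and> v \<in> C})"

definition simple_subcoalgebra :: "('b::finite \<Rightarrow> 'b \<Rightarrow> 'b \<Rightarrow> 'k::field) \<Rightarrow> ('b \<Rightarrow> 'k) set \<Rightarrow> bool" where
  "simple_subcoalgebra dl C \<longleftrightarrow> subcoalgebra dl C \<and> C \<noteq> {0} \<and>
     (\<forall>D. subcoalgebra dl D \<and> D \<subseteq> C \<longrightarrow> D = {0} \<or> D = C)"

definition pointed :: "('b::finite \<Rightarrow> 'b \<Rightarrow> 'b \<Rightarrow> 'k::field) \<Rightarrow> bool" where
  "pointed dl \<longleftrightarrow> (\<forall>C. simple_subcoalgebra dl C \<longrightarrow> (\<exists>v. v \<noteq> 0 \<and> C = range (\<lambda>c. vscale c v)))"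

text \<open>Two-sided ideals and the commutator ideal; H_ab = H / commutator_ideal.\<close>
definition two_sided_ideal :: "('b::finite \<Rightarrow> 'b \<Rightarrow> 'b \<Rightarrow> 'k::field) \<Rightarrow> ('b \<Rightarrow> 'k) set \<Rightarrow> bool" where
  "two_sided_ideal mu I \<longleftrightarrow> subspace_of I \<and>
     (\<forall>x\<in>I. \<forall>y. h_mult mu x y \<in> I \<and> h_mult mu y x \<in> I)"

definition commutator_ideal :: "('b::finite \<Rightarrow> 'b \<Rightarrow> 'b \<Rightarrow> 'k::field) \<Rightarrow> ('b \<Rightarrow> 'k) set" where
  "commutator_ideal mu = \<Inter>{I. two_sided_ideal mu I \<and>
       (\<forall>x y. h_mult mu x y - h_mult mu y x \<in> I)}"

definition galg :: "('g, 'm) monoid_scheme \<Rightarrow> ('g \<Rightarrow> 'k::field) set" where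
  "galg G = {f. \<forall>a. a \<notin> carrier G \<longrightarrow> f a = 0}"

definition galg_mult :: "('g, 'm) monoid_scheme \<Rightarrow> ('g \<Rightarrow> 'k::field) \<Rightarrow> ('g \<Rightarrow> 'k) \<Rightarrow> ('g \<Rightarrow> 'k)" where
  "galg_mult G f h = (\<lambda>c. if c \<in> carrier G then
       (\<Sum>a\<in>carrier G. \<Sum>b\<in>carrier G. if a \<otimes>\<^bsub>G\<^esub> b = c then f a * h b else 0) else 0)"

definition galg_one :: "('g, 'm) monoid_scheme \<Rightarrow> ('g \<Rightarrow> 'k::field)" where
  "galg_one G = (\<lambda>c. if c = \<one>\<^bsub>G\<^esub> then 1 else 0)"

definition galg_comult :: "('g, 'm) monoid_scheme \<Rightarrow> ('g \<Rightarrow> 'k::field) \<Rightarrow> ('g \<times> 'g \<Rightarrow> 'k)" where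
  "galg_comult G f = (\<lambda>(a, b). if a = b then f a else 0)"

definition galg_counit :: "('g, 'm) monoid_scheme \<Rightarrow> ('g \<Rightarrow> 'k::field) \<Rightarrow> 'k" where
  "galg_counit G f = (\<Sum>a\<in>carrier G. f a)"

definition lin_map :: "('b::finite \<Rightarrow> ('g \<Rightarrow> 'k::field)) \<Rightarrow> ('b \<Rightarrow> 'k) \<Rightarrow> ('g \<Rightarrow> 'k)" where
  "lin_map pim x = (\<Sum>i\<in>UNIV. vscale (x i) (pim i))"

text \<open>H_ab is isomorphic, as a Hopf algebra, to the group algebra kG: there is a surjective
bialgebra (hence Hopf algebra) map H -> kG whose kernel is the commutator ideal.\<close>
definition hab_iso_group_algebra ::
  "('b::finite \<Rightarrow> 'b \<Rightarrow> 'b \<Rightarrow> 'k::field) \<Rightarrow> ('b \<Rightarrow> 'k) \<Rightarrow> ('b \<Rightarrow> 'b \<Rightarrow> 'b \<Rightarrow> 'k)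
   \<Rightarrow> ('b \<Rightarrow> 'k) \<Rightarrow> ('g, 'm) monoid_scheme \<Rightarrow> bool" where
  "hab_iso_group_algebra mu eta dl ep G \<longleftrightarrow>
     (\<exists>pim. (\<forall>i. pim i \<in> galg G) \<and>
        (\<forall>x y. lin_map pim (h_mult mu x y) = galg_mult G (lin_map pim x) (lin_map pim y)) \<and>
        lin_map pim eta = galg_one G \<and>
        (\<forall>x. galg_comult G (lin_map pim x) =
              (\<lambda>(g, h). \<Sum>a\<in>UNIV. \<Sum>b\<in>UNIV. h_comult dl x (a, b) * pim a g * pim b h)) \<and>
        (\<forall>x. galg_counit G (lin_map pim x) = (\<Sum>i\<in>UNIV. x i * ep i)) \<and>
        galg G \<subseteq> range (lin_map pim) \<and>
        {x. lin_map pim x = 0} = commutator_ideal mu)"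

type_synonym ('v, 'k) mpoly = "('v \<Rightarrow>\<^sub>0 nat) \<Rightarrow>\<^sub>0 'k"

definition pconst :: "'k::field \<Rightarrow> ('v::linorder, 'k) mpoly fract" where
  "pconst c = Fract (Poly_Mapping.single 0 c) 1"

definition pvar :: "'v \<Rightarrow> ('v::linorder, 'k::field) mpoly fract" where
  "pvar v = Fract (Poly_Mapping.single (Poly_Mapping.single v 1) 1) 1"

text \<open>t_x = sum_b x_b t_b in S(t_H) = k[t_b : b], inside its fraction field.\<close>
definition tH :: "('b::{finite,linorder} \<Rightarrow> 'k::field) \<Rightarrow> ('b, 'k) mpoly fract" where
  "tH x = (\<Sum>b\<in>UNIV. pconst (x b) * pvar b)"

definition lin_ext :: "('b::{finite,linorder} \<Rightarrow> ('b, 'k::field) mpoly fract) \<Rightarrow> ('b \<Rightarrow> 'k) \<Rightarrow> ('b, 'k) mpoly fract" where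
  "lin_ext f x = (\<Sum>b\<in>UNIV. pconst (x b) * f b)"

text \<open>t^{-1}: the unique linear map with t_{x_1} t^{-1}_{x_2} = t^{-1}_{x_1} t_{x_2} = eps(x) 1.\<close>
definition tinv_cond :: "('b::{finite,linorder} \<Rightarrow> 'b \<Rightarrow> 'b \<Rightarrow> 'k::field) \<Rightarrow> ('b \<Rightarrow> 'k)
   \<Rightarrow> ('b \<Rightarrow> ('b, 'k) mpoly fract) \<Rightarrow> bool" where
  "tinv_cond dl ep f \<longleftrightarrow> (\<forall>x.
     (\<Sum>a\<in>UNIV. \<Sum>b\<in>UNIV. pconst (h_comult dl x (a, b)) * tH (h_basis a) * lin_ext f (h_basis b))
        = pconst (\<Sum>i\<in>UNIV. x i * ep i) \<and>
     (\<Sum>a\<in>UNIV. \<Sum>b\<in>UNIV. pconst (h_comult dl x (a, b)) * lin_ext f (h_basis a) * tH (h_basis b))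
        = pconst (\<Sum>i\<in>UNIV. x i * ep i))"

definition tinv :: "('b::{finite,linorder} \<Rightarrow> 'b \<Rightarrow> 'b \<Rightarrow> 'k::field) \<Rightarrow> ('b \<Rightarrow> 'k)
   \<Rightarrow> ('b \<Rightarrow> 'k) \<Rightarrow> ('b, 'k) mpoly fract" where
  "tinv dl ep = lin_ext (THE f. tinv_cond dl ep f)"

definition gen_sigma :: "('b::{finite,linorder} \<Rightarrow> 'b \<Rightarrow> 'b \<Rightarrow> 'k::field) \<Rightarrow> ('b \<Rightarrow> 'b \<Rightarrow> 'b \<Rightarrow> 'k)
   \<Rightarrow> ('b \<Rightarrow> 'k) \<Rightarrow> ('b \<Rightarrow> 'k) \<Rightarrow> ('b \<Rightarrow> 'k) \<Rightarrow> ('b, 'k) mpoly fract" where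
  "gen_sigma mu dl ep x y =
     (\<Sum>a\<in>UNIV. \<Sum>b\<in>UNIV. \<Sum>c\<in>UNIV. \<Sum>d\<in>UNIV.
        pconst (h_comult dl x (a, b) * h_comult dl y (c, d)) *
        tH (h_basis a) * tH (h_basis c) * tinv dl ep (h_mult mu (h_basis b) (h_basis d)))"

definition gen_sigma_inv :: "('b::{finite,linorder} \<Rightarrow> 'b \<Rightarrow> 'b \<Rightarrow> 'k::field) \<Rightarrow> ('b \<Rightarrow> 'b \<Rightarrow> 'b \<Rightarrow> 'k)
   \<Rightarrow> ('b \<Rightarrow> 'k) \<Rightarrow> ('b \<Rightarrow> 'k) \<Rightarrow> ('b \<Rightarrow> 'k) \<Rightarrow> ('b, 'k) mpoly fract" where
  "gen_sigma_inv mu dl ep x y =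
     (\<Sum>a\<in>UNIV. \<Sum>b\<in>UNIV. \<Sum>c\<in>UNIV. \<Sum>d\<in>UNIV.
        pconst (h_comult dl x (a, b) * h_comult dl y (c, d)) *
        tH (h_mult mu (h_basis a) (h_basis c)) * tinv dl ep (h_basis b) * tinv dl ep (h_basis d))"

inductive_set gen_subalg :: "('v::linorder, 'k::field) mpoly fract set \<Rightarrow> ('v, 'k) mpoly fract set"
  for S where
    const: "pconst c \<in> gen_subalg S"
  | gen: "s \<in> S \<Longrightarrow> s \<in> gen_subalg S"
  | add: "u \<in> gen_subalg S \<Longrightarrow> v \<in> gen_subalg S \<Longrightarrow> u + v \<in> gen_subalg S"
  | mul: "u \<in> gen_subalg S \<Longrightarrow> v \<in> gen_subalg S \<Longrightarrow> u * v \<in> gen_subalg S"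

definition generic_base_algebra :: "('b::{finite,linorder} \<Rightarrow> 'b \<Rightarrow> 'b \<Rightarrow> 'k::field) \<Rightarrow> ('b \<Rightarrow> 'b \<Rightarrow> 'b \<Rightarrow> 'k)
   \<Rightarrow> ('b \<Rightarrow> 'k) \<Rightarrow> ('b, 'k) mpoly fract set" where
  "generic_base_algebra mu dl ep =
     gen_subalg ({gen_sigma mu dl ep x y | x y. True} \<union> {gen_sigma_inv mu dl ep x y | x y. True})"

definition poly_ring :: "nat \<Rightarrow> (nat, 'k::field) mpoly set" where
  "poly_ring m = {p. \<forall>mon\<in>Poly_Mapping.keys p. Poly_Mapping.keys mon \<subseteq> {..<m}}"

definition mult_subset :: "nat \<Rightarrow> (nat, 'k::field) mpoly set \<Rightarrow> bool" where
  "mult_subset m T \<longleftrightarrow> T \<subseteq> poly_ring m \<and> 1 \<in> T \<and> 0 \<notin> T \<and> (\<forall>s\<in>T. \<forall>t\<in>T. s * t \<in> T)"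

definition localization :: "nat \<Rightarrow> (nat, 'k::field) mpoly set \<Rightarrow> (nat, 'k) mpoly fract set" where
  "localization m T = {Fract a s | a s. a \<in> poly_ring m \<and> s \<in> T}"

definition k_alg_iso :: "('v::linorder, 'k::field) mpoly fract set \<Rightarrow> ('w::linorder, 'k) mpoly fract set
   \<Rightarrow> (('v, 'k) mpoly fract \<Rightarrow> ('w, 'k) mpoly fract) \<Rightarrow> bool" where
  "k_alg_iso A B \<phi> \<longleftrightarrow> bij_betw \<phi> A B \<and>
     (\<forall>x\<in>A. \<forall>y\<in>A. \<phi> (x + y) = \<phi> x + \<phi> y \<and> \<phi> (x * y) = \<phi> x * \<phi> y) \<and>
     (\<forall>c. \<forall>x\<in>A. \<phi> (pconst c * x) = pconst c * \<phi> x) \<and> \<phi> 1 = 1"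

end

theory Submission
  imports Defs "HOL.Vector_Spaces"
begin

text \<open>
  Let \<open>\<Gamma>\<close> be the group of group-like elements of \<open>H\<close>, \<open>F\<close> the fraction field of \<open>S(t_H)\<close> and \<open>A\<close> the
  localization of \<open>S(t_H)\<close> at the \<open>t_g\<close> with \<open>g \<in> \<Gamma>\<close>. Since \<open>H\<close> is pointed, it has a basis containing \<open>\<Gamma>\<close>,
  homogeneous for the right coaction of \<open>H_ab = kG\<close>, that is triangular for the right coregular comodule,
  with group-like diagonal \<open>h_i\<close>. By triangularity \<open>t^{-1}\<close> takes values in \<open>A\<close>, and \<open>\<B>_H\<close> consists of
  elements of \<open>A\<close> of degree 1.

  Conversely let \<open>K\<close> be the quotient field of \<open>\<B>_H\<close>. For a \<open>K\<close>-linear endomorphism \<open>\<phi>\<close> of \<open>F\<close>, the operator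
  \<open>\<phi> \<mapsto> t^{-1}_{x_1} \<phi>(t_{x_2} -)\<close> is multiplicative in \<open>x\<close>, hence kills the commutator ideal; it follows that
  every Laurent monomial of degree 1 lies in \<open>K\<close>. Finally \<open>A \<inter> K = \<B>_H\<close>: under the generic translation
  \<open>t_x \<mapsto> s_{x_1} t_{x_2}\<close> the leading coefficient in \<open>s\<close> of an element of \<open>\<B>_H\<close> is a monomial in the
  \<open>t_g\<close>, and it is a unit of \<open>\<B>_H\<close> because \<open>\<Gamma>\<close> is finite; so quotients can be computed by division.
  Thus \<open>\<B>_H\<close> is the span of the Laurent monomials of degree 1, with generators \<open>t_i / t_{h_i}\<close> and a basis of the
  lattice of exponents of degree 1 supported on \<open>\<Gamma>\<close>.
\<close>

section \<open>Evaluation of polynomials and extension to fractions\<close>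

text \<open>Why the operators L_x \<phi> = t^{-1}_{x_1} \<phi>(t_{x_2} -) see only H_ab: t_{xy} and
  t^{-1}_{xy} differ from the products t_x t_y and t^{-1}_x t^{-1}_y by the cocycles \<sigma>^{-1}
  and \<sigma>, which are scalars for \<phi> and cancel, and what is left is symmetric in x and y
  because F is commutative. So an x that vanishes in H_ab acts by 0, which turns \<phi>(t_i z) into
  (t_i / t_{h_i}) \<phi>(t_{h_i} z). Such identities suffice, since a lies in K as soon as \<phi>(a)
  = a \<phi>(1) for all \<phi>. The obstacle is the return from K to \<B>_H, because division of
  elements of \<B>_H might leave it. The translation is adapted to this: the cocycle of the
  translated t is s s \<sigma>(t) s^{-1}, so \<B>_H goes into Laurent polynomials in s with
  coefficients in \<B>_H, and s = \<epsilon> undoes the translation. One linear order, that of the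
  index type, serves both as the order of the triangular basis and as the monomial order behind
  leading terms.\<close>

definition is_ring_hom :: "('a::comm_ring_1 \<Rightarrow> 'r::comm_ring_1) \<Rightarrow> bool" where
  "is_ring_hom h \<longleftrightarrow> h 1 = 1 \<and> (\<forall>a b. h (a + b) = h a + h b) \<and> (\<forall>a b. h (a * b) = h a * h b)"

lemma ring_hom_1: "is_ring_hom h \<Longrightarrow> h 1 = 1"
  and ring_hom_add: "is_ring_hom h \<Longrightarrow> h (a + b) = h a + h b"
  and ring_hom_mult: "is_ring_hom h \<Longrightarrow> h (a * b) = h a * h b"
  by (auto simp: is_ring_hom_def)

lemma ring_hom_0: "is_ring_hom h \<Longrightarrow> h 0 = 0"
  using ring_hom_add[of h 0 0] by simp

lemma ring_hom_minus: "is_ring_hom h \<Longrightarrow> h (- a) = - h a"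
  using ring_hom_add[of h a "- a"] by (simp add: ring_hom_0 add_eq_0_iff)

lemma ring_hom_diff: "is_ring_hom h \<Longrightarrow> h (a - b) = h a - h b"
  using ring_hom_add[of h a "- b"] by (simp add: ring_hom_minus)

lemma ring_hom_sum: "is_ring_hom h \<Longrightarrow> h (sum f A) = (\<Sum>a\<in>A. h (f a))"
  by (induction A rule: infinite_finite_induct) (auto simp: ring_hom_0 ring_hom_add)

lemma ring_hom_power: "is_ring_hom h \<Longrightarrow> h (a ^ n) = h a ^ n"
  by (induction n) (auto simp: ring_hom_1 ring_hom_mult)

lemma id_ring_hom: "is_ring_hom (\<lambda>x. x)"
  by (simp add: is_ring_hom_def)

lemma ring_hom_comp: "is_ring_hom g \<Longrightarrow> is_ring_hom h \<Longrightarrow> is_ring_hom (\<lambda>x. g (h x))"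
  by (simp add: is_ring_hom_def)

lemma field_hom_inverse:
  fixes h :: "'a::field \<Rightarrow> 'r::field"
  assumes "is_ring_hom h"
  shows "h (inverse a) = inverse (h a)"
proof (cases "a = 0")
  case False
  then have "h a * h (inverse a) = 1"
    by (metis assms ring_hom_1 ring_hom_mult right_inverse)
  then show ?thesis
    by (metis inverse_unique)
qed (simp add: assms ring_hom_0)

lemma field_hom_eq_0_iff:
  fixes h :: "'a::field \<Rightarrow> 'r::field"
  assumes "is_ring_hom h"
  shows "h a = 0 \<longleftrightarrow> a = 0"
  using field_hom_inverse[OF assms, of a] ring_hom_mult[OF assms, of a "inverse a"]
  by (metis assms mult_zero_left right_inverse ring_hom_0 ring_hom_1 zero_neq_one)

lemma field_hom_divide:
  fixes h :: "'a::field \<Rightarrow> 'r::field"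
  assumes "is_ring_hom h"
  shows "h (a / b) = h a / h b"
  by (simp add: assms divide_inverse field_hom_inverse ring_hom_mult)

definition mon_ev :: "('v \<Rightarrow> 'r::comm_semiring_1) \<Rightarrow> ('v \<Rightarrow>\<^sub>0 nat) \<Rightarrow> 'r" where
  "mon_ev w m = (\<Prod>v\<in>Poly_Mapping.keys m. w v ^ Poly_Mapping.lookup m v)"

definition poly_ev :: "('k::comm_ring_1 \<Rightarrow> 'r::comm_ring_1) \<Rightarrow> ('v \<Rightarrow> 'r) \<Rightarrow> (('v \<Rightarrow>\<^sub>0 nat) \<Rightarrow>\<^sub>0 'k) \<Rightarrow> 'r" where
  "poly_ev h w p = (\<Sum>m\<in>Poly_Mapping.keys p. h (Poly_Mapping.lookup p m) * mon_ev w m)"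

lemma mon_ev_superset:
  "finite S \<Longrightarrow> Poly_Mapping.keys m \<subseteq> S \<Longrightarrow> mon_ev w m = (\<Prod>v\<in>S. w v ^ Poly_Mapping.lookup m v)"
  unfolding mon_ev_def by (rule prod.mono_neutral_left) (auto simp: in_keys_iff)

lemma mon_ev_add: "mon_ev w (m + n) = mon_ev w m * mon_ev w n"
proof -
  let ?S = "Poly_Mapping.keys m \<union> Poly_Mapping.keys n"
  have "mon_ev w (m + n) = (\<Prod>v\<in>?S. w v ^ Poly_Mapping.lookup (m + n) v)"
    by (rule mon_ev_superset) (simp_all add: keys_add)
  also have "\<dots> = (\<Prod>v\<in>?S. w v ^ Poly_Mapping.lookup m v) * (\<Prod>v\<in>?S. w v ^ Poly_Mapping.lookup n v)"
    by (simp add: lookup_add power_add prod.distrib)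
  also have "\<dots> = mon_ev w m * mon_ev w n"
    by (simp add: mon_ev_superset[of ?S])
  finally show ?thesis .
qed

lemma mon_ev_0 [simp]: "mon_ev w 0 = 1"
  by (simp add: mon_ev_def)

lemma mon_ev_single [simp]: "mon_ev w (Poly_Mapping.single v n) = w v ^ n"
  by (cases "n = 0") (auto simp: mon_ev_def)

lemma poly_ev_superset:
  assumes "is_ring_hom h" "finite S" "Poly_Mapping.keys p \<subseteq> S"
  shows "poly_ev h w p = (\<Sum>m\<in>S. h (Poly_Mapping.lookup p m) * mon_ev w m)"
  unfolding poly_ev_def using assms
  by (intro sum.mono_neutral_left) (auto simp: in_keys_iff ring_hom_0)

lemma poly_ev_add:
  assumes "is_ring_hom h"
  shows "poly_ev h w (p + q) = poly_ev h w p + poly_ev h w q"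
proof -
  let ?S = "Poly_Mapping.keys p \<union> Poly_Mapping.keys q"
  have "poly_ev h w (p + q) = (\<Sum>m\<in>?S. h (Poly_Mapping.lookup (p + q) m) * mon_ev w m)"
    by (rule poly_ev_superset) (simp_all add: assms keys_add)
  also have "\<dots> = (\<Sum>m\<in>?S. h (Poly_Mapping.lookup p m) * mon_ev w m)
       + (\<Sum>m\<in>?S. h (Poly_Mapping.lookup q m) * mon_ev w m)"
    by (simp add: lookup_add ring_hom_add[OF assms] ring_distribs sum.distrib)
  also have "\<dots> = poly_ev h w p + poly_ev h w q"
    by (simp add: poly_ev_superset[OF assms, of ?S])
  finally show ?thesis .
qed

lemma poly_ev_0 [simp]: "poly_ev h w 0 = 0"
  by (simp add: poly_ev_def)

lemma poly_ev_single:
  "is_ring_hom h \<Longrightarrow> poly_ev h w (Poly_Mapping.single m c) = h c * mon_ev w m"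
  by (cases "c = 0") (auto simp: poly_ev_def ring_hom_0)

lemma poly_ev_sum:
  "is_ring_hom h \<Longrightarrow> poly_ev h w (sum f A) = (\<Sum>a\<in>A. poly_ev h w (f a))"
  by (induction A rule: infinite_finite_induct) (auto simp: poly_ev_add)

lemma poly_sum_monomials:
  "p = (\<Sum>m\<in>Poly_Mapping.keys p. Poly_Mapping.single m (Poly_Mapping.lookup p m))"
  by (rule poly_mapping_eqI)
     (auto simp: lookup_sum lookup_single when_def in_keys_iff sum.delta')

lemma poly_ev_mult:
  assumes h: "is_ring_hom h"
  shows "poly_ev h w (p * q) = poly_ev h w p * poly_ev h w q"
proof -
  have "p * q = (\<Sum>m\<in>Poly_Mapping.keys p. Poly_Mapping.single m (Poly_Mapping.lookup p m))
      * (\<Sum>n\<in>Poly_Mapping.keys q. Poly_Mapping.single n (Poly_Mapping.lookup q n))"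
    using poly_sum_monomials[of p] poly_sum_monomials[of q] by simp
  also have "\<dots> = (\<Sum>m\<in>Poly_Mapping.keys p. \<Sum>n\<in>Poly_Mapping.keys q.
        Poly_Mapping.single (m + n) (Poly_Mapping.lookup p m * Poly_Mapping.lookup q n))"
    by (simp add: sum_product mult_single)
  finally have "poly_ev h w (p * q) = (\<Sum>m\<in>Poly_Mapping.keys p. \<Sum>n\<in>Poly_Mapping.keys q.
      h (Poly_Mapping.lookup p m * Poly_Mapping.lookup q n) * mon_ev w (m + n))"
    by (simp add: poly_ev_sum[OF h] poly_ev_single[OF h])
  also have "\<dots> = poly_ev h w p * poly_ev h w q"
    by (simp add: poly_ev_def sum_product mon_ev_add ring_hom_mult[OF h] mult_ac)
  finally show ?thesis .
qed

lemma poly_ev_1: "is_ring_hom h \<Longrightarrow> poly_ev h w 1 = 1"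
  using poly_ev_single[of h w 0 1] by (simp add: ring_hom_1)

lemma poly_ev_ring_hom: "is_ring_hom h \<Longrightarrow> is_ring_hom (poly_ev h w)"
  by (simp add: is_ring_hom_def[of "poly_ev h w"] poly_ev_1 poly_ev_add poly_ev_mult)

text \<open>Constants and variables generate the polynomial ring. This is how composites of
  substitutions are later recognised as the identity or as the inclusion into the fractions.\<close>

lemma ring_hom_poly_eqI:
  fixes f g :: "(('v \<Rightarrow>\<^sub>0 nat) \<Rightarrow>\<^sub>0 'k::comm_ring_1) \<Rightarrow> 'r::comm_ring_1"
  assumes f: "is_ring_hom f" and g: "is_ring_hom g"
    and c: "\<And>c. f (Poly_Mapping.single 0 c) = g (Poly_Mapping.single 0 c)"
    and v: "\<And>v. f (Poly_Mapping.single (Poly_Mapping.single v 1) 1)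
              = g (Poly_Mapping.single (Poly_Mapping.single v 1) 1)"
  shows "f p = g p"
proof -
  have mon: "f (Poly_Mapping.single m 1) = g (Poly_Mapping.single m 1)" for m :: "'v \<Rightarrow>\<^sub>0 nat"
  proof -
    have sing: "f (Poly_Mapping.single (Poly_Mapping.single x n) 1) =
        g (Poly_Mapping.single (Poly_Mapping.single x n) 1)" for x and n :: nat
    proof (induction n)
      case 0
      then show ?case by (simp add: ring_hom_1[OF f] ring_hom_1[OF g])
    next
      case (Suc n)
      have "Poly_Mapping.single (Poly_Mapping.single x (Suc n)) (1::'k) =
          Poly_Mapping.single (Poly_Mapping.single x 1) 1 * Poly_Mapping.single (Poly_Mapping.single x n) 1"
        by (simp add: mult_single flip: single_add)
      then show ?case
        by (simp add: ring_hom_mult[OF f] ring_hom_mult[OF g] Suc v[simplified])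
    qed
    have "finite S \<Longrightarrow> f (Poly_Mapping.single (\<Sum>x\<in>S. Poly_Mapping.single x (Poly_Mapping.lookup m x)) 1)
        = g (Poly_Mapping.single (\<Sum>x\<in>S. Poly_Mapping.single x (Poly_Mapping.lookup m x)) 1)" for S
    proof (induction S rule: finite_induct)
      case (insert x S)
      have "Poly_Mapping.single (\<Sum>x\<in>insert x S. Poly_Mapping.single x (Poly_Mapping.lookup m x)) (1::'k)
         = Poly_Mapping.single (Poly_Mapping.single x (Poly_Mapping.lookup m x)) 1 *
           Poly_Mapping.single (\<Sum>x\<in>S. Poly_Mapping.single x (Poly_Mapping.lookup m x)) 1"
        using insert by (simp add: mult_single)
      then show ?case
        by (simp add: ring_hom_mult[OF f] ring_hom_mult[OF g] insert sing)
    qed (simp add: ring_hom_1[OF f] ring_hom_1[OF g])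
    then show ?thesis
      using poly_sum_monomials[of m] by (metis finite_keys)
  qed
  have "f (Poly_Mapping.single m a) = g (Poly_Mapping.single m a)" for m a
  proof -
    have "Poly_Mapping.single m a = Poly_Mapping.single 0 a * Poly_Mapping.single m 1"
      by (simp add: mult_single)
    then show ?thesis
      by (simp add: ring_hom_mult[OF f] ring_hom_mult[OF g] c mon)
  qed
  then have "f (\<Sum>m\<in>Poly_Mapping.keys p. Poly_Mapping.single m (Poly_Mapping.lookup p m)) =
     g (\<Sum>m\<in>Poly_Mapping.keys p. Poly_Mapping.single m (Poly_Mapping.lookup p m))"
    by (simp add: ring_hom_sum[OF f] ring_hom_sum[OF g])
  then show ?thesis
    using poly_sum_monomials[of p] by simp
qed

section \<open>Extension of homomorphisms to fractions\<close>

lemma Fract_1_ring_hom: "is_ring_hom (\<lambda>a. Fract a 1)"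
  by (simp add: is_ring_hom_def One_fract_def)

lemma Fract_1_eq_0_iff: "Fract a 1 = 0 \<longleftrightarrow> a = 0"
  by (simp add: Zero_fract_def eq_fract)

lemma single_0_ring_hom: "is_ring_hom (\<lambda>c. Poly_Mapping.single 0 c :: ('v \<Rightarrow>\<^sub>0 nat) \<Rightarrow>\<^sub>0 'k::comm_ring_1)"
  by (simp add: is_ring_hom_def single_add mult_single)

lemma pconst_ring_hom: "is_ring_hom pconst"
  unfolding pconst_def by (rule ring_hom_comp[OF Fract_1_ring_hom single_0_ring_hom])

text \<open>A junk value unless h is injective on D and x is a fraction with numerator and denominator in D.\<close>
definition fract_ext :: "'a::idom set \<Rightarrow> ('a \<Rightarrow> 'r::field) \<Rightarrow> 'a fract \<Rightarrow> 'r" where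
  "fract_ext D h x = (THE y. \<exists>a\<in>D. \<exists>b\<in>D. b \<noteq> 0 \<and> x = Fract a b \<and> y = h a / h b)"

definition subring_on :: "'a::comm_ring_1 set \<Rightarrow> bool" where
  "subring_on D \<longleftrightarrow> 1 \<in> D \<and> (\<forall>a\<in>D. \<forall>b\<in>D. a + b \<in> D \<and> a * b \<in> D)"

text \<open>Equal fractions satisfy \<open>a * b' = a' * b\<close>, an equation that
  \<open>h\<close> preserves; injectivity on \<open>D\<close> keeps the denominators nonzero, so the
  value is unique.\<close>

lemma fract_ext_Fract:
  assumes h: "is_ring_hom h" and inj: "\<And>a. a \<in> D \<Longrightarrow> h a = 0 \<Longrightarrow> a = 0"
    and "a \<in> D" "b \<in> D" "b \<noteq> 0"
  shows "fract_ext D h (Fract a b) = h a / h b"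
  unfolding fract_ext_def
proof (rule the_equality)
  show "\<exists>a'\<in>D. \<exists>b'\<in>D. b' \<noteq> 0 \<and> Fract a b = Fract a' b' \<and> h a / h b = h a' / h b'"
    using assms by blast
next
  fix y assume "\<exists>a'\<in>D. \<exists>b'\<in>D. b' \<noteq> 0 \<and> Fract a b = Fract a' b' \<and> y = h a' / h b'"
  then obtain a' b' where ab: "a' \<in> D" "b' \<in> D" "b' \<noteq> 0" "Fract a b = Fract a' b'" "y = h a' / h b'"
    by blast
  then have "a * b' = a' * b"
    using assms by (simp add: eq_fract)
  then have "h a * h b' = h a' * h b"
    by (metis h ring_hom_mult)
  moreover have "h b \<noteq> 0" "h b' \<noteq> 0"
    using ab assms inj by blast+
  ultimately show "y = h a / h b"
    using ab by (simp add: frac_eq_eq)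
qed

lemma fract_ext_add_mult:
  assumes h: "is_ring_hom h" and inj: "\<And>a. a \<in> D \<Longrightarrow> h a = 0 \<Longrightarrow> a = 0" and D: "subring_on D"
    and ab: "a \<in> D" "b \<in> D" "b \<noteq> 0" and cd: "c \<in> D" "d \<in> D" "d \<noteq> 0"
  shows "fract_ext D h (Fract a b + Fract c d) = fract_ext D h (Fract a b) + fract_ext D h (Fract c d)"
    and "fract_ext D h (Fract a b * Fract c d) = fract_ext D h (Fract a b) * fract_ext D h (Fract c d)"
proof -
  have nz: "h b \<noteq> 0" "h d \<noteq> 0"
    using ab cd inj by blast+
  note ev = fract_ext_Fract[OF h inj]
  have "fract_ext D h (Fract (a * d + c * b) (b * d)) = h (a * d + c * b) / h (b * d)"
    by (rule ev) (use ab cd D in \<open>auto simp: subring_on_def\<close>)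
  then show "fract_ext D h (Fract a b + Fract c d) = fract_ext D h (Fract a b) + fract_ext D h (Fract c d)"
    using nz by (simp add: ab cd ev add_frac_eq ring_hom_add[OF h] ring_hom_mult[OF h])
  have "fract_ext D h (Fract (a * c) (b * d)) = h (a * c) / h (b * d)"
    by (rule ev) (use ab cd D in \<open>auto simp: subring_on_def\<close>)
  then show "fract_ext D h (Fract a b * Fract c d) = fract_ext D h (Fract a b) * fract_ext D h (Fract c d)"
    by (simp add: ab cd ev ring_hom_mult[OF h])
qed

lemma fract_ext_UNIV_ring_hom:
  assumes h: "is_ring_hom h" and inj: "\<And>a. h a = 0 \<Longrightarrow> a = 0"
  shows "is_ring_hom (fract_ext UNIV h)"
proof -
  have *: "subring_on UNIV" by (simp add: subring_on_def)
  have "fract_ext UNIV h 1 = 1"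
    using fract_ext_Fract[of h UNIV 1 1] h inj by (simp add: One_fract_def ring_hom_1)
  moreover have "fract_ext UNIV h (x + y) = fract_ext UNIV h x + fract_ext UNIV h y"
    and "fract_ext UNIV h (x * y) = fract_ext UNIV h x * fract_ext UNIV h y" for x y
    by (cases x; cases y; simp only:, rule fract_ext_add_mult; use assms * in auto)+
  ultimately show ?thesis by (simp add: is_ring_hom_def)
qed

section \<open>Convolution, functionals over subfields, lattices\<close>

lemma sum_delta_mult:
  fixes f :: "'i::finite \<Rightarrow> 'r::comm_semiring_1"
  shows "(\<Sum>a\<in>UNIV. f a * (if i = a then 1 else 0)) = f i"
    and "(\<Sum>a\<in>UNIV. f a * (if a = i then 1 else 0)) = f i"
    and "(\<Sum>a\<in>UNIV. (if i = a then 1 else 0) * f a) = f i"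
    and "(\<Sum>a\<in>UNIV. (if a = i then 1 else 0) * f a) = f i"
proof -
  have "(\<Sum>a\<in>UNIV. f a * (if i = a then 1 else 0)) = (\<Sum>a\<in>UNIV. if i = a then f a else 0)"
    by (rule sum.cong) auto
  then show "(\<Sum>a\<in>UNIV. f a * (if i = a then 1 else 0)) = f i" by simp
  then show "(\<Sum>a\<in>UNIV. f a * (if a = i then 1 else 0)) = f i"
    and "(\<Sum>a\<in>UNIV. (if i = a then 1 else 0) * f a) = f i"
    and "(\<Sum>a\<in>UNIV. (if a = i then 1 else 0) * f a) = f i"
    by (simp_all only: mult.commute eq_commute)
qed

lemma solve_linear_eq: "x = a * y + a * s \<Longrightarrow> a \<noteq> 0 \<Longrightarrow> y = x / a - s" for x a y s :: "'r::field"
  by (simp add: field_simps)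

text \<open>The convolution product of linear maps from the coalgebra with constants
  \<open>c\<close> to the field \<open>'r\<close>. A map is recorded by its values on the basis, and
  scalars enter through the embedding \<open>h\<close>.\<close>

definition conv :: "('k::field \<Rightarrow> 'r::field) \<Rightarrow> ('i::finite \<Rightarrow> 'i \<Rightarrow> 'i \<Rightarrow> 'k) \<Rightarrow> ('i \<Rightarrow> 'r) \<Rightarrow> ('i \<Rightarrow> 'r) \<Rightarrow> 'i \<Rightarrow> 'r" where
  "conv h c f g i = (\<Sum>a\<in>UNIV. \<Sum>b\<in>UNIV. h (c i a b) * f a * g b)"

text \<open>The matrix of the operator x -> x_1 f(x_2): row \<open>i\<close> holds the coordinates
  of the image of e_i.\<close>

definition comat :: "('k::field \<Rightarrow> 'r::field) \<Rightarrow> ('i::finite \<Rightarrow> 'i \<Rightarrow> 'i \<Rightarrow> 'k) \<Rightarrow> ('i \<Rightarrow> 'r) \<Rightarrow> 'i \<Rightarrow> 'i \<Rightarrow> 'r" where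
  "comat h c f i a = (\<Sum>b\<in>UNIV. h (c i a b) * f b)"

locale coalg_consts =
  fixes c :: "'i::finite \<Rightarrow> 'i \<Rightarrow> 'i \<Rightarrow> 'k::field" and ep :: "'i \<Rightarrow> 'k"
  assumes coassoc: "(\<Sum>p\<in>UNIV. c i p z * c p a b) = (\<Sum>p\<in>UNIV. c i a p * c p b z)"
    and counit_l: "(\<Sum>p\<in>UNIV. ep p * c i p l) = (if i = l then 1 else 0)"
    and counit_r: "(\<Sum>p\<in>UNIV. c i l p * ep p) = (if i = l then 1 else 0)"
begin

lemma conv_comat: "conv h c f g i = (\<Sum>a\<in>UNIV. f a * comat h c g i a)"
  unfolding conv_def comat_def by (simp add: sum_distrib_left mult_ac)

text \<open>Coassociativity read as a matrix identity: passing from a map to its matrix reverses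
  products. Associativity and inverses for convolution thereby become matrix algebra.\<close>

lemma comat_conv:
  assumes h: "is_ring_hom h"
  shows "comat h c (conv h c f g) i a = (\<Sum>b\<in>UNIV. comat h c g i b * comat h c f b a)"
proof -
  have co: "(\<Sum>b\<in>UNIV. h (c i a b) * h (c b p q)) = (\<Sum>b\<in>UNIV. h (c i b q) * h (c b a p))" for p q
    using arg_cong[OF coassoc[where i=i and z=q and a=a and b=p], of h]
    by (simp add: ring_hom_sum[OF h] ring_hom_mult[OF h])
  have "comat h c (conv h c f g) i a =
      (\<Sum>b\<in>UNIV. \<Sum>p\<in>UNIV. \<Sum>q\<in>UNIV. h (c i a b) * h (c b p q) * (f p * g q))"
    unfolding comat_def conv_def by (simp add: sum_distrib_left mult_ac)
  also have "\<dots> = (\<Sum>p\<in>UNIV. \<Sum>q\<in>UNIV. \<Sum>b\<in>UNIV. h (c i a b) * h (c b p q) * (f p * g q))"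
    by (subst sum.swap, rule sum.cong[OF refl], rule sum.swap)
  also have "\<dots> = (\<Sum>p\<in>UNIV. \<Sum>q\<in>UNIV. \<Sum>b\<in>UNIV. h (c i b q) * h (c b a p) * (f p * g q))"
    by (simp only: co flip: sum_distrib_right)
  also have "\<dots> = (\<Sum>b\<in>UNIV. \<Sum>p\<in>UNIV. \<Sum>q\<in>UNIV. h (c i b q) * h (c b a p) * (f p * g q))"
    by (subst (2) sum.swap, rule sum.cong[OF refl], rule sum.swap)
  also have "\<dots> = (\<Sum>b\<in>UNIV. comat h c g i b * comat h c f b a)"
    unfolding comat_def sum_product
    by (rule sum.cong[OF refl], subst sum.swap) (simp add: mult_ac)
  finally show ?thesis .
qed

lemma comat_unit:
  assumes h: "is_ring_hom h"
  shows "comat h c (\<lambda>i. h (ep i)) i a = (if i = a then 1 else 0)"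
  using arg_cong[OF counit_r[of i a], of h]
  by (simp add: comat_def ring_hom_sum[OF h] ring_hom_mult[OF h] ring_hom_0[OF h] ring_hom_1[OF h] split: if_splits)

lemma conv_unit_r: "is_ring_hom h \<Longrightarrow> conv h c f (\<lambda>i. h (ep i)) = f"
  by (rule ext) (simp only: conv_comat comat_unit sum_delta_mult)

text \<open>The counit on the first leg recovers \<open>f\<close> from its matrix, so that what is
  known about all matrix entries passes to \<open>f\<close> itself.\<close>

lemma sum_ep_comat:
  assumes h: "is_ring_hom h"
  shows "(\<Sum>a\<in>UNIV. h (ep a) * comat h c f i a) = f i"
proof -
  have "(\<Sum>a\<in>UNIV. h (ep a) * comat h c f i a) = (\<Sum>b\<in>UNIV. (\<Sum>a\<in>UNIV. h (ep a) * h (c i a b)) * f b)"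
    unfolding comat_def sum_distrib_left sum_distrib_right by (subst sum.swap) (simp add: mult_ac)
  also have "\<dots> = (\<Sum>b\<in>UNIV. (if i = b then 1 else 0) * f b)"
  proof (rule sum.cong[OF refl])
    fix b
    show "(\<Sum>a\<in>UNIV. h (ep a) * h (c i a b)) * f b = (if i = b then 1 else 0) * f b"
      using arg_cong[OF counit_l[of i b], of h]
      by (simp add: ring_hom_sum[OF h] ring_hom_mult[OF h] ring_hom_0[OF h] ring_hom_1[OF h] split: if_splits)
  qed
  finally show ?thesis by (simp only: sum_delta_mult)
qed

lemma conv_unit_l: "is_ring_hom h \<Longrightarrow> conv h c (\<lambda>i. h (ep i)) f = f"
  by (rule ext) (simp add: conv_comat sum_ep_comat)

lemma conv_assoc:
  assumes h: "is_ring_hom h"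
  shows "conv h c (conv h c f g) k = conv h c f (conv h c g k)"
proof
  fix i
  have "conv h c (conv h c f g) k i = (\<Sum>a\<in>UNIV. \<Sum>b\<in>UNIV. f b * comat h c g a b * comat h c k i a)"
    by (simp add: conv_comat sum_distrib_right)
  also have "\<dots> = (\<Sum>b\<in>UNIV. \<Sum>a\<in>UNIV. f b * comat h c g a b * comat h c k i a)"
    by (rule sum.swap)
  also have "\<dots> = conv h c f (conv h c g k) i"
    by (subst conv_comat) (simp add: comat_conv[OF h] sum_distrib_left mult_ac)
  finally show "conv h c (conv h c f g) k i = conv h c f (conv h c g k) i" .
qed

lemma conv_inverse_unique:
  assumes h: "is_ring_hom h"
    and "conv h c g f = (\<lambda>i. h (ep i))" "conv h c f g' = (\<lambda>i. h (ep i))"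
  shows "g = g'"
proof -
  have "g = conv h c g (conv h c f g')"
    by (simp only: assms(3) conv_unit_r[OF h])
  also have "\<dots> = g'"
    by (simp only: conv_assoc[OF h, symmetric] assms(2) conv_unit_l[OF h])
  finally show ?thesis .
qed

text \<open>A triangular system of equations, solved by recursion along r.\<close>
lemma conv_inverse_exists:
  fixes r :: "'i \<Rightarrow> nat"
  assumes h: "is_ring_hom h"
    and tri: "\<And>i a b. c i a b \<noteq> 0 \<Longrightarrow> a = i \<or> r a < r i"
    and diag: "\<And>i. comat h c f i i \<noteq> 0"
  obtains g where "conv h c g f = (\<lambda>i. h (ep i))" "conv h c f g = (\<lambda>i. h (ep i))"
proof -
  have tri': "comat h c f i a = 0" if "a \<noteq> i" "\<not> r a < r i" for i a
  proof -
    have "c i a b = 0" for b using that tri[of i a b] by blast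
    then show ?thesis by (simp add: comat_def ring_hom_0[OF h])
  qed
  define Phi where "Phi g i = (h (ep i) - (\<Sum>a\<in>{a. r a < r i}. g a * comat h c f i a)) / comat h c f i i"
    for g i
  have "adm_wf (measure r) Phi"
    by (auto simp: adm_wf_def Phi_def)
  then have "wfrec (measure r) Phi = Phi (wfrec (measure r) Phi)"
    by (rule wfrec_fixpoint[OF wf_measure])
  then obtain g where g: "g = Phi g" by metis
  have split: "conv h c g f i = g i * comat h c f i i + (\<Sum>a\<in>{a. r a < r i}. g a * comat h c f i a)" for g i
  proof -
    have "conv h c g f i = (\<Sum>a\<in>insert i {a. r a < r i}. g a * comat h c f i a)"
      unfolding conv_comat by (rule sum.mono_neutral_right) (use tri' in auto)
    then show ?thesis by simp
  qed
  have gf: "conv h c g f = (\<lambda>i. h (ep i))"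
  proof
    fix i
    have "g i * comat h c f i i = h (ep i) - (\<Sum>a\<in>{a. r a < r i}. g a * comat h c f i a)"
      by (subst g) (simp add: Phi_def diag)
    then show "conv h c g f i = h (ep i)" by (simp add: split)
  qed
  have inj: "g1 = g2" if eq: "conv h c g1 f = conv h c g2 f" for g1 g2
  proof
    fix i
    show "g1 i = g2 i"
    proof (induction "r i" arbitrary: i rule: less_induct)
      case less
      have "(\<Sum>a\<in>{a. r a < r i}. g1 a * comat h c f i a) = (\<Sum>a\<in>{a. r a < r i}. g2 a * comat h c f i a)"
        using less by (intro sum.cong) auto
      then show ?case
        using fun_cong[OF eq, of i] diag[of i] by (simp add: split)
    qed
  qed
  \<comment> \<open>The left inverse is also a right inverse: convolution by \<open>f\<close> from
    the right is injective by the same triangularity, and both sides agree after it.\<close>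
  have "conv h c f g = (\<lambda>i. h (ep i))"
    by (rule inj) (simp add: conv_assoc[OF h] gf conv_unit_l[OF h] conv_unit_r[OF h])
  with gf show ?thesis by (rule that)
qed

text \<open>Locates the entries of the inverse matrix. Since the matrices of \<open>f\<close> and
  \<open>g\<close> multiply to 1, row \<open>i\<close> of the inverse is expressed through rows of
  smaller \<open>r\<close>, and the recursion never leaves column \<open>j\<close>; hence a set
  \<open>Y j\<close> for each column. With \<open>Y\<close> a family of graded pieces this controls
  degrees, with \<open>Y\<close> constant it controls denominators.\<close>

lemma comat_inverse_mem:
  fixes r :: "'i \<Rightarrow> nat"
  assumes h: "is_ring_hom h"
    and tri: "\<And>i a b. c i a b \<noteq> 0 \<Longrightarrow> a = i \<or> r a < r i"
    and diag: "\<And>i. comat h c f i i \<noteq> 0"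
    and gf: "conv h c g f = (\<lambda>i. h (ep i))"
    and Y0: "\<And>j. 0 \<in> Y j"
    and Yd: "\<And>j x y. x \<in> Y j \<Longrightarrow> y \<in> Y j \<Longrightarrow> x - y \<in> Y j"
    and Y1: "\<And>i. 1 / comat h c f i i \<in> Y i"
    and Ym: "\<And>i k j z. z \<in> Y j \<Longrightarrow> comat h c f i k * z / comat h c f i i \<in> Y j"
  shows "comat h c g i j \<in> Y j"
proof (induction "r i" arbitrary: i rule: less_induct)
  case less
  have tri': "comat h c f i a = 0" if "a \<noteq> i" "\<not> r a < r i" for i a
  proof -
    have "c i a b = 0" for b using that tri[of i a b] by blast
    then show ?thesis by (simp add: comat_def ring_hom_0[OF h])
  qed
  have Ya: "x + y \<in> Y j" if "x \<in> Y j" "y \<in> Y j" for x y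
    using Yd[OF that(1) Yd[OF Y0 that(2)]] by simp
  let ?S = "\<Sum>k\<in>{k. r k < r i}. comat h c f i k * comat h c g k j / comat h c f i i"
  have "(if i = j then 1 else 0) = (\<Sum>k\<in>UNIV. comat h c f i k * comat h c g k j)"
    using comat_conv[OF h, of g f i j] gf comat_unit[OF h, of i j] by simp
  also have "\<dots> = (\<Sum>k\<in>insert i {k. r k < r i}. comat h c f i k * comat h c g k j)"
    by (rule sum.mono_neutral_right) (use tri' in auto)
  also have "\<dots> = comat h c f i i * comat h c g i j + comat h c f i i * ?S"
    using diag[of i] by (simp add: sum_distrib_left)
  finally have "comat h c g i j = (if i = j then 1 else 0) / comat h c f i i - ?S"
    using diag[of i] by (rule solve_linear_eq)
  then have "comat h c g i j = (if i = j then 1 / comat h c f i i else 0) - ?S"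
    by simp
  moreover have "?S \<in> Y j"
  proof -
    have "finite A \<Longrightarrow> A \<subseteq> {k. r k < r i} \<Longrightarrow>
      (\<Sum>k\<in>A. comat h c f i k * comat h c g k j / comat h c f i i) \<in> Y j" for A
      by (induction A rule: finite_induct) (use less Y0 Ym Ya in auto)
    then show ?thesis by simp
  qed
  ultimately show ?case using Y0 Y1 Yd by simp
qed

end

text \<open>Structure constants of the tensor square, so that maps in two arguments x, y are
  convolved like maps on H.\<close>

definition pair_c :: "('i \<Rightarrow> 'i \<Rightarrow> 'i \<Rightarrow> 'k::field) \<Rightarrow> 'i \<times> 'i \<Rightarrow> 'i \<times> 'i \<Rightarrow> 'i \<times> 'i \<Rightarrow> 'k" where
  "pair_c c = (\<lambda>(i, k) (a, b) (x, y). c i a x * c k b y)"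

definition pair_ep :: "('i \<Rightarrow> 'k::field) \<Rightarrow> 'i \<times> 'i \<Rightarrow> 'k" where
  "pair_ep e = (\<lambda>(i, k). e i * e k)"

lemma sum_UNIV_pair: "(\<Sum>p\<in>(UNIV :: ('i::finite \<times> 'j::finite) set). f p) = (\<Sum>a\<in>UNIV. \<Sum>b\<in>UNIV. f (a, b))"
  by (simp add: sum.cartesian_product flip: UNIV_Times_UNIV)

lemma (in coalg_consts) pair_coalg: "coalg_consts (pair_c c) (pair_ep ep)"
proof
  fix i z a b :: "'i \<times> 'i"
  show "(\<Sum>p\<in>UNIV. pair_c c i p z * pair_c c p a b) = (\<Sum>p\<in>UNIV. pair_c c i a p * pair_c c p b z)"
  proof (cases i; cases z; cases a; cases b)
    fix i1 i2 z1 z2 a1 a2 b1 b2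
    assume eqs: "i = (i1, i2)" "z = (z1, z2)" "a = (a1, a2)" "b = (b1, b2)"
    have "(\<Sum>p\<in>UNIV. pair_c c i p z * pair_c c p a b) =
      (\<Sum>p\<in>UNIV. c i1 p z1 * c p a1 b1) * (\<Sum>p\<in>UNIV. c i2 p z2 * c p a2 b2)"
      by (simp add: eqs sum_UNIV_pair pair_c_def sum_product mult_ac)
    also have "\<dots> = (\<Sum>p\<in>UNIV. c i1 a1 p * c p b1 z1) * (\<Sum>p\<in>UNIV. c i2 a2 p * c p b2 z2)"
      by (simp only: coassoc)
    also have "\<dots> = (\<Sum>p\<in>UNIV. pair_c c i a p * pair_c c p b z)"
      by (simp add: eqs sum_UNIV_pair pair_c_def sum_product mult_ac)
    finally show ?thesis .
  qed
next
  fix i l :: "'i \<times> 'i"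
  obtain i1 i2 l1 l2 where eqs: "i = (i1, i2)" "l = (l1, l2)" by (cases i; cases l)
  have "(\<Sum>p\<in>UNIV. pair_ep ep p * pair_c c i p l) =
      (\<Sum>p\<in>UNIV. ep p * c i1 p l1) * (\<Sum>p\<in>UNIV. ep p * c i2 p l2)"
    by (simp add: eqs sum_UNIV_pair pair_c_def pair_ep_def sum_product mult_ac)
  then show "(\<Sum>p\<in>UNIV. pair_ep ep p * pair_c c i p l) = (if i = l then 1 else 0)"
    by (simp add: counit_l eqs)
  have "(\<Sum>p\<in>UNIV. pair_c c i l p * pair_ep ep p) =
      (\<Sum>p\<in>UNIV. c i1 l1 p * ep p) * (\<Sum>p\<in>UNIV. c i2 l2 p * ep p)"
    by (simp add: eqs sum_UNIV_pair pair_c_def pair_ep_def sum_product mult_ac)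
  then show "(\<Sum>p\<in>UNIV. pair_c c i l p * pair_ep ep p) = (if i = l then 1 else 0)"
    by (simp add: counit_r eqs)
qed

text \<open>The composite of \<open>f\<close> with the multiplication, as a map on the tensor
  square.\<close>

definition mulf :: "('k::field \<Rightarrow> 'r::field) \<Rightarrow> ('i::finite \<Rightarrow> 'i \<Rightarrow> 'i \<Rightarrow> 'k) \<Rightarrow> ('i \<Rightarrow> 'r) \<Rightarrow> 'i \<times> 'i \<Rightarrow> 'r" where
  "mulf h m f = (\<lambda>(i, j). \<Sum>l\<in>UNIV. h (m i j l) * f l)"

definition tensf :: "('i \<Rightarrow> 'r::field) \<Rightarrow> ('i \<Rightarrow> 'r) \<Rightarrow> 'i \<times> 'i \<Rightarrow> 'r" where
  "tensf f g = (\<lambda>(i, j). f i * g j)"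

lemma conv_tensf:
  fixes h :: "'k::field \<Rightarrow> 'r::field" and c :: "'i::finite \<Rightarrow> 'i \<Rightarrow> 'i \<Rightarrow> 'k"
  assumes h: "is_ring_hom h"
  shows "conv h (pair_c c) (tensf f f') (tensf g g') = tensf (conv h c f g) (conv h c f' g')"
proof
  fix p :: "'i \<times> 'i"
  obtain i k where p: "p = (i, k)" by (cases p)
  let ?X = "\<lambda>a b. h (c i a b) * f a * g b" and ?Y = "\<lambda>a b. h (c k a b) * f' a * g' b"
  have "conv h (pair_c c) (tensf f f') (tensf g g') p = (\<Sum>a1\<in>UNIV. \<Sum>a2\<in>UNIV. \<Sum>b1\<in>UNIV. \<Sum>b2\<in>UNIV. ?X a1 b1 * ?Y a2 b2)"
    by (simp add: conv_def p sum_UNIV_pair pair_c_def tensf_def ring_hom_mult[OF h] mult_ac)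
  also have "\<dots> = (\<Sum>a1\<in>UNIV. \<Sum>a2\<in>UNIV. (\<Sum>b1\<in>UNIV. ?X a1 b1) * (\<Sum>b2\<in>UNIV. ?Y a2 b2))"
    by (simp only: sum_product)
  also have "\<dots> = tensf (conv h c f g) (conv h c f' g') p"
    by (simp only: conv_def p tensf_def prod.case sum_product)
  finally show "conv h (pair_c c) (tensf f f') (tensf g g') p = tensf (conv h c f g) (conv h c f' g') p" .
qed

text \<open>The multiplication of a bialgebra is a coalgebra map, so composition with it respects
  convolution.\<close>

lemma conv_mulf:
  fixes h :: "'k::field \<Rightarrow> 'r::field" and c m :: "'i::finite \<Rightarrow> 'i \<Rightarrow> 'i \<Rightarrow> 'k"
  assumes h: "is_ring_hom h"
    and bialg: "\<And>i j a b. (\<Sum>p\<in>UNIV. m i j p * c p a b) =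
        (\<Sum>a1\<in>UNIV. \<Sum>b1\<in>UNIV. \<Sum>a2\<in>UNIV. \<Sum>b2\<in>UNIV. c i a1 b1 * c j a2 b2 * m a1 a2 a * m b1 b2 b)"
  shows "mulf h m (conv h c f g) = conv h (pair_c c) (mulf h m f) (mulf h m g)"
proof
  fix x :: "'i \<times> 'i"
  obtain i j where x: "x = (i, j)" by (cases x)
  let ?X = "\<lambda>a1 b1 a2 b2 a b. h (c i a1 b1) * h (c j a2 b2) * h (m a1 a2 a) * h (m b1 b2 b) * f a * g b"
  have "mulf h m (conv h c f g) x = (\<Sum>l\<in>UNIV. \<Sum>a\<in>UNIV. \<Sum>b\<in>UNIV. h (m i j l) * h (c l a b) * (f a * g b))"
    by (simp add: mulf_def x conv_def sum_distrib_left mult_ac)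
  also have "\<dots> = (\<Sum>a\<in>UNIV. \<Sum>b\<in>UNIV. \<Sum>l\<in>UNIV. h (m i j l) * h (c l a b) * (f a * g b))"
    by (subst sum.swap, rule sum.cong[OF refl], rule sum.swap)
  also have "\<dots> = (\<Sum>a\<in>UNIV. \<Sum>b\<in>UNIV. h (\<Sum>l\<in>UNIV. m i j l * c l a b) * (f a * g b))"
    by (simp add: ring_hom_sum[OF h] ring_hom_mult[OF h] sum_distrib_right)
  also have "\<dots> = (\<Sum>a\<in>UNIV. \<Sum>b\<in>UNIV. \<Sum>a1\<in>UNIV. \<Sum>b1\<in>UNIV. \<Sum>a2\<in>UNIV. \<Sum>b2\<in>UNIV. ?X a1 b1 a2 b2 a b)"
    unfolding bialg ring_hom_sum[OF h] ring_hom_mult[OF h] sum_distrib_right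
    by (intro sum.cong refl) (simp only: mult_ac)
  also have "\<dots> = (\<Sum>a1\<in>UNIV. \<Sum>a2\<in>UNIV. \<Sum>b1\<in>UNIV. \<Sum>b2\<in>UNIV. \<Sum>a\<in>UNIV. \<Sum>b\<in>UNIV. ?X a1 b1 a2 b2 a b)"
    unfolding sum.cartesian_product
    by (rule sum.reindex_bij_witness[where i = "\<lambda>(a1,a2,b1,b2,a,b). (a,b,a1,b1,a2,b2)"
        and j = "\<lambda>(a,b,a1,b1,a2,b2). (a1,a2,b1,b2,a,b)"]) auto
  also have "\<dots> = (\<Sum>a1\<in>UNIV. \<Sum>a2\<in>UNIV. \<Sum>b1\<in>UNIV. \<Sum>b2\<in>UNIV. h (c i a1 b1) * h (c j a2 b2) *
      ((\<Sum>a\<in>UNIV. h (m a1 a2 a) * f a) * (\<Sum>b\<in>UNIV. h (m b1 b2 b) * g b)))"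
    unfolding sum_product unfolding sum_distrib_left by (intro sum.cong refl) (simp only: mult_ac)
  also have "\<dots> = conv h (pair_c c) (mulf h m f) (mulf h m g) x"
    by (simp only: conv_def x sum_UNIV_pair pair_c_def mulf_def ring_hom_mult[OF h] prod.case mult.assoc)
  finally show "mulf h m (conv h c f g) x = conv h (pair_c c) (mulf h m f) (mulf h m g) x" .
qed

section \<open>Linear functionals over a subfield\<close>

definition subfield_on :: "'a::field set \<Rightarrow> bool" where
  "subfield_on K \<longleftrightarrow> 1 \<in> K \<and> (\<forall>x\<in>K. \<forall>y\<in>K. x - y \<in> K \<and> x * y \<in> K \<and> x / y \<in> K)"

text \<open>The field is split as W + K a, where W is a maximal K-subspace that contains 1 and
  misses a; the functional reads off the coefficient of a. Zorn's lemma is applied to subspaces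
  directly, without choosing a basis over K.\<close>

lemma exists_functional_over_subfield:
  fixes K :: "'a::field set"
  assumes K: "subfield_on K" and a: "a \<notin> K"
  obtains ph :: "'a \<Rightarrow> 'a" where "\<And>x y. ph (x + y) = ph x + ph y" "\<And>k x. k \<in> K \<Longrightarrow> ph (k * x) = k * ph x"
    "ph 1 = 0" "ph a = 1"
proof -
  have K1: "1 \<in> K" and Kd: "\<And>x y. x \<in> K \<Longrightarrow> y \<in> K \<Longrightarrow> x - y \<in> K" and Km: "\<And>x y. x \<in> K \<Longrightarrow> y \<in> K \<Longrightarrow> x * y \<in> K"
    and Kq: "\<And>x y. x \<in> K \<Longrightarrow> y \<in> K \<Longrightarrow> x / y \<in> K"
    using K by (auto simp: subfield_on_def)
  have K0: "0 \<in> K" using Kd[OF K1 K1] by simp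
  have Kn: "- x \<in> K" if "x \<in> K" for x using Kd[OF K0 that] by simp
  have Ka: "x + y \<in> K" if "x \<in> K" "y \<in> K" for x y using Kd[OF that(1) Kn[OF that(2)]] by simp
  define sub where "sub W \<longleftrightarrow> (\<forall>x\<in>W. \<forall>y\<in>W. x + y \<in> W) \<and> (\<forall>k\<in>K. \<forall>x\<in>W. k * x \<in> W)" for W :: "'a set"
  let ?A = "{W. sub W \<and> 1 \<in> W \<and> a \<notin> W}"
  have "K \<in> ?A" using K1 Ka Km a by (auto simp: sub_def)
  moreover have "\<Union>C \<in> ?A" if ne: "C \<noteq> {}" and chain: "subset.chain ?A C" for C
  proof -
    have C: "sub X" "1 \<in> X" "a \<notin> X" if "X \<in> C" for X
      using chain that by (auto simp: subset.chain_def)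
    have tot: "X \<subseteq> Y \<or> Y \<subseteq> X" if "X \<in> C" "Y \<in> C" for X Y
      using chain that by (auto simp: subset.chain_def)
    have "x + y \<in> \<Union>C" if xy: "x \<in> \<Union>C" "y \<in> \<Union>C" for x y
    proof -
      obtain X Y where XY: "X \<in> C" "Y \<in> C" "x \<in> X" "y \<in> Y" using xy by auto
      then have "x \<in> X \<and> y \<in> X \<or> x \<in> Y \<and> y \<in> Y" using tot[of X Y] by auto
      then have "x + y \<in> X \<or> x + y \<in> Y" using XY C(1)[of X] C(1)[of Y] by (auto simp: sub_def)
      then show ?thesis using XY by blast
    qed
    moreover have "k * x \<in> \<Union>C" if "k \<in> K" "x \<in> \<Union>C" for k x
    proof -
      obtain X where "X \<in> C" "x \<in> X" using \<open>x \<in> \<Union>C\<close> by auto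
      moreover from this have "k * x \<in> X" using C(1)[of X] \<open>k \<in> K\<close> by (auto simp: sub_def)
      ultimately show ?thesis by blast
    qed
    ultimately have "sub (\<Union>C)" unfolding sub_def by simp
    moreover have "1 \<in> \<Union>C" using ne C(2) by auto
    moreover have "a \<notin> \<Union>C" using C(3) by auto
    ultimately show ?thesis by simp
  qed
  ultimately have "\<exists>M\<in>?A. \<forall>X\<in>?A. M \<subseteq> X \<longrightarrow> X = M"
    by (intro subset_Zorn_nonempty) blast+
  then obtain W where W: "W \<in> ?A" and max: "\<And>X. X \<in> ?A \<Longrightarrow> W \<subseteq> X \<Longrightarrow> X = W"
    by blast
  have Ws: "sub W" and W1: "1 \<in> W" and aW: "a \<notin> W" using W by auto
  have Wa: "x + y \<in> W" if "x \<in> W" "y \<in> W" for x y using Ws that by (simp add: sub_def)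
  have Wk: "k * x \<in> W" if "k \<in> K" "x \<in> W" for k x using Ws that by (simp add: sub_def)
  have W0: "0 \<in> W" using Wk[OF K0 W1] by simp
  have Wd: "x - y \<in> W" if "x \<in> W" "y \<in> W" for x y
    using Wa[OF that(1) Wk[OF Kn[OF K1] that(2)]] by simp
  have ex: "\<exists>k\<in>K. z - k * a \<in> W" for z
  proof (cases "z \<in> W")
    case True
    then show ?thesis using K0 by (intro bexI[of _ 0]) auto
  next
    case False
    let ?X = "{w + k * z | w k. w \<in> W \<and> k \<in> K}"
    have "sub ?X" unfolding sub_def
    proof (intro conjI ballI)
      fix x y assume "x \<in> ?X" "y \<in> ?X"
      then obtain w k w' k' where "x = w + k * z" "y = w' + k' * z" "w \<in> W" "k \<in> K" "w' \<in> W" "k' \<in> K" by blast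
      moreover from this have "x + y = (w + w') + (k + k') * z" by (simp add: algebra_simps)
      ultimately show "x + y \<in> ?X" using Wa Ka by blast
    next
      fix l x assume "l \<in> K" "x \<in> ?X"
      then obtain w k where "x = w + k * z" "w \<in> W" "k \<in> K" by blast
      moreover from this have "l * x = l * w + (l * k) * z" by (simp add: algebra_simps)
      ultimately show "l * x \<in> ?X" using Wk Km \<open>l \<in> K\<close> by blast
    qed
    moreover have sup: "W \<subseteq> ?X"
    proof
      fix w assume "w \<in> W"
      then have "w = w + 0 * z \<and> w \<in> W \<and> 0 \<in> K" using K0 by simp
      then show "w \<in> ?X" by blast
    qed
    moreover have "z \<in> ?X"
    proof -
      have "z = 0 + 1 * z \<and> 0 \<in> W \<and> 1 \<in> K" using W0 K1 by simp
      then show ?thesis by blast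
    qed
    ultimately have X: "sub ?X" "W \<subseteq> ?X" "z \<in> ?X" by this+
    \<comment> \<open>Otherwise W + K z would be a larger subspace that still misses a.\<close>
    have "a \<in> ?X"
    proof (rule ccontr)
      assume "a \<notin> ?X"
      have "1 \<in> ?X" using X(2) W1 by (rule subsetD)
      have "?X \<in> ?A" by (rule CollectI, intro conjI) fact+
      then have "?X = W" using X(2) by (rule max)
      with X(3) False show False by (simp only:)
    qed
    then obtain w k where wk: "a = w + k * z" "w \<in> W" "k \<in> K" by blast
    \<comment> \<open>As a lies outside W, the vector z really occurs, and solving for z gives its
      coefficient at a.\<close>
    then have "k \<noteq> 0" using aW by auto
    then have "z - (1 / k) * a = (- (1 / k)) * w" using wk by (simp add: field_simps)
    moreover have "(- (1 / k)) * w \<in> W"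
      by (rule Wk[OF Kn[OF Kq[OF K1 wk(3)]] wk(2)])
    ultimately have "z - (1 / k) * a \<in> W" by (simp only:)
    then show ?thesis using Kq[OF K1 wk(3)] by blast
  qed
  have un: "k = k'" if "k \<in> K" "k' \<in> K" "z - k * a \<in> W" "z - k' * a \<in> W" for k k' z
  proof (rule ccontr)
    assume "k \<noteq> k'"
    have "(k' - k) * a \<in> W" using Wd[OF that(3) that(4)] by (simp add: algebra_simps)
    then have "(1 / (k' - k)) * ((k' - k) * a) \<in> W"
      by (rule Wk[OF Kq[OF K1 Kd[OF that(2,1)]]])
    then show False using \<open>k \<noteq> k'\<close> aW by simp
  qed
  define ph where "ph z = (THE k. k \<in> K \<and> z - k * a \<in> W)" for z
  have phi: "ph z = k" if "k \<in> K" "z - k * a \<in> W" for z k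
    unfolding ph_def using un that by blast
  have phi': "ph z \<in> K \<and> z - ph z * a \<in> W" for z
    using ex[of z] phi by blast
  show ?thesis
  proof
    show "ph (x + y) = ph x + ph y" for x y
      using phi'[of x] phi'[of y] Wa[of "x - ph x * a" "y - ph y * a"]
      by (intro phi Ka) (auto simp: algebra_simps)
    show "ph (k * x) = k * ph x" if "k \<in> K" for k x
      using phi'[of x] Wk[OF that, of "x - ph x * a"] that
      by (intro phi Km) (auto simp: algebra_simps)
    show "ph 1 = 0" using K0 W1 by (intro phi) auto
    show "ph a = 1" using K1 W0 by (intro phi) auto
  qed
qed

text \<open>The positive multiples of unit vectors give the lattice full rank on \<open>S\<close>,
  so that its basis can be indexed by \<open>S\<close> itself. Coordinates are added one at a time:
  a vector with least positive new entry reduces all the others by division with remainder.\<close>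

lemma lattice_basis:
  fixes L :: "('b \<Rightarrow> int) set"
  assumes L0: "(\<lambda>_. 0) \<in> L" and Ld: "\<And>v w. v \<in> L \<Longrightarrow> w \<in> L \<Longrightarrow> (\<lambda>b. v b - w b) \<in> L"
    and S: "finite S" and N: "\<And>p. p \<in> S \<Longrightarrow> \<exists>n>0. (\<lambda>b. if b = p then n else 0) \<in> L"
  obtains v where "\<And>p. p \<in> S \<Longrightarrow> v p \<in> L \<and> (\<forall>b. b \<notin> S \<longrightarrow> v p b = 0)"
    "\<And>w. w \<in> L \<Longrightarrow> (\<forall>b. b \<notin> S \<longrightarrow> w b = 0) \<Longrightarrow> \<exists>n. \<forall>b. w b = (\<Sum>p\<in>S. n p * v p b)"
    "\<And>n. (\<forall>b. (\<Sum>p\<in>S. n p * v p b) = 0) \<Longrightarrow> (\<forall>p\<in>S. n p = 0)"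
proof -
  have Lm: "(\<lambda>b. k * w b) \<in> L" if "w \<in> L" for w and k :: int
  proof -
    have neg: "(\<lambda>b. - v b) \<in> L" if "v \<in> L" for v using Ld[OF L0 that] by simp
    have add: "(\<lambda>b. v b + w b) \<in> L" if "v \<in> L" "w \<in> L" for v w using Ld[OF that(1) neg[OF that(2)]] by simp
    have nat: "(\<lambda>b. int n * w b) \<in> L" for n
      by (induction n) (use L0 add[OF that] in \<open>auto simp: ring_distribs\<close>)
    show ?thesis
    proof (cases "k \<ge> 0")
      case True
      then show ?thesis using nat[of "Int.nat k"] by simp
    next
      case False
      then show ?thesis using neg[OF nat[of "Int.nat (- k)"]] by simp
    qed
  qed
  have N': "\<forall>p\<in>S. \<exists>n>0. (\<lambda>b. if b = p then n else 0) \<in> L" using N by blast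
  have "\<exists>v. (\<forall>p\<in>S. v p \<in> L \<and> (\<forall>b. b \<notin> S \<longrightarrow> v p b = 0)) \<and>
    (\<forall>w\<in>L. (\<forall>b. b \<notin> S \<longrightarrow> w b = 0) \<longrightarrow> (\<exists>n. \<forall>b. w b = (\<Sum>p\<in>S. n p * v p b))) \<and>
    (\<forall>n. (\<forall>b. (\<Sum>p\<in>S. n p * v p b) = 0) \<longrightarrow> (\<forall>p\<in>S. n p = 0))"
    using S N'
  proof (induction S rule: finite_induct)
    case (insert i S)
    have "\<forall>p\<in>S. \<exists>n>0. (\<lambda>b. if b = p then n else 0) \<in> L"
      using insert.prems by simp
    from insert.IH[OF this] obtain v where v: "\<forall>p\<in>S. v p \<in> L \<and> (\<forall>b. b \<notin> S \<longrightarrow> v p b = 0)"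
      "\<forall>w\<in>L. (\<forall>b. b \<notin> S \<longrightarrow> w b = 0) \<longrightarrow> (\<exists>n. \<forall>b. w b = (\<Sum>p\<in>S. n p * v p b))"
      "\<forall>n. (\<forall>b. (\<Sum>p\<in>S. n p * v p b) = 0) \<longrightarrow> (\<forall>p\<in>S. n p = 0)"
      by (elim exE conjE)
    \<comment> \<open>The new entries of lattice vectors supported on \<open>insert i S\<close> will
      be the multiples of \<open>d\<close>; the multiple of the unit vector at \<open>i\<close>
      shows that a positive entry exists.\<close>
    let ?D = "\<lambda>d::nat. d > 0 \<and> (\<exists>w\<in>L. (\<forall>b. b \<notin> insert i S \<longrightarrow> w b = 0) \<and> w i = int d)"
    define d where "d = (LEAST d. ?D d)"
    obtain n where "n > 0" "(\<lambda>b. if b = i then n else 0) \<in> L" using insert.prems by blast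
    then have "?D (Int.nat n)" by (intro conjI bexI[of _ "\<lambda>b. if b = i then n else 0"]) auto
    then have "?D d" unfolding d_def by (rule LeastI)
    then obtain w0 where w0: "d > 0" "w0 \<in> L" "\<forall>b. b \<notin> insert i S \<longrightarrow> w0 b = 0" "w0 i = int d" by blast
    define v' where "v' = v(i := w0)"
    have sum_v': "(\<Sum>p\<in>insert i S. n p * v' p b) = n i * w0 b + (\<Sum>p\<in>S. n p * v p b)" for n b
    proof -
      have "(\<Sum>p\<in>S. n p * v' p b) = (\<Sum>p\<in>S. n p * v p b)"
        using insert(2) by (intro sum.cong) (auto simp: v'_def)
      then show ?thesis using insert(1,2) by (simp add: v'_def)
    qed
    show ?case
    proof (intro exI[of _ v'] conjI ballI allI impI)
      fix p assume "p \<in> insert i S"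
      then show "v' p \<in> L" using v w0 by (auto simp: v'_def)
      fix b assume "b \<notin> insert i S"
      then show "v' p b = 0" using v w0 \<open>p \<in> insert i S\<close> by (auto simp: v'_def)
    next
      fix w assume w: "w \<in> L" "\<forall>b. b \<notin> insert i S \<longrightarrow> w b = 0"
      define q where "q = w i div int d"
      define w' where "w' = (\<lambda>b. w b - q * w0 b)"
      have w': "w' \<in> L" using Ld[OF w(1) Lm[OF w0(2)]] by (simp add: w'_def)
      have w'i: "w' i = w i mod int d" using w0 by (simp add: w'_def q_def minus_div_mult_eq_mod)
      \<comment> \<open>A nonzero remainder would be a positive entry smaller than
        \<open>d\<close>.\<close>
      have "w' i = 0"
      proof (rule ccontr)
        assume "w' i \<noteq> 0"
        then have pos: "w' i > 0" using w'i w0(1) pos_mod_sign[of "int d" "w i"] by linarith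
        then have "?D (Int.nat (w' i))" using w' w w0 by (auto simp: w'_def intro!: bexI[of _ w'])
        then have "d \<le> Int.nat (w' i)" unfolding d_def by (rule Least_le)
        moreover have "w' i < int d" using w'i w0(1) by simp
        ultimately show False using pos by linarith
      qed
      then have "\<forall>b. b \<notin> S \<longrightarrow> w' b = 0" using w(2) w0(3) unfolding w'_def
        by (metis diff_zero insert_iff mult_zero_right)
      then obtain n where n: "\<forall>b. w' b = (\<Sum>p\<in>S. n p * v p b)" using v(2) w' by blast
      show "\<exists>n. \<forall>b. w b = (\<Sum>p\<in>insert i S. n p * v' p b)"
      proof (intro exI allI)
        fix b
        have "(\<Sum>p\<in>S. (n(i := q)) p * v p b) = (\<Sum>p\<in>S. n p * v p b)"
          using insert(2) by (intro sum.cong) auto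
        then show "w b = (\<Sum>p\<in>insert i S. (n(i := q)) p * v' p b)"
          using n unfolding sum_v' by (simp add: w'_def algebra_simps)
      qed
    next
      fix n p assume z: "\<forall>b. (\<Sum>p\<in>insert i S. n p * v' p b) = 0" and p: "p \<in> insert i S"
      have "(\<Sum>p\<in>S. n p * v p i) = 0" using v(1) insert(2) by (intro sum.neutral) auto
      then have "n i = 0" using z[rule_format, of i] w0 unfolding sum_v' by simp
      then have "\<forall>b. (\<Sum>p\<in>S. n p * v p b) = 0" using z unfolding sum_v' by simp
      then show "n p = 0" using v(3) p \<open>n i = 0\<close> by blast
    qed
  qed auto
  then obtain v where v: "\<forall>p\<in>S. v p \<in> L \<and> (\<forall>b. b \<notin> S \<longrightarrow> v p b = 0)"
      "\<forall>w\<in>L. (\<forall>b. b \<notin> S \<longrightarrow> w b = 0) \<longrightarrow> (\<exists>n. \<forall>b. w b = (\<Sum>p\<in>S. n p * v p b))"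
      "\<forall>n. (\<forall>b. (\<Sum>p\<in>S. n p * v p b) = 0) \<longrightarrow> (\<forall>p\<in>S. n p = 0)"
    by (elim exE conjE)
  show ?thesis
    by (rule that[of v]) (use v in simp_all)
qed

section \<open>Leading coefficients and Laurent monomials\<close>

lemma lookup_times:
  fixes p q :: "'m::comm_monoid_add \<Rightarrow>\<^sub>0 'r::comm_ring_1"
  shows "Poly_Mapping.lookup (p * q) k = (\<Sum>(a, b)\<in>Poly_Mapping.keys p \<times> Poly_Mapping.keys q.
     if a + b = k then Poly_Mapping.lookup p a * Poly_Mapping.lookup q b else 0)"
proof -
  have "p * q = (\<Sum>m\<in>Poly_Mapping.keys p. Poly_Mapping.single m (Poly_Mapping.lookup p m))
      * (\<Sum>n\<in>Poly_Mapping.keys q. Poly_Mapping.single n (Poly_Mapping.lookup q n))"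
    using poly_sum_monomials[of p] poly_sum_monomials[of q] by simp
  also have "\<dots> = (\<Sum>m\<in>Poly_Mapping.keys p. \<Sum>n\<in>Poly_Mapping.keys q.
        Poly_Mapping.single (m + n) (Poly_Mapping.lookup p m * Poly_Mapping.lookup q n))"
    by (simp add: sum_product mult_single)
  finally show ?thesis
    by (simp add: lookup_sum lookup_single when_def flip: sum.cartesian_product)
qed

lemma lookup_times_single:
  fixes p :: "('v \<Rightarrow>\<^sub>0 nat) \<Rightarrow>\<^sub>0 'r::comm_ring_1"
  shows "Poly_Mapping.lookup (p * Poly_Mapping.single n 1) (k + n) = Poly_Mapping.lookup p k"
proof -
  have "Poly_Mapping.lookup (p * Poly_Mapping.single n 1) (k + n) =
      (\<Sum>(a, b)\<in>Poly_Mapping.keys p \<times> {n}. if a = k then Poly_Mapping.lookup p a else 0)"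
    unfolding lookup_times by (rule sum.cong) (auto split: if_splits)
  also have "\<dots> = Poly_Mapping.lookup p k"
    by (simp add: in_keys_iff flip: sum.cartesian_product)
  finally show ?thesis .
qed

text \<open>The order is compatible with addition, so a sum of exponents bounded by \<open>m\<close>
  and \<open>n\<close> reaches \<open>m + n\<close> only when both bounds are attained.\<close>

lemma lookup_times_top:
  fixes p q :: "('v::linorder \<Rightarrow>\<^sub>0 nat) \<Rightarrow>\<^sub>0 'r::comm_ring_1"
  assumes p: "\<forall>k\<in>Poly_Mapping.keys p. k \<le> m" and q: "\<forall>k\<in>Poly_Mapping.keys q. k \<le> n"
  shows "\<forall>k\<in>Poly_Mapping.keys (p * q). k \<le> m + n"
    and "Poly_Mapping.lookup (p * q) (m + n) = Poly_Mapping.lookup p m * Poly_Mapping.lookup q n"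
proof -
  show "\<forall>k\<in>Poly_Mapping.keys (p * q). k \<le> m + n"
    using keys_mult[of p q] p q by (auto intro!: add_mono dest!: subsetD[OF keys_mult])
  have eq: "a = m \<and> b = n" if "a \<in> Poly_Mapping.keys p" "b \<in> Poly_Mapping.keys q" "a + b = m + n" for a b
  proof -
    have "a \<le> m" "b \<le> n" using that p q by auto
    moreover from this have "\<not> a < m" "\<not> b < n"
      using that(3) add_less_le_mono[of a m b n] add_le_less_mono[of a m b n] by (metis order_less_irrefl)+
    ultimately show ?thesis by (simp add: order_le_less)
  qed
  have "Poly_Mapping.lookup (p * q) (m + n) = (\<Sum>x\<in>Poly_Mapping.keys p \<times> Poly_Mapping.keys q.
     if x = (m, n) then Poly_Mapping.lookup p m * Poly_Mapping.lookup q n else 0)"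
    unfolding lookup_times by (rule sum.cong) (use eq in \<open>auto split: if_splits\<close>)
  also have "\<dots> = Poly_Mapping.lookup p m * Poly_Mapping.lookup q n"
    by (auto simp: in_keys_iff)
  finally show "Poly_Mapping.lookup (p * q) (m + n) = Poly_Mapping.lookup p m * Poly_Mapping.lookup q n" .
qed

text \<open>The order on exponents is lexicographic with the smallest index deciding, so variables
  of larger index are smaller. This fixes the direction of the triangularity conditions
  below.\<close>

lemma single_le_single_iff_ge:
  fixes a i :: "'v::linorder"
  assumes "i \<le> a"
  shows "Poly_Mapping.single a (1::nat) \<le> Poly_Mapping.single i 1"
proof (cases "a = i")
  case False
  then have "Poly_Mapping.single a (1::nat) < Poly_Mapping.single i 1"
    using assms unfolding less_poly_mapping.rep_eq less_fun_def
    by (intro exI[of _ i]) (auto simp: lookup_single when_def)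
  then show ?thesis by simp
qed simp

text \<open>Upper bounds for exponents add up under multiplication and the coefficients at the
  bounds multiply. The formula remains true when the bound is not attained, both sides then being
  0.\<close>

lemma mon_ev_top:
  fixes w :: "'v::linorder \<Rightarrow> ('v \<Rightarrow>\<^sub>0 nat) \<Rightarrow>\<^sub>0 'r::comm_ring_1"
  assumes w: "\<And>i. \<forall>k\<in>Poly_Mapping.keys (w i). k \<le> Poly_Mapping.single i 1"
  shows "\<forall>k\<in>Poly_Mapping.keys (mon_ev w m). k \<le> m"
    and "Poly_Mapping.lookup (mon_ev w m) m = mon_ev (\<lambda>i. Poly_Mapping.lookup (w i) (Poly_Mapping.single i 1)) m"
proof -
  let ?Q = "\<lambda>m. (\<forall>k\<in>Poly_Mapping.keys (mon_ev w m). k \<le> m) \<and>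
    Poly_Mapping.lookup (mon_ev w m) m = mon_ev (\<lambda>i. Poly_Mapping.lookup (w i) (Poly_Mapping.single i 1)) m"
  have add: "?Q (m + n)" if "?Q m" "?Q n" for m n
    using that lookup_times_top[of "mon_ev w m" m "mon_ev w n" n] by (simp add: mon_ev_add)
  have Q0: "?Q 0" by (simp flip: single_one)
  have sing: "?Q (Poly_Mapping.single i n)" for i n
  proof (induction n)
    case 0
    then show ?case using Q0 by simp
  next
    case (Suc n)
    have "?Q (Poly_Mapping.single i 1)" using w by simp
    from add[OF this Suc] show ?case by (simp flip: single_add)
  qed
  have "finite S \<Longrightarrow> ?Q (\<Sum>x\<in>S. Poly_Mapping.single x (f x))" for S f
  proof (induction S rule: finite_induct)
    case empty
    then show ?case using Q0 by simp
  next
    case (insert x S)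
    show ?case using add[OF sing[of x "f x"] insert.IH] insert(1,2) by simp
  qed
  from this[of "Poly_Mapping.keys m" "Poly_Mapping.lookup m"] have "?Q m"
    using poly_sum_monomials[of m] by simp
  then show "\<forall>k\<in>Poly_Mapping.keys (mon_ev w m). k \<le> m"
    and "Poly_Mapping.lookup (mon_ev w m) m = mon_ev (\<lambda>i. Poly_Mapping.lookup (w i) (Poly_Mapping.single i 1)) m"
    by auto
qed

text \<open>The image of each monomial of \<open>p\<close> is bounded by its own exponent, so at the
  largest exponent \<open>M\<close> only the image of the leading term contributes.\<close>

lemma poly_ev_top:
  fixes w :: "'v::linorder \<Rightarrow> ('v \<Rightarrow>\<^sub>0 nat) \<Rightarrow>\<^sub>0 'r::comm_ring_1" and h :: "'k::comm_ring_1 \<Rightarrow> 'r"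
  assumes h: "is_ring_hom h" and w: "\<And>i. \<forall>k\<in>Poly_Mapping.keys (w i). k \<le> Poly_Mapping.single i 1"
    and p: "p \<noteq> 0"
  defines "M \<equiv> Max (Poly_Mapping.keys p)"
  defines "q \<equiv> poly_ev (\<lambda>c. Poly_Mapping.single 0 (h c)) w p"
  shows "\<forall>k\<in>Poly_Mapping.keys q. k \<le> M"
    and "Poly_Mapping.lookup q M = h (Poly_Mapping.lookup p M) *
      mon_ev (\<lambda>i. Poly_Mapping.lookup (w i) (Poly_Mapping.single i 1)) M"
proof -
  have ne: "Poly_Mapping.keys p \<noteq> {}" using p by simp
  have Mk: "M \<in> Poly_Mapping.keys p" unfolding M_def using ne by simp
  have Mm: "m \<le> M" if "m \<in> Poly_Mapping.keys p" for m unfolding M_def using that by simp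
  have term_le: "\<forall>k\<in>Poly_Mapping.keys (Poly_Mapping.single 0 c * mon_ev w m). k \<le> m"
    and term_eq: "Poly_Mapping.lookup (Poly_Mapping.single 0 c * mon_ev w m) m =
      c * Poly_Mapping.lookup (mon_ev w m) m" for c m
    using lookup_times_top[of "Poly_Mapping.single 0 c" 0 "mon_ev w m" m] mon_ev_top(1)[OF w, of m]
    by auto
  show "\<forall>k\<in>Poly_Mapping.keys q. k \<le> M"
  proof
    fix k assume "k \<in> Poly_Mapping.keys q"
    then obtain m where "m \<in> Poly_Mapping.keys p"
      "k \<in> Poly_Mapping.keys (Poly_Mapping.single 0 (h (Poly_Mapping.lookup p m)) * mon_ev w m)"
      unfolding q_def poly_ev_def by (auto dest!: subsetD[OF keys_sum])
    then show "k \<le> M" using term_le[of "h (Poly_Mapping.lookup p m)" m] Mm[of m] by auto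
  qed
  have "Poly_Mapping.lookup q M = (\<Sum>m\<in>Poly_Mapping.keys p.
      Poly_Mapping.lookup (Poly_Mapping.single 0 (h (Poly_Mapping.lookup p m)) * mon_ev w m) M)"
    by (simp add: q_def poly_ev_def lookup_sum)
  also have "\<dots> = (\<Sum>m\<in>Poly_Mapping.keys p. if m = M then
      h (Poly_Mapping.lookup p M) * Poly_Mapping.lookup (mon_ev w M) M else 0)"
  proof (rule sum.cong[OF refl])
    fix m assume m: "m \<in> Poly_Mapping.keys p"
    show "Poly_Mapping.lookup (Poly_Mapping.single 0 (h (Poly_Mapping.lookup p m)) * mon_ev w m) M =
      (if m = M then h (Poly_Mapping.lookup p M) * Poly_Mapping.lookup (mon_ev w M) M else 0)"
    proof (cases "m = M")
      case False
      then have "m < M" using Mm[OF m] by simp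
      then have "M \<notin> Poly_Mapping.keys (Poly_Mapping.single 0 (h (Poly_Mapping.lookup p m)) * mon_ev w m)"
        using term_le[of "h (Poly_Mapping.lookup p m)" m] by auto
      then show ?thesis using False by (simp add: in_keys_iff)
    qed (simp add: term_eq)
  qed
  also have "\<dots> = h (Poly_Mapping.lookup p M) * Poly_Mapping.lookup (mon_ev w M) M"
    using Mk by simp
  finally show "Poly_Mapping.lookup q M = h (Poly_Mapping.lookup p M) *
      mon_ev (\<lambda>i. Poly_Mapping.lookup (w i) (Poly_Mapping.single i 1)) M"
    by (simp add: mon_ev_top(2)[OF w])
qed

text \<open>Division from the top. Let M be the largest exponent at which \<open>r\<close> has a
  coefficient outside \<open>B\<close>. At m + M the product consists of q_m r_M and of terms whose
  exponent in \<open>r\<close> exceeds M, which lie in \<open>B\<close>. Since q_m is invertible in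
  \<open>B\<close>, so does r_M.\<close>

lemma coeffs_quotient_mem:
  fixes q r :: "('v::linorder \<Rightarrow>\<^sub>0 nat) \<Rightarrow>\<^sub>0 'r::field"
  assumes B0: "0 \<in> B" and Bd: "\<And>x y. x \<in> B \<Longrightarrow> y \<in> B \<Longrightarrow> x - y \<in> B"
    and Bm: "\<And>x y. x \<in> B \<Longrightarrow> y \<in> B \<Longrightarrow> x * y \<in> B"
    and q: "\<And>k. Poly_Mapping.lookup q k \<in> B" and qr: "\<And>k. Poly_Mapping.lookup (q * r) k \<in> B"
    and top: "\<forall>k\<in>Poly_Mapping.keys q. k \<le> m" and nz: "Poly_Mapping.lookup q m \<noteq> 0"
    and inv: "inverse (Poly_Mapping.lookup q m) \<in> B"
  shows "Poly_Mapping.lookup r k \<in> B"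
proof (rule ccontr)
  assume "Poly_Mapping.lookup r k \<notin> B"
  let ?S = "{k\<in>Poly_Mapping.keys r. Poly_Mapping.lookup r k \<notin> B}"
  define M where "M = Max ?S"
  have "k \<in> ?S" using \<open>Poly_Mapping.lookup r k \<notin> B\<close> B0 by (auto simp: in_keys_iff)
  then have "M \<in> ?S" unfolding M_def by (intro Max_in) auto
  then have MS: "M \<in> Poly_Mapping.keys r" "Poly_Mapping.lookup r M \<notin> B" by auto
  have Mmax: "Poly_Mapping.lookup r b \<in> B" if "M < b" for b
  proof (rule ccontr)
    assume "Poly_Mapping.lookup r b \<notin> B"
    then have "b \<in> ?S" using B0 by (auto simp: in_keys_iff)
    then have "b \<le> M" unfolding M_def by (intro Max_ge) auto
    then show False using that by simp
  qed
  let ?K = "Poly_Mapping.keys q \<times> Poly_Mapping.keys r"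
  let ?f = "\<lambda>(a, b). if a + b = m + M then Poly_Mapping.lookup q a * Poly_Mapping.lookup r b else 0"
  have mK: "(m, M) \<in> ?K" using nz MS by (simp add: in_keys_iff)
  have rest: "?f x \<in> B" if xK: "x \<in> ?K - {(m, M)}" for x
  proof -
    obtain a b where x: "x = (a, b)" "a \<in> Poly_Mapping.keys q" "b \<in> Poly_Mapping.keys r" "(a, b) \<noteq> (m, M)"
      using xK by (cases x) auto
    show ?thesis
    proof (cases "a + b = m + M")
      case True
      have "a \<noteq> m" using True x(4) by auto
      then have "a < m" using top x(2) by (simp add: order.strict_iff_order)
      then have "M < b" using True add_less_le_mono[of a m b M] by (cases "b \<le> M") auto
      then show ?thesis using True x q Mmax Bm by auto
    qed (use x B0 in auto)
  qed
  have Ba: "x + y \<in> B" if "x \<in> B" "y \<in> B" for x y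
    using Bd[OF that(1) Bd[OF B0 that(2)]] by simp
  have sumB: "finite A \<Longrightarrow> (\<forall>x\<in>A. g x \<in> B) \<Longrightarrow> sum g A \<in> B" for A and g :: "_ \<Rightarrow> 'r"
    by (induction A rule: finite_induct) (auto simp: B0 Ba)
  have "Poly_Mapping.lookup (q * r) (m + M) = ?f (m, M) + sum ?f (?K - {(m, M)})"
    unfolding lookup_times by (rule sum.remove[OF _ mK]) simp
  moreover have "sum ?f (?K - {(m, M)}) \<in> B"
    using rest by (intro sumB) auto
  ultimately have "Poly_Mapping.lookup q m * Poly_Mapping.lookup r M \<in> B"
    using Bd[OF qr[of "m + M"], of "sum ?f (?K - {(m, M)})"] by simp
  then have "inverse (Poly_Mapping.lookup q m) * (Poly_Mapping.lookup q m * Poly_Mapping.lookup r M) \<in> B"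
    by (rule Bm[OF inv])
  then show False using nz MS by (simp add: field_simps)
qed

section \<open>Laurent monomials\<close>

definition lmon :: "('b::finite \<Rightarrow> 'r::field) \<Rightarrow> ('b \<Rightarrow> int) \<Rightarrow> 'r" where
  "lmon w v = (\<Prod>b\<in>UNIV. w b powi v b)"

lemma lmon_0 [simp]: "lmon w (\<lambda>_. 0) = 1"
  by (simp add: lmon_def)

lemma lmon_add: "(\<And>b. w b \<noteq> 0) \<Longrightarrow> lmon w (\<lambda>b. u b + v b) = lmon w u * lmon w v"
  by (simp add: lmon_def power_int_add prod.distrib)

lemma lmon_minus: "lmon w (\<lambda>b. - v b) = inverse (lmon w v)"
  using prod_inversef[of "\<lambda>b. w b powi v b" UNIV] by (simp add: lmon_def power_int_minus o_def)

lemma lmon_diff: "(\<And>b. w b \<noteq> 0) \<Longrightarrow> lmon w (\<lambda>b. u b - v b) = lmon w u / lmon w v"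
  using lmon_add[of w u "\<lambda>b. - v b"] by (simp add: lmon_minus divide_inverse)

lemma lmon_nonzero: "(\<And>b. w b \<noteq> 0) \<Longrightarrow> lmon w v \<noteq> 0"
  by (simp add: lmon_def)

lemma lmon_delta: "lmon w (\<lambda>b. if b = a then n else 0) = w a powi n"
proof -
  have "lmon w (\<lambda>b. if b = a then n else 0) = (\<Prod>b\<in>UNIV. if b = a then w a powi n else 1)"
    unfolding lmon_def by (rule prod.cong) auto
  then show ?thesis by simp
qed

lemma power_int_prod: "(\<Prod>b\<in>A. f b) powi n = (\<Prod>b\<in>A. f b powi n)" for f :: "'b \<Rightarrow> 'r::field"
  by (induction A rule: infinite_finite_induct) (auto simp: power_int_mult_distrib)

lemma lmon_sum:
  assumes w: "\<And>b. w b \<noteq> 0"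
  shows "lmon w (\<lambda>b. \<Sum>p\<in>S. n p * v p b) = (\<Prod>p\<in>S. lmon w (v p) powi n p)"
proof (induction S rule: infinite_finite_induct)
  case (insert x S)
  have "lmon w (\<lambda>b. n x * v x b) = lmon w (v x) powi n x"
    unfolding lmon_def power_int_prod by (intro prod.cong refl) (metis mult.commute power_int_mult)
  then show ?case
    using insert by (simp add: lmon_add[OF w])
qed auto

lemma mon_ev_lmon: "mon_ev w m = lmon w (\<lambda>b. int (Poly_Mapping.lookup m b))"
  by (simp add: mon_ev_superset[of UNIV] lmon_def)

lemma single_eq_0_iff: "Poly_Mapping.single m c = 0 \<longleftrightarrow> c = 0"
  by (metis lookup_single_eq lookup_zero single_zero)

lemma pvar_nonzero: "pvar v \<noteq> 0"
  by (simp add: pvar_def Fract_1_eq_0_iff single_eq_0_iff)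

lemma poly_ev_pvar: "poly_ev pconst pvar p = Fract p 1"
  by (rule ring_hom_poly_eqI[OF poly_ev_ring_hom[OF pconst_ring_hom] Fract_1_ring_hom])
     (simp_all add: poly_ev_single[OF pconst_ring_hom] ring_hom_1[OF pconst_ring_hom], simp_all add: pconst_def pvar_def)

lemma mon_ev_pvar: "mon_ev pvar m = Fract (Poly_Mapping.single m 1) 1"
  using poly_ev_pvar[of "Poly_Mapping.single m 1"]
  by (simp add: poly_ev_single[OF pconst_ring_hom] ring_hom_1[OF pconst_ring_hom])

text \<open>Adding one large \<open>N\<close> to every exponent multiplies all the monomials by a
  common factor and turns them into distinct polynomial monomials.\<close>

lemma lmon_pvar_independent:
  fixes c :: "('b::{finite,linorder} \<Rightarrow> int) \<Rightarrow> 'k::field"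
  assumes S: "finite S" and z: "(\<Sum>v\<in>S. pconst (c v) * lmon (pvar :: 'b \<Rightarrow> ('b, 'k) mpoly fract) v) = 0"
    and u: "u \<in> S"
  shows "c u = 0"
proof -
  let ?w = "pvar :: 'b \<Rightarrow> ('b, 'k) mpoly fract"
  define N where "N = (\<Sum>v\<in>S. \<Sum>b\<in>UNIV. \<bar>v b\<bar>)"
  have N: "N + v b \<ge> 0" if "v \<in> S" for v b
  proof -
    have "\<bar>v b\<bar> \<le> (\<Sum>b\<in>UNIV. \<bar>v b\<bar>)" by (rule member_le_sum) auto
    also have "\<dots> \<le> N" unfolding N_def using S that by (intro member_le_sum) (auto intro: sum_nonneg)
    finally show ?thesis by linarith
  qed
  define e where "e v = (\<Sum>b\<in>UNIV. Poly_Mapping.single b (nat (N + v b)))" for v :: "'b \<Rightarrow> int"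
  have e: "Poly_Mapping.lookup (e v) b = nat (N + v b)" for v b
    by (simp add: e_def lookup_sum lookup_single when_def)
  have "lmon ?w (\<lambda>b. N + v b) = Fract (Poly_Mapping.single (e v) 1) 1" if "v \<in> S" for v
  proof -
    have "(\<lambda>b. int (Poly_Mapping.lookup (e v) b)) = (\<lambda>b. N + v b)"
      using N[OF that] by (simp add: e)
    then show ?thesis using mon_ev_lmon[of ?w "e v"] mon_ev_pvar[of "e v"] by metis
  qed
  then have "(\<Sum>v\<in>S. pconst (c v) * lmon ?w (\<lambda>b. N + v b)) = (\<Sum>v\<in>S. Fract (Poly_Mapping.single (e v) (c v)) 1)"
    by (intro sum.cong) (auto simp: pconst_def mult_single)
  moreover have "(\<Sum>v\<in>S. pconst (c v) * lmon ?w (\<lambda>b. N + v b)) = lmon ?w (\<lambda>b. N) * (\<Sum>v\<in>S. pconst (c v) * lmon ?w v)"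
    by (simp add: lmon_add pvar_nonzero sum_distrib_left mult_ac)
  ultimately have "Fract (\<Sum>v\<in>S. Poly_Mapping.single (e v) (c v)) 1 = 0"
    using z ring_hom_sum[OF Fract_1_ring_hom, of "\<lambda>v. Poly_Mapping.single (e v) (c v)" S] by simp
  then have "(\<Sum>v\<in>S. Poly_Mapping.single (e v) (c v)) = 0"
    by (simp only: Fract_1_eq_0_iff)
  then have "0 = Poly_Mapping.lookup (\<Sum>v\<in>S. Poly_Mapping.single (e v) (c v)) (e u)"
    by simp
  also have "\<dots> = (\<Sum>v\<in>S. if v = u then c u else 0)"
    unfolding lookup_sum
  proof (rule sum.cong[OF refl])
    fix v assume v: "v \<in> S"
    have "v = u" if "e v = e u"
    proof
      fix b
      have "nat (N + v b) = nat (N + u b)" using that by (metis e)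
      then show "v b = u b" using N[OF v, of b] N[OF u, of b] by linarith
    qed
    then show "Poly_Mapping.lookup (Poly_Mapping.single (e v) (c v)) (e u) = (if v = u then c u else 0)"
      by (auto simp: lookup_single when_def)
  qed
  finally show ?thesis using S u by simp
qed

section \<open>The base algebra of a triangular bialgebra and its quotient field\<close>

lemma sum_rotate: "(\<Sum>a\<in>A. \<Sum>b\<in>B. \<Sum>i\<in>C. f a b i) = (\<Sum>i\<in>C. \<Sum>a\<in>A. \<Sum>b\<in>B. f a b i)"
proof -
  have "(\<Sum>a\<in>A. \<Sum>b\<in>B. \<Sum>i\<in>C. f a b i) = (\<Sum>a\<in>A. \<Sum>i\<in>C. \<Sum>b\<in>B. f a b i)"
    by (rule sum.cong[OF refl], rule sum.swap)
  then show ?thesis by (simp only: sum.swap[of _ C A])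
qed

text \<open>The linear extension of the basis values \<open>f\<close>, evaluated at the vector
  \<open>x\<close>.\<close>

definition conv_dual :: "('k::field \<Rightarrow> 'r::field) \<Rightarrow> ('i::finite \<Rightarrow> 'r) \<Rightarrow> ('i \<Rightarrow> 'k) \<Rightarrow> 'r" where
  "conv_dual h f x = (\<Sum>i\<in>UNIV. h (x i) * f i)"

lemma conv_dual_add: "is_ring_hom h \<Longrightarrow> conv_dual h f (x + y) = conv_dual h f x + conv_dual h f y"
  by (simp add: conv_dual_def ring_hom_add ring_distribs sum.distrib)

lemma conv_dual_diff: "is_ring_hom h \<Longrightarrow> conv_dual h f (x - y) = conv_dual h f x - conv_dual h f y"
  by (simp add: conv_dual_def ring_hom_diff left_diff_distrib sum_subtractf)

lemma conv_dual_vscale: "is_ring_hom h \<Longrightarrow> conv_dual h f (vscale k x) = h k * conv_dual h f x"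
  by (simp add: conv_dual_def vscale_def ring_hom_mult sum_distrib_left mult_ac)

lemma conv_dual_basis: "is_ring_hom h \<Longrightarrow> conv_dual h f (h_basis i) = f i"
proof -
  assume h: "is_ring_hom h"
  have "h (h_basis i j) = (if j = i then 1 else 0)" for j
    by (simp add: h_basis_def ring_hom_0[OF h] ring_hom_1[OF h])
  then show ?thesis by (simp only: conv_dual_def sum_delta_mult)
qed

lemma conv_dual_h_mult:
  assumes h: "is_ring_hom h"
  shows "conv_dual h f (h_mult m x y) = (\<Sum>i\<in>UNIV. \<Sum>j\<in>UNIV. h (x i) * h (y j) * mulf h m f (i, j))"
proof -
  have "conv_dual h f (h_mult m x y) = (\<Sum>l\<in>UNIV. \<Sum>i\<in>UNIV. \<Sum>j\<in>UNIV. h (x i) * h (y j) * (h (m i j l) * f l))"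
    by (simp add: conv_dual_def h_mult_def ring_hom_sum[OF h] ring_hom_mult[OF h] sum_distrib_right mult.assoc)
  also have "\<dots> = (\<Sum>i\<in>UNIV. \<Sum>j\<in>UNIV. \<Sum>l\<in>UNIV. h (x i) * h (y j) * (h (m i j l) * f l))"
    by (subst sum.swap, rule sum.cong[OF refl], rule sum.swap)
  finally show ?thesis by (simp add: mulf_def sum_distrib_left)
qed

lemma ring_hom_conv:
  assumes "is_ring_hom g"
  shows "g (conv h c f f' i) = conv (\<lambda>x. g (h x)) c (\<lambda>j. g (f j)) (\<lambda>j. g (f' j)) i"
  by (simp add: conv_def ring_hom_sum[OF assms] ring_hom_mult[OF assms])

lemma ring_hom_mulf:
  assumes "is_ring_hom g"
  shows "g (mulf h m f p) = mulf (\<lambda>x. g (h x)) m (\<lambda>j. g (f j)) p"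
  by (simp add: mulf_def ring_hom_sum[OF assms] ring_hom_mult[OF assms] split: prod.split)

lemma ring_hom_tensf: "is_ring_hom g \<Longrightarrow> g (tensf f f' p) = tensf (\<lambda>j. g (f j)) (\<lambda>j. g (f' j)) p"
  by (simp add: tensf_def ring_hom_mult split: prod.split)

lemma sum_mem:
  assumes "0 \<in> B" "\<And>x y. x \<in> B \<Longrightarrow> y \<in> B \<Longrightarrow> x + y \<in> B" "\<And>a. a \<in> A \<Longrightarrow> f a \<in> B"
  shows "sum f A \<in> B"
  using assms(3) by (induction A rule: infinite_finite_induct) (auto simp: assms(1,2))

lemma prod_mem:
  assumes "1 \<in> B" "\<And>x y. x \<in> B \<Longrightarrow> y \<in> B \<Longrightarrow> x * y \<in> B" "\<And>a. a \<in> A \<Longrightarrow> f a \<in> B"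
  shows "prod f A \<in> B"
  using assms(3) by (induction A rule: infinite_finite_induct) (auto simp: assms(1,2))

lemma power_mem:
  assumes "1 \<in> B" "\<And>x y. x \<in> B \<Longrightarrow> y \<in> B \<Longrightarrow> x * y \<in> B" "x \<in> B"
  shows "x ^ n \<in> B"
  by (induction n) (auto simp: assms)

lemma tH_basis: "tH (h_basis a) = pvar a"
  using conv_dual_basis[OF pconst_ring_hom, of pvar a] by (simp add: tH_def conv_dual_def)

lemma lin_ext_basis: "lin_ext f (h_basis a) = f a"
  using conv_dual_basis[OF pconst_ring_hom, of f a] by (simp add: lin_ext_def conv_dual_def)

lemma sum_h_comult:
  assumes h: "is_ring_hom h"
  shows   "(\<Sum>a\<in>UNIV. \<Sum>b\<in>UNIV. h (h_comult c x (a, b)) * f a * g b) = conv_dual h (conv h c f g) x"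
proof -
  have "(\<Sum>a\<in>UNIV. \<Sum>b\<in>UNIV. h (h_comult c x (a, b)) * f a * g b) =
      (\<Sum>a\<in>UNIV. \<Sum>b\<in>UNIV. \<Sum>i\<in>UNIV. h (x i) * (h (c i a b) * f a * g b))"
    unfolding h_comult_def prod.case ring_hom_sum[OF h] ring_hom_mult[OF h] sum_distrib_right
    by (intro sum.cong refl) (simp only: mult_ac)
  also have "\<dots> = (\<Sum>i\<in>UNIV. \<Sum>a\<in>UNIV. \<Sum>b\<in>UNIV. h (x i) * (h (c i a b) * f a * g b))"
    by (rule sum_rotate)
  finally show ?thesis by (simp add: conv_dual_def conv_def sum_distrib_left)
qed

text \<open>The two defining equations of t^{-1} say that it is the two-sided convolution inverse of
  t; by linearity they need checking on the basis only.\<close>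

lemma tinv_cond_iff:
  fixes c :: "'b::{finite,linorder} \<Rightarrow> 'b \<Rightarrow> 'b \<Rightarrow> 'k::field"
  shows "tinv_cond c ep f \<longleftrightarrow> conv pconst c pvar f = (\<lambda>i. pconst (ep i)) \<and> conv pconst c f pvar = (\<lambda>i. pconst (ep i))"
proof -
  have ep: "pconst (\<Sum>i\<in>UNIV. x i * ep i) = conv_dual pconst (\<lambda>i. pconst (ep i) :: ('b, 'k) mpoly fract) x" for x
    by (simp add: conv_dual_def ring_hom_sum[OF pconst_ring_hom] ring_hom_mult[OF pconst_ring_hom])
  have eq: "(\<forall>x. conv_dual pconst f x = conv_dual pconst g x) \<longleftrightarrow> f = g"
    for f g :: "'b \<Rightarrow> ('b, 'k) mpoly fract"
    by (metis conv_dual_basis[OF pconst_ring_hom] ext)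
  show ?thesis
    by (simp add: tinv_cond_def tH_basis lin_ext_basis sum_h_comult[OF pconst_ring_hom] ep all_conj_distrib eq)
qed

definition tinv_fun :: "('b::{finite,linorder} \<Rightarrow> 'b \<Rightarrow> 'b \<Rightarrow> 'k::field) \<Rightarrow> ('b \<Rightarrow> 'k) \<Rightarrow> 'b \<Rightarrow> ('b, 'k) mpoly fract" where
  "tinv_fun c ep = (THE f. tinv_cond c ep f)"

lemma tinv_eq: "tinv c ep x = conv_dual pconst (tinv_fun c ep) x"
  by (simp add: tinv_def tinv_fun_def lin_ext_def conv_dual_def)

lemma bilinear_sum:
  assumes h: "is_ring_hom h"
  shows   "(\<Sum>a\<in>UNIV. \<Sum>b\<in>UNIV. \<Sum>e\<in>UNIV. \<Sum>d\<in>UNIV.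
        h (h_comult c x (a, b) * h_comult c y (e, d)) * f (a, e) * g (b, d))
     = (\<Sum>i\<in>UNIV. \<Sum>j\<in>UNIV. h (x i) * h (y j) * conv h (pair_c c) f g (i, j))"
proof -
  have "(\<Sum>a\<in>UNIV. \<Sum>b\<in>UNIV. \<Sum>e\<in>UNIV. \<Sum>d\<in>UNIV.
        h (h_comult c x (a, b) * h_comult c y (e, d)) * f (a, e) * g (b, d))
    = (\<Sum>a\<in>UNIV. \<Sum>b\<in>UNIV. \<Sum>e\<in>UNIV. \<Sum>d\<in>UNIV. \<Sum>i\<in>UNIV. \<Sum>j\<in>UNIV.
        h (x i) * h (y j) * (h (c i a b * c j e d) * f (a, e) * g (b, d)))"
    unfolding h_comult_def prod.case
    unfolding sum_product unfolding ring_hom_sum[OF h] ring_hom_mult[OF h] sum_distrib_right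
    by (intro sum.cong refl) (simp only: mult_ac)
  also have "\<dots> = (\<Sum>i\<in>UNIV. \<Sum>j\<in>UNIV. \<Sum>a\<in>UNIV. \<Sum>e\<in>UNIV. \<Sum>b\<in>UNIV. \<Sum>d\<in>UNIV.
        h (x i) * h (y j) * (h (c i a b * c j e d) * f (a, e) * g (b, d)))"
    unfolding sum.cartesian_product
    by (rule sum.reindex_bij_witness[where i = "\<lambda>(i,j,a,e,b,d). (a,b,e,d,i,j)"
        and j = "\<lambda>(a,b,e,d,i,j). (i,j,a,e,b,d)"]) auto
  also have "\<dots> = (\<Sum>i\<in>UNIV. \<Sum>j\<in>UNIV. h (x i) * h (y j) * conv h (pair_c c) f g (i, j))"
    by (simp only: conv_def sum_UNIV_pair pair_c_def prod.case sum_distrib_left)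
  finally show ?thesis .
qed

text \<open>Writes the cocycle as a convolution product on the tensor square: t (x) t, followed by
  t^{-1} composed with the multiplication. All later cancellations are associativity of this
  product.\<close>

lemma gen_sigma_eq:
  fixes c m :: "'b::{finite,linorder} \<Rightarrow> 'b \<Rightarrow> 'b \<Rightarrow> 'k::field"
  shows "gen_sigma m c ep x y = (\<Sum>i\<in>UNIV. \<Sum>j\<in>UNIV. pconst (x i) * pconst (y j) * conv pconst (pair_c c) (tensf pvar pvar) (mulf pconst m (tinv_fun c ep)) (i, j))"
proof -
  have "tinv c ep (h_mult m (h_basis b) (h_basis d)) = mulf pconst m (tinv_fun c ep) (b, d)" for b d
  proof -
    have eq: "(pconst (h_basis p q) :: ('b, 'k) mpoly fract) = (if q = p then 1 else 0)" for p q :: 'b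
      by (simp add: h_basis_def ring_hom_0[OF pconst_ring_hom] ring_hom_1[OF pconst_ring_hom])
    show ?thesis unfolding tinv_eq conv_dual_h_mult[OF pconst_ring_hom]
      by (simp only: eq mult.assoc sum_delta_mult flip: sum_distrib_left)
  qed
  then show ?thesis
    using bilinear_sum[OF pconst_ring_hom, of c x y "tensf pvar pvar" "mulf pconst m (tinv_fun c ep)"] by (simp add: gen_sigma_def tH_basis tensf_def mult.assoc)
qed

lemma gen_sigma_inv_eq:
  fixes c m :: "'b::{finite,linorder} \<Rightarrow> 'b \<Rightarrow> 'b \<Rightarrow> 'k::field"
  shows "gen_sigma_inv m c ep x y = (\<Sum>i\<in>UNIV. \<Sum>j\<in>UNIV. pconst (x i) * pconst (y j) * conv pconst (pair_c c) (mulf pconst m pvar) (tensf (tinv_fun c ep) (tinv_fun c ep)) (i, j))"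
proof -
  have "tH (h_mult m (h_basis b) (h_basis d)) = mulf pconst m pvar (b, d)" for b d
  proof -
    have eq: "(pconst (h_basis p q) :: ('b, 'k) mpoly fract) = (if q = p then 1 else 0)" for p q :: 'b
      by (simp add: h_basis_def ring_hom_0[OF pconst_ring_hom] ring_hom_1[OF pconst_ring_hom])
    have "tH z = conv_dual pconst pvar z" for z :: "'b \<Rightarrow> 'k" by (simp add: tH_def conv_dual_def)
    then show ?thesis
      by (simp only: conv_dual_h_mult[OF pconst_ring_hom] eq mult.assoc sum_delta_mult flip: sum_distrib_left)
  qed
  moreover have "tinv c ep (h_basis b) = tinv_fun c ep b" for b
    by (simp add: tinv_eq conv_dual_basis[OF pconst_ring_hom])
  ultimately show ?thesis
    using bilinear_sum[OF pconst_ring_hom, of c x y "mulf pconst m pvar" "tensf (tinv_fun c ep) (tinv_fun c ep)"] by (simp add: gen_sigma_inv_def tensf_def mult.assoc)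
qed

text \<open>The interface between the Hopf algebra and the commutative algebra. Basis vectors are
  represented by their indices: \<open>P\<close> are the group-likes, with product \<open>pm\<close>
  and unit \<open>u\<close>, \<open>hh i\<close> is the diagonal h_i, and \<open>dg\<close> is the
  degree, of which only equality matters. By \<open>tri\<close> the first legs of \<Delta> e_i
  belong to smaller variables, or to t_i itself. The structure of H_ab enters through
  \<open>dg\<close> and through \<open>ker_c\<close> and \<open>ker_P\<close>: the second leg
  \<open>c i a\<close> off the diagonal, and the difference of group-likes of equal degree, vanish
  in every commutative quotient. Finiteness of the group of group-likes appears as
  \<open>P_torsion\<close>.\<close>

locale triangular_bialgebra = coalg_consts c ep
  for c :: "'b::{finite,linorder} \<Rightarrow> 'b \<Rightarrow> 'b \<Rightarrow> 'k::field" and ep :: "'b \<Rightarrow> 'k" +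
  fixes m :: "'b \<Rightarrow> 'b \<Rightarrow> 'b \<Rightarrow> 'k" and P :: "'b set" and pm :: "'b \<Rightarrow> 'b \<Rightarrow> 'b" and u :: 'b
    and hh :: "'b \<Rightarrow> 'b" and dg :: "'b \<Rightarrow> 'd"
  assumes bialg: "(\<Sum>p\<in>UNIV. m i j p * c p a b) =
        (\<Sum>a1\<in>UNIV. \<Sum>b1\<in>UNIV. \<Sum>a2\<in>UNIV. \<Sum>b2\<in>UNIV. c i a1 b1 * c j a2 b2 * m a1 a2 a * m b1 b2 b)"
    and ep_mult: "(\<Sum>p\<in>UNIV. m i j p * ep p) = ep i * ep j"
    and P_c: "p \<in> P \<Longrightarrow> c p a b = (if a = p \<and> b = p then 1 else 0)"
    and P_ep: "p \<in> P \<Longrightarrow> ep p = 1"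
    and P_pm: "p \<in> P \<Longrightarrow> q \<in> P \<Longrightarrow> pm p q \<in> P"
    and P_m: "p \<in> P \<Longrightarrow> q \<in> P \<Longrightarrow> m p q l = (if l = pm p q then 1 else 0)"
    and u_P: "u \<in> P" and pm_u: "p \<in> P \<Longrightarrow> pm p u = p"
    and P_torsion: "p \<in> P \<Longrightarrow> \<exists>n>0. (pm p ^^ n) u = u"
    and tri: "c i a b \<noteq> 0 \<Longrightarrow> i \<le> a"
    and hh_P: "hh i \<in> P" and diag: "c i i b = (if b = hh i then 1 else 0)"
    and dg_hh: "dg (hh i) = dg i"
    and dg_c: "c i a b \<noteq> 0 \<Longrightarrow> dg b = dg i"
    and dg_m: "m i j l \<noteq> 0 \<Longrightarrow> dg l = dg (pm (hh i) (hh j))"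
    and ker_c: "two_sided_ideal m I \<Longrightarrow> (\<forall>x y. h_mult m x y - h_mult m y x \<in> I) \<Longrightarrow> a \<noteq> i \<Longrightarrow> c i a \<in> I"
    and ker_P: "two_sided_ideal m I \<Longrightarrow> (\<forall>x y. h_mult m x y - h_mult m y x \<in> I) \<Longrightarrow>
        p \<in> P \<Longrightarrow> q \<in> P \<Longrightarrow> dg p = dg q \<Longrightarrow> h_basis p - h_basis q \<in> I"
begin

sublocale c2: coalg_consts "pair_c c" "pair_ep ep"
  by (rule pair_coalg)

text \<open>Counts the larger indices, so it drops along the triangular order and can drive the
  recursions.\<close>

definition rk :: "'b \<Rightarrow> nat" where "rk i = card {a. i < a}"

lemma rk_less: "c i a b \<noteq> 0 \<Longrightarrow> a = i \<or> rk a < rk i"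
proof -
  assume "c i a b \<noteq> 0"
  then have "i \<le> a" by (rule tri)
  moreover have "rk a < rk i" if "i < a"
    unfolding rk_def using that by (intro psubset_card_mono) auto
  ultimately show ?thesis by (auto simp: order_le_less)
qed

lemma comat_diag: "is_ring_hom h \<Longrightarrow> comat h c f i i = f (hh i)"
proof -
  assume h: "is_ring_hom h"
  have "h (c i i b) = (if b = hh i then 1 else 0)" for b
    by (simp add: diag ring_hom_0[OF h] ring_hom_1[OF h])
  then show ?thesis by (simp only: comat_def sum_delta_mult)
qed

lemma P_h:
  assumes "is_ring_hom h" "p \<in> P"
  shows "conv h c f g p = f p * g p"
proof -
  have "conv h c f g p = (\<Sum>a\<in>UNIV. \<Sum>b\<in>UNIV. if b = p then (if a = p then f p * g p else 0) else 0)"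
    unfolding conv_def using assms
    by (intro sum.cong) (auto simp: P_c ring_hom_0 ring_hom_1)
  then show ?thesis by simp
qed

lemma mulf_P: "is_ring_hom h \<Longrightarrow> p \<in> P \<Longrightarrow> q \<in> P \<Longrightarrow> mulf h m f (p, q) = f (pm p q)"
proof -
  assume h: "is_ring_hom h" and pq: "p \<in> P" "q \<in> P"
  have "h (m p q b) = (if b = pm p q then 1 else 0)" for b
    by (simp add: P_m[OF pq] ring_hom_0[OF h] ring_hom_1[OF h])
  then show ?thesis by (simp only: mulf_def prod.case sum_delta_mult)
qed

abbreviation kp :: "'k \<Rightarrow> ('b, 'k) mpoly fract" where "kp \<equiv> pconst"
abbreviation tv :: "'b \<Rightarrow> ('b, 'k) mpoly fract" where "tv \<equiv> pvar"

lemma kp_hom: "is_ring_hom kp"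
  by (rule pconst_ring_hom)

definition tau :: "'b \<Rightarrow> ('b, 'k) mpoly fract" where "tau = tinv_fun c ep"

text \<open>The diagonal of the matrix of t consists of the variables t_{h_i}, which are nonzero, so
  the inverse exists; its uniqueness makes the definite description denote it.\<close>

lemma tau_inverse:
  shows conv_t_tau: "conv kp c tv tau = (\<lambda>i. kp (ep i))" and conv_tau_t: "conv kp c tau tv = (\<lambda>i. kp (ep i))"
proof -
  have "comat kp c tv i i \<noteq> 0" for i
    by (simp add: comat_diag[OF kp_hom] pvar_nonzero)
  then have "\<exists>g. conv kp c g tv = (\<lambda>i. kp (ep i)) \<and> conv kp c tv g = (\<lambda>i. kp (ep i))"
    by (rule conv_inverse_exists[OF kp_hom, of rk tv, rotated]) (blast, erule rk_less)
  then obtain g where "conv kp c g tv = (\<lambda>i. kp (ep i))" "conv kp c tv g = (\<lambda>i. kp (ep i))"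
    by blast
  then have "tinv_cond c ep g" by (simp add: tinv_cond_iff)
  moreover have "f = g" if "tinv_cond c ep f" for f
    using that \<open>tinv_cond c ep g\<close> conv_inverse_unique[OF kp_hom, of f tv g] by (simp add: tinv_cond_iff)
  ultimately have "tinv_cond c ep tau" unfolding tau_def tinv_fun_def by (rule theI)
  then show "conv kp c tv tau = (\<lambda>i. kp (ep i))" "conv kp c tau tv = (\<lambda>i. kp (ep i))"
    by (simp_all add: tinv_cond_iff)
qed

lemma tau_P: "p \<in> P \<Longrightarrow> tau p = 1 / tv p"
proof -
  assume p: "p \<in> P"
  have "tv p * tau p = 1"
    using fun_cong[OF conv_t_tau, of p] P_h[OF kp_hom p, of tv tau] by (simp add: P_ep[OF p] ring_hom_1[OF kp_hom])
  then show ?thesis by (simp add: eq_divide_eq pvar_nonzero mult.commute)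
qed

abbreviation cv2 where "cv2 \<equiv> conv kp (pair_c c)"
abbreviation TT where "TT \<equiv> tensf tv tv"
abbreviation TM where "TM \<equiv> mulf kp m tv"
abbreviation ZZ where "ZZ \<equiv> tensf tau tau"
abbreviation ZM where "ZM \<equiv> mulf kp m tau"
abbreviation E2 where "E2 \<equiv> (\<lambda>p. kp (pair_ep ep p))"

definition sg where "sg = cv2 TT ZM"
definition sgi where "sgi = cv2 TM ZZ"

lemma mulf_ep: "is_ring_hom h \<Longrightarrow> mulf h m (\<lambda>i. h (ep i)) = (\<lambda>p. h (pair_ep ep p))"
  using ring_hom_sum[of h "\<lambda>p. m i j p * ep p" UNIV for i j]
  by (auto simp: mulf_def pair_ep_def ep_mult ring_hom_mult)

lemma tensf_ep: "is_ring_hom h \<Longrightarrow> tensf (\<lambda>i. h (ep i)) (\<lambda>i. h (ep i)) = (\<lambda>p. h (pair_ep ep p))"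
  by (auto simp: tensf_def pair_ep_def ring_hom_mult)

lemma cv2_inverses: "cv2 TM ZM = E2" "cv2 ZM TM = E2" "cv2 TT ZZ = E2" "cv2 ZZ TT = E2"
  by (simp_all add: conv_mulf[OF kp_hom bialg, symmetric] conv_tensf[OF kp_hom] conv_t_tau conv_tau_t
      mulf_ep[OF kp_hom] tensf_ep[OF kp_hom])

lemmas cv2_simps = c2.conv_assoc[OF kp_hom] c2.conv_unit_l[OF kp_hom] c2.conv_unit_r[OF kp_hom]

lemma cv2_cancel: "cv2 TM (cv2 ZM f) = f" "cv2 ZM (cv2 TM f) = f" "cv2 TT (cv2 ZZ f) = f" "cv2 ZZ (cv2 TT f) = f"
  by (simp_all add: c2.conv_assoc[OF kp_hom, symmetric] cv2_inverses c2.conv_unit_l[OF kp_hom])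

text \<open>The forms in which cocycle values can be pulled out of a \<open>B\<close>-linear map. In
  Sweedler notation: t_{xy} = \<sigma>^{-1}(x_1, y_1) t_{x_2} t_{y_2} and t^{-1}_{xy} = t^{-1}_{x_1}
  t^{-1}_{y_1} \<sigma>(x_2, y_2).\<close>

lemma TM_sgi: "TM = cv2 sgi TT" and ZM_sg: "ZM = cv2 ZZ sg" and sg_sgi: "cv2 sg (cv2 sgi f) = f"
  by (simp_all add: sg_def sgi_def cv2_simps cv2_inverses cv2_cancel)

section \<open>The base algebra and its quotient field\<close>

definition B where "B = generic_base_algebra m c ep"

lemma gen_sigma_sg: "gen_sigma m c ep x y = (\<Sum>i\<in>UNIV. \<Sum>j\<in>UNIV. kp (x i) * kp (y j) * sg (i, j))"
  and gen_sigma_inv_sgi: "gen_sigma_inv m c ep x y = (\<Sum>i\<in>UNIV. \<Sum>j\<in>UNIV. kp (x i) * kp (y j) * sgi (i, j))"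
  by (simp_all only: gen_sigma_eq gen_sigma_inv_eq sg_def sgi_def tau_def)

lemma B_const: "kp x \<in> B" and B_add: "x1 \<in> B \<Longrightarrow> y1 \<in> B \<Longrightarrow> x1 + y1 \<in> B" and B_mult: "x1 \<in> B \<Longrightarrow> y1 \<in> B \<Longrightarrow> x1 * y1 \<in> B"
  unfolding B_def generic_base_algebra_def by (auto intro: gen_subalg.intros)

lemma B_0: "0 \<in> B" and B_1: "1 \<in> B"
  using B_const[of 0] B_const[of 1] by (simp_all add: ring_hom_0[OF kp_hom] ring_hom_1[OF kp_hom])

lemma B_diff: "x \<in> B \<Longrightarrow> y \<in> B \<Longrightarrow> x - y \<in> B"
proof -
  assume "x \<in> B" "y \<in> B"
  then have "x + kp (- 1) * y \<in> B" by (intro B_add B_mult B_const)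
  then show ?thesis by (simp add: ring_hom_minus[OF kp_hom] ring_hom_1[OF kp_hom])
qed

lemma sg_B: "sg p \<in> B" and sgi_B: "sgi p \<in> B"
proof -
  obtain i j where p: "p = (i, j)" by (cases p)
  have eq: "kp (h_basis p q) = (if q = p then 1 else 0)" for p q :: 'b
    by (simp add: h_basis_def ring_hom_0[OF kp_hom] ring_hom_1[OF kp_hom])
  have "gen_sigma m c ep (h_basis i) (h_basis j) = sg p" "gen_sigma_inv m c ep (h_basis i) (h_basis j) = sgi p"
    unfolding gen_sigma_sg gen_sigma_inv_sgi p
    by (simp_all only: eq mult.assoc sum_delta_mult flip: sum_distrib_left)
  then show "sg p \<in> B" "sgi p \<in> B"
    unfolding B_def generic_base_algebra_def by (metis (mono_tags, lifting) UnCI gen_subalg.gen mem_Collect_eq)+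
qed

text \<open>By bilinearity the cocycle values on pairs of basis vectors already generate the
  algebra.\<close>

lemma B_induct:
  assumes "b \<in> B" "\<And>x. kp x \<in> X" "\<And>p. sg p \<in> X" "\<And>p. sgi p \<in> X"
    "\<And>x y. x \<in> X \<Longrightarrow> y \<in> X \<Longrightarrow> x + y \<in> X" "\<And>x y. x \<in> X \<Longrightarrow> y \<in> X \<Longrightarrow> x * y \<in> X"
  shows "b \<in> X"
proof -
  have X0: "0 \<in> X" using assms(2)[of 0] by (simp add: ring_hom_0[OF kp_hom])
  have "gen_sigma m c ep x y \<in> X" for x y
    unfolding gen_sigma_sg by (intro sum_mem[OF X0 assms(5)] assms(6) assms(2) assms(3))
  moreover have "gen_sigma_inv m c ep x y \<in> X" for x y
    unfolding gen_sigma_inv_sgi by (intro sum_mem[OF X0 assms(5)] assms(6) assms(2) assms(4))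
  moreover have "b \<in> gen_subalg ({gen_sigma m c ep x y |x y. True} \<union> {gen_sigma_inv m c ep x y |x y. True})"
    using assms(1) by (simp add: B_def generic_base_algebra_def)
  then have "(\<forall>x y. gen_sigma m c ep x y \<in> X) \<longrightarrow> (\<forall>x y. gen_sigma_inv m c ep x y \<in> X) \<longrightarrow> b \<in> X"
    by (induction rule: gen_subalg.induct) (use assms in auto)
  ultimately show ?thesis by blast
qed

definition K where "K = {x / y | x y. x \<in> B \<and> y \<in> B \<and> y \<noteq> 0}"

lemma B_K: "x \<in> B \<Longrightarrow> x \<in> K"
  unfolding K_def using B_1 by (metis (mono_tags, lifting) div_by_1 mem_Collect_eq zero_neq_one)

lemma K_field: "subfield_on K"
  unfolding subfield_on_def
proof (intro conjI ballI)
  show "1 \<in> K" by (rule B_K[OF B_1])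
  fix x y assume "x \<in> K" "y \<in> K"
  then obtain a b a' b' where x: "x = a / b" "a \<in> B" "b \<in> B" "b \<noteq> 0" and y: "y = a' / b'" "a' \<in> B" "b' \<in> B" "b' \<noteq> 0"
    unfolding K_def by blast
  have "x - y = (a * b' - a' * b) / (b * b')" using x y by (simp add: field_simps)
  moreover have "a * b' - a' * b \<in> B" "b * b' \<in> B" "b * b' \<noteq> 0" using x y by (auto intro: B_diff B_mult)
  ultimately show "x - y \<in> K" unfolding K_def by blast
  have "x * y = (a * a') / (b * b')" using x y by simp
  moreover have "a * a' \<in> B" using x y by (auto intro: B_mult)
  ultimately show "x * y \<in> K" using \<open>b * b' \<in> B\<close> \<open>b * b' \<noteq> 0\<close> unfolding K_def by blast
  show "x / y \<in> K"
  proof (cases "a' = 0")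
    case True
    then show ?thesis using y B_K[OF B_0] by simp
  next
    case False
    have "x / y = (a * b') / (b * a')" using x y by simp
    moreover have "a * b' \<in> B" "b * a' \<in> B" "b * a' \<noteq> 0" using x y False by (auto intro: B_mult)
    ultimately show ?thesis unfolding K_def by blast
  qed
qed

lemma K_mult: "x \<in> K \<Longrightarrow> y \<in> K \<Longrightarrow> x * y \<in> K" and K_div: "x \<in> K \<Longrightarrow> y \<in> K \<Longrightarrow> x / y \<in> K" and K_1: "1 \<in> K"
  using K_field by (auto simp: subfield_on_def)

section \<open>Operators attached to linear maps over the base algebra\<close>

definition Blin where "Blin f \<longleftrightarrow> (\<forall>x y. f (x + y) = f x + f y) \<and> (\<forall>b\<in>B. \<forall>x. f (b * x) = b * f x)"

lemma Blin_add: "Blin f \<Longrightarrow> f (x + y) = f x + f y" and Blin_mult: "Blin f \<Longrightarrow> b \<in> B \<Longrightarrow> f (b * x) = b * f x"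
  by (auto simp: Blin_def)

lemma Blin_sum: "Blin f \<Longrightarrow> f (sum g A) = (\<Sum>a\<in>A. f (g a))"
proof -
  assume f: "Blin f"
  have "f 0 = 0" using Blin_add[OF f, of 0 0] by (metis add.right_neutral add_left_cancel)
  then show ?thesis by (induction A rule: infinite_finite_induct) (auto simp: Blin_add[OF f])
qed

text \<open>For \<open>a\<close> outside \<open>K\<close> there is a \<open>K\<close>-linear map
  with \<open>f 1 = 0\<close> and \<open>f a = 1\<close>, which violates the hypothesis. Membership
  in \<open>K\<close> is thus tested without exhibiting numerator and denominator.\<close>

lemma mem_K_if_commutes:
  assumes "\<And>f. Blin f \<Longrightarrow> f a = a * f 1"
  shows "a \<in> K"
proof (rule ccontr)
  assume "a \<notin> K"
  from exists_functional_over_subfield[OF K_field this] obtain f where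
    f: "\<And>x y. f (x + y) = f x + f y" "\<And>k x. k \<in> K \<Longrightarrow> f (k * x) = k * f x" "f 1 = 0" "f a = 1"
    by blast
  then have "Blin f" using B_K by (simp add: Blin_def)
  from assms[OF this] f show False by simp
qed

text \<open>In Sweedler notation t^{-1}_{x_1} f(t_{x_2} z), at the basis vectors x.\<close>

definition Lf where "Lf f z = conv kp c tau (\<lambda>b. f (tv b * z))"

text \<open>On a product x y, the factor \<sigma> contained in t^{-1}_{xy} meets the factor
  \<sigma>^{-1} that was pulled out of \<open>f\<close>, and they cancel. The remaining expression
  treats x and y separately.\<close>

lemma mulf_Lf:
  assumes f: "Blin f"
  shows "mulf kp m (Lf f z) = cv2 ZZ (\<lambda>(a, b). f (tv a * tv b * z))"
proof -
  have "mulf kp m (\<lambda>b. f (tv b * z)) p = f (TM p * z)" for p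
    by (cases p) (simp add: mulf_def sum_distrib_right mult.assoc Blin_sum[OF f] Blin_mult[OF f B_const])
  also have "f (TM p * z) = cv2 sgi (\<lambda>(a, b). f (tv a * tv b * z)) p" for p
  proof -
    have coef: "kp x * sgi q \<in> B" for x q by (intro B_mult B_const sgi_B)
    have "TM p * z = (\<Sum>a\<in>UNIV. \<Sum>b\<in>UNIV. (kp (pair_c c p a b) * sgi a) * (TT b * z))"
      by (subst TM_sgi) (simp add: conv_def sum_distrib_right mult.assoc)
    then have "f (TM p * z) = (\<Sum>a\<in>UNIV. \<Sum>b\<in>UNIV. (kp (pair_c c p a b) * sgi a) * f (TT b * z))"
      by (simp only: Blin_sum[OF f] Blin_mult[OF f coef])
    then show ?thesis by (simp add: conv_def tensf_def case_prod_beta)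
  qed
  finally have "mulf kp m (\<lambda>b. f (tv b * z)) = cv2 sgi (\<lambda>(a, b). f (tv a * tv b * z))" by (rule ext)
  then have "mulf kp m (Lf f z) = cv2 (cv2 ZZ sg) (cv2 sgi (\<lambda>(a, b). f (tv a * tv b * z)))"
    by (simp add: Lf_def conv_mulf[OF kp_hom bialg] ZM_sg[symmetric])
  then show ?thesis by (simp add: c2.conv_assoc[OF kp_hom] sg_sgi)
qed

lemma cv2_ZZ_expand: "cv2 ZZ (\<lambda>(a, b). f (tv a * tv b * z)) (i, j) =
   (\<Sum>a\<in>UNIV. \<Sum>b\<in>UNIV. \<Sum>a'\<in>UNIV. \<Sum>b'\<in>UNIV. (kp (c i a b) * tau a) * (kp (c j a' b') * tau a') * f (tv b * tv b' * z))"
proof -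
  have "cv2 ZZ (\<lambda>(a, b). f (tv a * tv b * z)) (i, j) =
   (\<Sum>a\<in>UNIV. \<Sum>a'\<in>UNIV. \<Sum>b\<in>UNIV. \<Sum>b'\<in>UNIV. (kp (c i a b) * tau a) * (kp (c j a' b') * tau a') * f (tv b * tv b' * z))"
    by (simp add: conv_def sum_UNIV_pair pair_c_def tensf_def ring_hom_mult[OF kp_hom] mult_ac)
  also have "\<dots> = (\<Sum>a\<in>UNIV. \<Sum>b\<in>UNIV. \<Sum>a'\<in>UNIV. \<Sum>b'\<in>UNIV. (kp (c i a b) * tau a) * (kp (c j a' b') * tau a') * f (tv b * tv b' * z))"
    by (rule sum.cong[OF refl], rule sum.swap)
  finally show ?thesis .
qed

text \<open>After the cancellation only products in the commutative field F are left, so x and y can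
  be exchanged.\<close>

lemma mulf_Lf_sym:
  assumes f: "Blin f"
  shows "mulf kp m (Lf f z) (i, j) = mulf kp m (Lf f z) (j, i)"
proof -
  let ?X = "\<lambda>a b a' b'. (kp (c i a b) * tau a) * (kp (c j a' b') * tau a') * f (tv b * tv b' * z)"
  have "(\<Sum>a\<in>UNIV. \<Sum>b\<in>UNIV. \<Sum>a'\<in>UNIV. \<Sum>b'\<in>UNIV. ?X a b a' b') = (\<Sum>a'\<in>UNIV. \<Sum>b'\<in>UNIV. \<Sum>a\<in>UNIV. \<Sum>b\<in>UNIV. ?X a b a' b')"
    unfolding sum.cartesian_product
    by (rule sum.reindex_bij_witness[where i = "\<lambda>(a,b,e,d). (e,d,a,b)" and j = "\<lambda>(a,b,e,d). (e,d,a,b)"]) auto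
  then show ?thesis unfolding mulf_Lf[OF f] cv2_ZZ_expand by (simp only: mult_ac)
qed

text \<open>The elements of H at which all the operators vanish. It turns out to be an ideal with
  commutative quotient, hence contains everything that dies in H_ab.\<close>

definition I0 where "I0 = {x. \<forall>f z. Blin f \<longrightarrow> conv_dual kp (Lf f z) x = 0}"

lemma Blin_Lf:
  assumes f: "Blin f"
  shows "Blin (\<lambda>w. conv_dual kp (Lf f w) y)"
proof -
  have "conv_dual kp (Lf f (w + w')) y = conv_dual kp (Lf f w) y + conv_dual kp (Lf f w') y" for w w'
    by (simp add: conv_dual_def Lf_def conv_def distrib_left Blin_add[OF f] sum.distrib)
  moreover have "conv_dual kp (Lf f (b * w)) y = b * conv_dual kp (Lf f w) y" if b: "b \<in> B" for b w
  proof -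
    have "f (tv j * (b * w)) = b * f (tv j * w)" for j
      using Blin_mult[OF f b, of "tv j * w"] by (simp add: mult_ac)
    then show ?thesis
      by (simp add: conv_dual_def Lf_def conv_def sum_distrib_left mult_ac)
  qed
  ultimately show ?thesis by (simp add: Blin_def)
qed

text \<open>Multiplicativity L_{xy} f = L_x (L_y f). The inner map is again \<open>B\<close>-linear
  but differs from \<open>f\<close>, and therefore \<open>I0\<close> quantifies over all
  \<open>B\<close>-linear maps.\<close>

lemma conv_dual_Lf_mult:
  assumes f: "Blin f"
  shows "conv_dual kp (Lf f z) (h_mult m x y) = conv_dual kp (Lf (\<lambda>w. conv_dual kp (Lf f w) y) z) x"
proof -
  have eq: "Lf (\<lambda>w. conv_dual kp (Lf f w) y) z i = (\<Sum>j\<in>UNIV. kp (y j) * mulf kp m (Lf f z) (i, j))" for i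
  proof -
    let ?X = "\<lambda>j a b a' b'. kp (y j) * ((kp (c i a b) * tau a) * (kp (c j a' b') * tau a') * f (tv b * tv b' * z))"
    have "Lf (\<lambda>w. conv_dual kp (Lf f w) y) z i =
      (\<Sum>a\<in>UNIV. \<Sum>b\<in>UNIV. \<Sum>j\<in>UNIV. \<Sum>a'\<in>UNIV. \<Sum>b'\<in>UNIV. ?X j a b a' b')"
      unfolding Lf_def conv_def conv_dual_def sum_distrib_left
      by (intro sum.cong refl) (simp add: mult_ac)
    also have "\<dots> = (\<Sum>j\<in>UNIV. \<Sum>a\<in>UNIV. \<Sum>b\<in>UNIV. \<Sum>a'\<in>UNIV. \<Sum>b'\<in>UNIV. ?X j a b a' b')"
      by (rule sum_rotate)
    finally show ?thesis
      unfolding mulf_Lf[OF f] cv2_ZZ_expand sum_distrib_left .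
  qed
  then show ?thesis
    unfolding conv_dual_h_mult[OF kp_hom]
    by (simp add: conv_dual_def[of kp "Lf (\<lambda>w. conv_dual kp (Lf f w) y) z"] eq sum_distrib_left mult.assoc)
qed

lemma conv_dual_Lf_commute:
  assumes f: "Blin f"
  shows "conv_dual kp (Lf f z) (h_mult m x y) = conv_dual kp (Lf f z) (h_mult m y x)"
  unfolding conv_dual_h_mult[OF kp_hom]
  by (subst sum.swap) (simp only: mulf_Lf_sym[OF f] mult_ac)

lemma I0_ideal: "two_sided_ideal m I0" "\<forall>x y. h_mult m x y - h_mult m y x \<in> I0"
proof -
  have z: "conv_dual kp f 0 = 0" for f
    by (simp add: conv_dual_def ring_hom_0[OF kp_hom])
  have r: "h_mult m x y \<in> I0" if "x \<in> I0" for x y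
    using that Blin_Lf by (simp add: I0_def conv_dual_Lf_mult)
  then have "h_mult m y x \<in> I0" if "x \<in> I0" for x y
    using r[OF that, of y] conv_dual_Lf_commute by (simp add: I0_def)
  with r show "two_sided_ideal m I0"
    by (simp add: two_sided_ideal_def subspace_of_def)
       (simp add: I0_def z conv_dual_add[OF kp_hom] conv_dual_vscale[OF kp_hom])
  show "\<forall>x y. h_mult m x y - h_mult m y x \<in> I0"
    using conv_dual_Lf_commute by (simp add: I0_def conv_dual_diff[OF kp_hom])
qed

text \<open>Convolution with t undoes the operator, so f(t_i z) is the sum over a of t_a times the
  operator value at the second leg \<open>c i a\<close>. Off the diagonal these legs lie in
  \<open>I0\<close>, on the diagonal the leg is h_i. The choice z = 1 / t_{h_i} makes the surviving
  argument of \<open>f\<close> equal to 1.\<close>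

lemma tv_hh_K: "tv i / tv (hh i) \<in> K"
proof (rule mem_K_if_commutes)
  fix f assume f: "Blin f"
  let ?z = "1 / tv (hh i)"
  have off: "comat kp c (Lf f ?z) i a = 0" if "a \<noteq> i" for a
    using ker_c[OF I0_ideal that] f by (simp add: I0_def conv_dual_def comat_def)
  have cL: "conv kp c tv (Lf f ?z) = (\<lambda>b. f (tv b * ?z))"
    unfolding Lf_def by (simp only: conv_assoc[OF kp_hom, symmetric] conv_t_tau conv_unit_l[OF kp_hom])
  have "f (tv i * ?z) = conv kp c tv (Lf f ?z) i"
    by (simp only: cL)
  also have "\<dots> = (\<Sum>a\<in>UNIV. tv a * comat kp c (Lf f ?z) i a)"
    by (rule conv_comat)
  also have "\<dots> = (\<Sum>a\<in>UNIV. if a = i then tv i * comat kp c (Lf f ?z) i i else 0)"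
    by (rule sum.cong) (auto simp: off)
  also have "\<dots> = tv i * Lf f ?z (hh i)"
    by (simp add: comat_diag[OF kp_hom])
  also have "Lf f ?z (hh i) = f 1 / tv (hh i)"
    unfolding Lf_def P_h[OF kp_hom hh_P] by (simp add: tau_P[OF hh_P] pvar_nonzero)
  finally show "f (tv i / tv (hh i)) = tv i / tv (hh i) * f 1" by simp
qed

text \<open>The difference of the two group-likes lies in \<open>I0\<close>, so their operator
  values coincide; with z = 1 / t_q one of them is f(1) / t_q.\<close>

lemma tv_P_K:
  assumes "p \<in> P" "q \<in> P" "dg p = dg q"
  shows "tv p / tv q \<in> K"
proof (rule mem_K_if_commutes)
  fix f assume f: "Blin f"
  let ?z = "1 / tv q"
  have "conv_dual kp (Lf f ?z) (h_basis p - h_basis q) = 0"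
    using ker_P[OF I0_ideal assms] f by (simp add: I0_def)
  then have "Lf f ?z p = Lf f ?z q"
    by (simp add: conv_dual_diff[OF kp_hom] conv_dual_basis[OF kp_hom])
  then have "f (tv p / tv q) / tv p = f 1 / tv q"
    unfolding Lf_def P_h[OF kp_hom assms(1)] P_h[OF kp_hom assms(2)]
    by (simp add: tau_P assms pvar_nonzero)
  then show "f (tv p / tv q) = tv p / tv q * f 1"
    by (simp add: field_simps pvar_nonzero)
qed

lemma tv_dg_K:
  assumes "dg i = dg j"
  shows "tv i / tv j \<in> K"
proof -
  have "tv i / tv (hh i) * (tv (hh i) / tv (hh j)) / (tv j / tv (hh j)) \<in> K"
    by (intro K_mult K_div tv_hh_K tv_P_K hh_P) (simp add: dg_hh assms)
  then show ?thesis by (simp add: pvar_nonzero)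
qed

lemma pair_P:
  assumes h: "is_ring_hom h" and pq: "p \<in> P" "q \<in> P"
  shows "conv h (pair_c c) f g (p, q) = f (p, q) * g (p, q)"
proof -
  have "conv h (pair_c c) f g (p, q) = (\<Sum>a\<in>UNIV. \<Sum>b\<in>UNIV. if b = (p, q) then (if a = (p, q) then f (p, q) * g (p, q) else 0) else 0)"
    unfolding conv_def
    by (intro sum.cong refl) (auto simp: pair_c_def P_c[OF pq(1)] P_c[OF pq(2)] ring_hom_0[OF h] ring_hom_1[OF h] split: prod.splits if_splits)
  then show ?thesis by simp
qed

lemma sg_P: "p \<in> P \<Longrightarrow> q \<in> P \<Longrightarrow> sg (p, q) = tv p * tv q / tv (pm p q)"
  and sgi_P: "p \<in> P \<Longrightarrow> q \<in> P \<Longrightarrow> sgi (p, q) = tv (pm p q) / (tv p * tv q)"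
  by (simp_all add: sg_def sgi_def pair_P[OF kp_hom] mulf_P[OF kp_hom] tensf_def tau_P P_pm)

text \<open>Replacing \<open>i\<close>, \<open>j\<close>, \<open>l\<close> by group-likes of the
  same degrees changes the quotient by factors in \<open>K\<close>, and on group-likes it is a value
  of \<sigma>^{-1}.\<close>

lemma tv_m_K:
  assumes "m i j l \<noteq> 0"
  shows "tv l / (tv i * tv j) \<in> K"
proof -
  have "tv l / tv (pm (hh i) (hh j)) * sgi (hh i, hh j) / (tv i / tv (hh i)) / (tv j / tv (hh j)) \<in> K"
    by (intro K_mult K_div tv_hh_K tv_dg_K B_K sgi_B dg_m assms)
  then show ?thesis by (simp add: pvar_nonzero sgi_P hh_P)
qed

section \<open>Classes of Laurent monomials modulo K\<close>

lemma lmon_tv_add: "lmon tv (\<lambda>b. v b + w b) = lmon tv v * lmon tv w"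
  and lmon_tv_diff: "lmon tv (\<lambda>b. v b - w b) = lmon tv v / lmon tv w"
  and lmon_tv_nonzero: "lmon tv v \<noteq> 0"
  by (simp_all add: lmon_add lmon_diff lmon_nonzero pvar_nonzero)

text \<open>The exponents that occur in the localization A, where only the variables of group-likes
  are inverted.\<close>

definition V where "V = {v. \<forall>b. b \<notin> P \<longrightarrow> (0::int) \<le> v b}"

lemma V_add: "v \<in> V \<Longrightarrow> w \<in> V \<Longrightarrow> (\<lambda>b. v b + w b) \<in> V"
  by (simp add: V_def)

text \<open>The span of the Laurent monomials in the class of y modulo K; the cosets of K play the role of
  the grading of S(t_H) by the group underlying H_ab.\<close>
inductive_set Asp for y where
  zero: "0 \<in> Asp y"
| step: "x \<in> Asp y \<Longrightarrow> v \<in> V \<Longrightarrow> lmon tv v / y \<in> K \<Longrightarrow> x + kp a * lmon tv v \<in> Asp y"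

lemma Asp_add: "x' \<in> Asp y \<Longrightarrow> x \<in> Asp y \<Longrightarrow> x + x' \<in> Asp y"
proof (induction rule: Asp.induct)
  case (step x' v a)
  then have "(x + x') + kp a * lmon tv v \<in> Asp y" by (intro Asp.step)
  then show ?case by (simp add: add.assoc)
qed simp

lemma Asp_scale: "x \<in> Asp y \<Longrightarrow> kp a * x \<in> Asp y"
proof (induction rule: Asp.induct)
  case (step x v b)
  then have "kp a * x + kp (a * b) * lmon tv v \<in> Asp y" by (intro Asp.step)
  then show ?case by (simp add: ring_hom_mult[OF kp_hom] distrib_left mult.assoc)
qed (simp add: Asp.zero)

lemma Asp_diff: "x \<in> Asp y \<Longrightarrow> x' \<in> Asp y \<Longrightarrow> x - x' \<in> Asp y"
  using Asp_add[OF Asp_scale[of x' y "- 1"]] by (simp add: ring_hom_minus[OF kp_hom] ring_hom_1[OF kp_hom])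

lemma Asp_mon: "v \<in> V \<Longrightarrow> lmon tv v / y \<in> K \<Longrightarrow> lmon tv v \<in> Asp y"
  using Asp.step[OF Asp.zero, of v y 1] by (simp add: ring_hom_1[OF kp_hom])

lemma Asp_mult: "x' \<in> Asp y' \<Longrightarrow> x \<in> Asp y \<Longrightarrow> x * x' \<in> Asp (y * y')"
proof (induction rule: Asp.induct)
  case zero
  then show ?case by (simp add: Asp.zero)
next
  case (step x' v a)
  note v = step.hyps(2,3)
  have "x * lmon tv v \<in> Asp (y * y')" using step.prems
  proof (induction rule: Asp.induct)
    case zero
    then show ?case by (simp add: Asp.zero)
  next
    case (step x w b)
    have "lmon tv (\<lambda>b. w b + v b) / (y * y') = lmon tv w / y * (lmon tv v / y')"
      by (simp add: lmon_tv_add)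
    also have "\<dots> \<in> K" using step v by (intro K_mult)
    finally have "x * lmon tv v + kp b * lmon tv (\<lambda>b. w b + v b) \<in> Asp (y * y')"
      using step v by (intro Asp.step V_add)
    then show ?case by (simp add: lmon_tv_add algebra_simps)
  qed
  from Asp_add[OF step.IH[OF step.prems] Asp_scale[OF this, of a]]
  have "kp a * (x * lmon tv v) + x * x' \<in> Asp (y * y')" .
  then show ?case by (simp add: algebra_simps)
qed

lemma Asp_sum: "(\<And>a. a \<in> A \<Longrightarrow> f a \<in> Asp y) \<Longrightarrow> sum f A \<in> Asp y"
  by (rule sum_mem) (auto intro: Asp.zero Asp_add)

lemma lmon_tv_single: "lmon tv (\<lambda>b. if b = i then 1 else 0) = tv i"
  and lmon_tv_single_inv: "lmon tv (\<lambda>b. if b = i then -1 else 0) = 1 / tv i"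
  by (simp_all add: lmon_delta power_int_minus divide_inverse)

lemma Asp_tv: "tv i / y \<in> K \<Longrightarrow> tv i \<in> Asp y"
  using Asp_mon[of "\<lambda>b. if b = i then 1 else 0" y] by (simp add: lmon_tv_single V_def)

lemma Asp_tv_inv: "p \<in> P \<Longrightarrow> 1 / tv p / y \<in> K \<Longrightarrow> 1 / tv p \<in> Asp y"
  using Asp_mon[of "\<lambda>b. if b = p then -1 else 0" y] by (auto simp: lmon_tv_single_inv V_def)

lemma Asp_kp: "kp a \<in> Asp 1"
proof -
  have "lmon tv (\<lambda>_. 0) \<in> Asp 1" by (rule Asp_mon) (simp_all add: V_def K_1)
  from Asp_scale[OF this, of a] show ?thesis by simp
qed

lemma Asp_TM: "TM (i, j) \<in> Asp (tv i * tv j)"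
  unfolding mulf_def prod.case
proof (rule Asp_sum)
  fix l
  show "kp (m i j l) * tv l \<in> Asp (tv i * tv j)"
    by (cases "m i j l = 0") (auto simp: ring_hom_0[OF kp_hom] intro: Asp.zero Asp_scale Asp_tv tv_m_K)
qed

lemma Asp_cong_K:
  assumes "x \<in> Asp y" "y / y' \<in> K" "y \<noteq> 0"
  shows "x \<in> Asp y'"
  using assms(1)
proof (induction rule: Asp.induct)
  case (step x v a)
  have "lmon tv v / y' = lmon tv v / y * (y / y')" using assms by simp
  also have "\<dots> \<in> K" using step assms by (intro K_mult)
  finally show ?case using step by (intro Asp.step)
qed (rule Asp.zero)

lemma Asp_comat_t: "comat kp c tv i a \<in> Asp (tv i)"
  unfolding comat_def
proof (rule Asp_sum)
  fix b
  show "kp (c i a b) * tv b \<in> Asp (tv i)"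
    by (cases "c i a b = 0") (auto simp: ring_hom_0[OF kp_hom] intro: Asp.zero Asp_scale Asp_tv tv_dg_K dg_c)
qed

text \<open>By \<open>dg_c\<close> the second legs of e_i and e_j keep the degrees of
  \<open>i\<close> and \<open>j\<close>, so a whole row of the matrix lies in one class.\<close>

lemma Asp_comat_TM: "comat kp (pair_c c) TM (i, j) q \<in> Asp (tv i * tv j)"
  unfolding comat_def
proof (rule Asp_sum)
  fix b :: "'b \<times> 'b"
  obtain x y a a' where q: "b = (x, y)" "q = (a, a')" by (cases b; cases q)
  show "kp (pair_c c (i, j) q b) * TM b \<in> Asp (tv i * tv j)"
  proof (cases "c i a x = 0 \<or> c j a' y = 0")
    case True
    then show ?thesis by (auto simp: q pair_c_def ring_hom_0[OF kp_hom] Asp.zero)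
  next
    case False
    have "tv x / tv i * (tv y / tv j) \<in> K"
      using False dg_c by (intro K_mult tv_dg_K) auto
    then have "TM (x, y) \<in> Asp (tv i * tv j)"
      by (intro Asp_cong_K[OF Asp_TM]) (simp_all add: pvar_nonzero)
    then show ?thesis unfolding q by (rule Asp_scale)
  qed
qed

lemma comat_TM_diag: "comat kp (pair_c c) f (i, j) (i, j) = f (hh i, hh j)"
proof -
  have "kp (pair_c c (i, j) (i, j) b) = (if b = (hh i, hh j) then 1 else 0)" for b
    by (cases b) (simp add: pair_c_def diag ring_hom_0[OF kp_hom] ring_hom_1[OF kp_hom])
  then show ?thesis by (simp only: comat_def sum_delta_mult)
qed

lemma pair_rk: "pair_c c i a b \<noteq> 0 \<Longrightarrow> a = i \<or> (case a of (x, y) \<Rightarrow> rk x + rk y) < (case i of (x, y) \<Rightarrow> rk x + rk y)"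
  by (auto simp: pair_c_def dest!: rk_less split: prod.splits)

lemma K_inverse: "x \<in> K \<Longrightarrow> 1 / x \<in> K"
  by (rule K_div[OF K_1])

text \<open>The matrix of t composed with the multiplication has rows of class t_i t_j, so its
  inverse has columns of the inverse class. The recursion divides only by diagonal entries, which
  are variables of group-likes, and so stays inside A.\<close>

lemma Asp_comat_ZM: "comat kp (pair_c c) ZM p (a, b) \<in> Asp (1 / (tv a * tv b))"
proof -
  let ?Y = "\<lambda>(a, b). Asp (1 / (tv a * tv b))"
  have dg: "comat kp (pair_c c) TM (i, j) (i, j) = tv (pm (hh i) (hh j))" for i j
    by (simp add: comat_TM_diag mulf_P[OF kp_hom hh_P hh_P])
  have inv: "1 / tv (pm (hh i) (hh j)) \<in> Asp (1 / (tv i * tv j))" for i j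
  proof (rule Asp_tv_inv)
    \<comment> \<open>Passing from \<open>i\<close> and \<open>j\<close> to their diagonal
      group-likes leaves a value of \<sigma> on group-likes, which is in \<open>B\<close>.\<close>
    have "tv i / tv (hh i) * (tv j / tv (hh j)) * sg (hh i, hh j) \<in> K"
      by (intro K_mult tv_hh_K B_K sg_B)
    then show "1 / tv (pm (hh i) (hh j)) / (1 / (tv i * tv j)) \<in> K"
      by (simp add: sg_P hh_P pvar_nonzero)
  qed (simp add: P_pm hh_P)
  have "comat kp (pair_c c) ZM p (a, b) \<in> ?Y (a, b)"
  proof (rule c2.comat_inverse_mem[where r = "\<lambda>(x, y). rk x + rk y" and f = TM and h = kp])
    show "is_ring_hom kp" by (rule kp_hom)
    show "pair_c c i a b \<noteq> 0 \<Longrightarrow> a = i \<or> (case a of (x, y) \<Rightarrow> rk x + rk y) < (case i of (x, y) \<Rightarrow> rk x + rk y)" for i a b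
      by (rule pair_rk)
    show "comat kp (pair_c c) TM i i \<noteq> 0" for i
      by (cases i) (simp add: dg pvar_nonzero)
    show "cv2 ZM TM = (\<lambda>i. kp (pair_ep ep i))" by (rule cv2_inverses)
    show "0 \<in> ?Y j" for j by (cases j) (simp add: Asp.zero)
    show "x - y \<in> ?Y j" if "x \<in> ?Y j" "y \<in> ?Y j" for j x y using that by (cases j) (simp add: Asp_diff)
    show "1 / comat kp (pair_c c) TM i i \<in> ?Y i" for i by (cases i) (simp add: dg inv)
    show "comat kp (pair_c c) TM i k * z / comat kp (pair_c c) TM i i \<in> ?Y j" if "z \<in> ?Y j" for i k j z
    proof -
      obtain i1 i2 j1 j2 where ij: "i = (i1, i2)" "j = (j1, j2)" by (cases i; cases j)
      have "comat kp (pair_c c) TM i k * (z * (1 / tv (pm (hh i1) (hh i2))))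
          \<in> Asp ((tv i1 * tv i2) * ((1 / (tv j1 * tv j2)) * (1 / (tv i1 * tv i2))))"
        using that unfolding ij by (intro Asp_mult Asp_comat_TM inv) simp
      then show ?thesis by (simp add: ij dg pvar_nonzero)
    qed
  qed
  then show ?thesis by simp
qed

lemma Asp_comat_tau: "comat kp c tau i a \<in> Asp (1 / tv a)"
proof (rule comat_inverse_mem[where r = rk and f = tv and h = kp and Y = "\<lambda>a. Asp (1 / tv a)"])
  have inv: "1 / tv (hh i) \<in> Asp (1 / tv i)" for i
    using tv_hh_K[of i] by (intro Asp_tv_inv hh_P) simp
  show "is_ring_hom kp" by (rule kp_hom)
  show "c i a b \<noteq> 0 \<Longrightarrow> a = i \<or> rk a < rk i" for i a b by (rule rk_less)
  show "comat kp c tv i i \<noteq> 0" for i by (simp add: comat_diag[OF kp_hom] pvar_nonzero)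
  show "conv kp c tau tv = (\<lambda>i. kp (ep i))" by (rule conv_tau_t)
  show "0 \<in> Asp (1 / tv j)" for j by (rule Asp.zero)
  show "x - y \<in> Asp (1 / tv j)" if "x \<in> Asp (1 / tv j)" "y \<in> Asp (1 / tv j)" for j x y using that by (rule Asp_diff)
  show "1 / comat kp c tv i i \<in> Asp (1 / tv i)" for i by (simp add: comat_diag[OF kp_hom] inv)
  show "comat kp c tv i k * z / comat kp c tv i i \<in> Asp (1 / tv j)" if "z \<in> Asp (1 / tv j)" for i k j z
  proof -
    have "comat kp c tv i k * (z * (1 / tv (hh i))) \<in> Asp (tv i * ((1 / tv j) * (1 / tv i)))"
      using that by (intro Asp_mult Asp_comat_t inv)
    then show ?thesis by (simp add: comat_diag[OF kp_hom] pvar_nonzero)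
  qed
qed

text \<open>In each summand of a cocycle value the class of the first factor cancels against the
  class of the matching column of the inverse matrix.\<close>

lemma B_subset_Asp: "B \<subseteq> Asp 1"
proof
  fix b assume "b \<in> B"
  then show "b \<in> Asp 1"
  proof (rule B_induct)
    show "kp x \<in> Asp 1" for x by (rule Asp_kp)
    show "x + y \<in> Asp 1" if "x \<in> Asp 1" "y \<in> Asp 1" for x y using that by (simp add: Asp_add)
    show "x * y \<in> Asp 1" if "x \<in> Asp 1" "y \<in> Asp 1" for x y using Asp_mult[OF that(2,1)] by simp
    show "sg p \<in> Asp 1" for p
      unfolding sg_def c2.conv_comat
    proof (rule Asp_sum)
      fix q :: "'b \<times> 'b"
      obtain a b where q: "q = (a, b)" by (cases q)
      have "(tv a * tv b) * comat kp (pair_c c) ZM p q \<in> Asp ((tv a * tv b) * (1 / (tv a * tv b)))"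
        unfolding q by (intro Asp_mult Asp_comat_ZM Asp_tv) (simp_all add: pvar_nonzero K_1)
      then show "TT q * comat kp (pair_c c) ZM p q \<in> Asp 1"
        by (simp add: q tensf_def pvar_nonzero)
    qed
    show "sgi p \<in> Asp 1" for p
      unfolding sgi_def c2.conv_comat
    proof (rule Asp_sum)
      fix q :: "'b \<times> 'b"
      obtain a b where q: "q = (a, b)" by (cases q)
      obtain i j where p: "p = (i, j)" by (cases p)
      have "comat kp (pair_c c) ZZ p q = comat kp c tau i a * comat kp c tau j b"
        by (simp add: comat_def p q sum_UNIV_pair pair_c_def tensf_def ring_hom_mult[OF kp_hom] sum_product mult_ac)
      then have "TM q * comat kp (pair_c c) ZZ p q \<in> Asp ((tv a * tv b) * ((1 / tv a) * (1 / tv b)))"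
        unfolding q by (simp only:) (intro Asp_mult Asp_comat_tau Asp_TM)
      then show "TM q * comat kp (pair_c c) ZZ p q \<in> Asp 1"
        by (simp add: pvar_nonzero)
    qed
  qed
qed

text \<open>The values \<sigma>(p, p^k) = t_p t_{p^k} / t_{p^{k+1}} telescope over k < n to t_p^n
  t_1 / t_{p^n}, and p^n = 1 for a suitable n.\<close>

lemma tv_power_unit:
  assumes "p \<in> P"
  shows "\<exists>n>0. tv p ^ n \<in> B \<and> inverse (tv p ^ n) \<in> B"
proof -
  \<comment> \<open>On the unit the cocycle is t_1 t_1 / t_1, so t_1 itself is a unit of
    \<open>B\<close>; here t_1 is \<open>tv u\<close>.\<close>
  have uB: "tv u \<in> B" "1 / tv u \<in> B"
    using sg_B[of "(u, u)"] sgi_B[of "(u, u)"] by (simp_all add: sg_P sgi_P u_P pm_u pvar_nonzero)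
  have it: "(pm p ^^ n) u \<in> P" for n
    by (induction n) (simp_all add: u_P P_pm assms)
  have "tv p ^ n * tv u / tv ((pm p ^^ n) u) \<in> B \<and> tv ((pm p ^^ n) u) / (tv p ^ n * tv u) \<in> B" for n
  proof (induction n)
    case 0
    then show ?case by (simp add: pvar_nonzero B_1)
  next
    case (Suc n)
    let ?q = "(pm p ^^ n) u"
    have "tv p ^ n * tv u / tv ?q * sg (p, ?q) \<in> B" "tv ?q / (tv p ^ n * tv u) * sgi (p, ?q) \<in> B"
      by (rule B_mult[OF conjunct1[OF Suc] sg_B], rule B_mult[OF conjunct2[OF Suc] sgi_B])
    then show ?case by (simp add: sg_P sgi_P it assms pvar_nonzero mult_ac)
  qed
  moreover obtain n where "n > 0" "(pm p ^^ n) u = u" using P_torsion[OF assms] by blast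
  ultimately have "tv p ^ n * tv u / tv u \<in> B \<and> tv u / (tv p ^ n * tv u) \<in> B"
    by metis
  then have "tv p ^ n \<in> B \<and> inverse (tv p ^ n) \<in> B"
    by (simp add: pvar_nonzero inverse_eq_divide)
  with \<open>n > 0\<close> show ?thesis by blast
qed

lemma uniform_exponent:
  obtains N where "N > 0" "\<And>p. p \<in> P \<Longrightarrow> tv p ^ N \<in> B" "\<And>p. p \<in> P \<Longrightarrow> inverse (tv p ^ N) \<in> B"
proof -
  obtain n where n: "\<And>p. p \<in> P \<Longrightarrow> n p > 0 \<and> tv p ^ n p \<in> B \<and> inverse (tv p ^ n p) \<in> B"
    using tv_power_unit by metis
  let ?N = "\<Prod>p\<in>P. n p"
  have "?N > 0" using n by (simp add: prod_pos)
  moreover have "tv p ^ ?N \<in> B \<and> inverse (tv p ^ ?N) \<in> B" if p: "p \<in> P" for p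
  proof -
    have "?N = n p * (\<Prod>p\<in>P - {p}. n p)" using p by (simp add: prod.remove)
    then have "tv p ^ ?N = (tv p ^ n p) ^ (\<Prod>p\<in>P - {p}. n p)"
      "inverse (tv p ^ ?N) = (inverse (tv p ^ n p)) ^ (\<Prod>p\<in>P - {p}. n p)"
      by (simp_all add: power_mult power_inverse)
    then show ?thesis using n[OF p] power_mem[OF B_1 B_mult] by metis
  qed
  ultimately show ?thesis using that by blast
qed

subsection \<open>Generic translation\<close>

text \<open>The generic translation t_x -> s_(x_1) t_(x_2), with new variables s over the field Frac S(t_H).\<close>
definition wform :: "'b \<Rightarrow> ('b, ('b, 'k) mpoly fract) mpoly" where
  "wform i = (\<Sum>a\<in>UNIV. Poly_Mapping.single (Poly_Mapping.single a 1) (comat kp c tv i a))"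

definition trans0 :: "('b, 'k) mpoly \<Rightarrow> ('b, ('b, 'k) mpoly fract) mpoly" where
  "trans0 = poly_ev (\<lambda>x. Poly_Mapping.single 0 (kp x)) wform"

lemma single_kp_hom: "is_ring_hom (\<lambda>x. Poly_Mapping.single 0 (kp x) :: ('b, ('b, 'k) mpoly fract) mpoly)"
  by (rule ring_hom_comp[OF single_0_ring_hom kp_hom])

lemma trans0_hom: "is_ring_hom trans0"
  unfolding trans0_def by (rule poly_ev_ring_hom[OF single_kp_hom])

text \<open>Specialises s_j to \<epsilon>(e_j). This reverses the translation, because
  \<epsilon>(x_1) t_{x_2} = t_x.\<close>

definition spec :: "('b, ('b, 'k) mpoly fract) mpoly \<Rightarrow> ('b, 'k) mpoly fract" where
  "spec = poly_ev (\<lambda>x. x) (\<lambda>j. kp (ep j))"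

lemma spec_trans0: "spec (trans0 p) = Fract p 1"
proof -
  have "is_ring_hom (\<lambda>p. spec (trans0 p))"
    unfolding spec_def by (rule ring_hom_comp[OF poly_ev_ring_hom[OF id_ring_hom] trans0_hom])
  then show ?thesis
  proof (rule ring_hom_poly_eqI[OF _ Fract_1_ring_hom])
    show "spec (trans0 (Poly_Mapping.single 0 a)) = Fract (Poly_Mapping.single 0 a) 1" for a
      by (simp add: spec_def trans0_def poly_ev_single[OF single_kp_hom] poly_ev_single[OF id_ring_hom]) (simp add: pconst_def)
    show "spec (trans0 (Poly_Mapping.single (Poly_Mapping.single v 1) 1)) =
        Fract (Poly_Mapping.single (Poly_Mapping.single v 1) 1) 1" for v
    proof -
      have "trans0 (Poly_Mapping.single (Poly_Mapping.single v 1) 1) = wform v"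
        by (simp add: trans0_def poly_ev_single[OF single_kp_hom] ring_hom_1[OF kp_hom])
      moreover have "spec (wform v) = (\<Sum>a\<in>UNIV. kp (ep a) * comat kp c tv v a)"
        by (simp add: spec_def wform_def poly_ev_sum[OF id_ring_hom] poly_ev_single[OF id_ring_hom] mult.commute)
      ultimately show ?thesis
        using sum_ep_comat[OF kp_hom, of tv v] by (simp add: pvar_def)
    qed
  qed
qed

lemma trans0_inj: "trans0 p = 0 \<Longrightarrow> p = 0"
  using spec_trans0[of p] by (simp add: spec_def Fract_1_eq_0_iff)

definition trans where "trans = fract_ext UNIV (\<lambda>p. Fract (trans0 p) 1)"

lemma trans_hom: "is_ring_hom trans"
  unfolding trans_def
  by (rule fract_ext_UNIV_ring_hom[OF ring_hom_comp[OF Fract_1_ring_hom trans0_hom]])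
     (simp add: Fract_1_eq_0_iff trans0_inj)

lemma trans_Fract: "trans (Fract p 1) = Fract (trans0 p) 1"
proof -
  have "trans (Fract p 1) = Fract (trans0 p) 1 / Fract (trans0 1) 1"
    unfolding trans_def
    by (rule fract_ext_Fract[OF ring_hom_comp[OF Fract_1_ring_hom trans0_hom]])
       (simp_all add: Fract_1_eq_0_iff trans0_inj)
  then show ?thesis by (simp add: ring_hom_1[OF trans0_hom])
qed

abbreviation lift :: "('b, 'k) mpoly fract \<Rightarrow> ('b, ('b, 'k) mpoly fract) mpoly fract" where "lift \<equiv> pconst"
abbreviation sv :: "'b \<Rightarrow> ('b, ('b, 'k) mpoly fract) mpoly fract" where "sv \<equiv> pvar"
abbreviation kE where "kE \<equiv> (\<lambda>x. lift (kp x))"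

lemma lift_hom: "is_ring_hom lift"
  by (rule pconst_ring_hom)

lemma kE_hom: "is_ring_hom kE"
  by (rule ring_hom_comp[OF lift_hom kp_hom])

lemma trans_kp: "trans (kp x) = kE x"
proof -
  have "trans (kp x) = Fract (trans0 (Poly_Mapping.single 0 x)) 1"
    unfolding pconst_def by (rule trans_Fract)
  then show ?thesis by (simp add: trans0_def poly_ev_single[OF single_kp_hom]) (simp add: pconst_def[of "kp x"])
qed

lemma trans_tv: "trans (tv i) = conv kE c sv (\<lambda>j. lift (tv j)) i"
proof -
  have "trans (tv i) = Fract (trans0 (Poly_Mapping.single (Poly_Mapping.single i 1) 1)) 1"
    unfolding pvar_def by (rule trans_Fract)
  also have "trans0 (Poly_Mapping.single (Poly_Mapping.single i 1) 1) = wform i"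
    by (simp add: trans0_def poly_ev_single[OF single_kp_hom] ring_hom_1[OF kp_hom])
  also have "Fract (wform i) 1 = (\<Sum>a\<in>UNIV. lift (comat kp c tv i a) * sv a)"
    unfolding wform_def ring_hom_sum[OF Fract_1_ring_hom]
    by (rule sum.cong) (simp_all add: pconst_def pvar_def mult_single)
  also have "\<dots> = conv kE c sv (\<lambda>j. lift (tv j)) i"
    by (simp add: conv_comat comat_def ring_hom_sum[OF lift_hom] ring_hom_mult[OF lift_hom] mult.commute)
  finally show ?thesis .
qed

text \<open>Laurent polynomials in s over \<open>B\<close>. The denominator is a single monomial
  with coefficient 1, so that no coefficient is ever divided.\<close>

definition BB :: "('b, ('b, 'k) mpoly fract) mpoly fract set" where
  "BB = {Fract q (Poly_Mapping.single M 1) | q M. \<forall>k. Poly_Mapping.lookup q k \<in> B}"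

lemma BBI: "(\<And>k. Poly_Mapping.lookup q k \<in> B) \<Longrightarrow> Fract q (Poly_Mapping.single M 1) \<in> BB"
  unfolding BB_def by blast

lemma coeffs_mult: "(\<And>k. Poly_Mapping.lookup p k \<in> B) \<Longrightarrow> (\<And>k. Poly_Mapping.lookup q k \<in> B) \<Longrightarrow> Poly_Mapping.lookup (p * q) k \<in> B"
  for p q :: "('b, ('b, 'k) mpoly fract) mpoly"
proof -
  assume pq: "\<And>k. Poly_Mapping.lookup p k \<in> B" "\<And>k. Poly_Mapping.lookup q k \<in> B"
  show ?thesis
    unfolding lookup_times
  proof (rule sum_mem[OF B_0 B_add])
    fix x
    show "(case x of (a, b) \<Rightarrow> if a + b = k then Poly_Mapping.lookup p a * Poly_Mapping.lookup q b else 0) \<in> B"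
      using B_mult[OF pq] B_0 by (cases x) simp
  qed
qed

lemma coeffs_single: "a \<in> B \<Longrightarrow> Poly_Mapping.lookup (Poly_Mapping.single M a) k \<in> B"
  by (simp add: lookup_single when_def B_0)

lemma BB_mult: "x \<in> BB \<Longrightarrow> y \<in> BB \<Longrightarrow> x * y \<in> BB" and BB_add: "x \<in> BB \<Longrightarrow> y \<in> BB \<Longrightarrow> x + y \<in> BB"
proof -
  assume "x \<in> BB" "y \<in> BB"
  then obtain p M q N where x: "x = Fract p (Poly_Mapping.single M 1)" "\<And>k. Poly_Mapping.lookup p k \<in> B"
    and y: "y = Fract q (Poly_Mapping.single N 1)" "\<And>k. Poly_Mapping.lookup q k \<in> B"
    unfolding BB_def by blast
  have "x * y = Fract (p * q) (Poly_Mapping.single (M + N) 1)"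
    by (simp add: x y mult_single)
  moreover have "Fract (p * q) (Poly_Mapping.single (M + N) 1) \<in> BB"
    by (rule BBI) (rule coeffs_mult[OF x(2) y(2)])
  ultimately show "x * y \<in> BB" by simp
  have "x + y = Fract (p * Poly_Mapping.single N 1 + q * Poly_Mapping.single M 1) (Poly_Mapping.single (M + N) 1)"
    by (simp add: x y mult_single single_eq_0_iff)
  moreover have "Fract (p * Poly_Mapping.single N 1 + q * Poly_Mapping.single M 1) (Poly_Mapping.single (M + N) 1) \<in> BB"
    by (rule BBI) (simp add: lookup_add, intro B_add coeffs_mult x(2) y(2) coeffs_single B_1)
  ultimately show "x + y \<in> BB" by simp
qed

lemma BB_lift: "a \<in> B \<Longrightarrow> lift a \<in> BB"
proof -
  assume "a \<in> B"
  then have "Fract (Poly_Mapping.single 0 a) (Poly_Mapping.single 0 1) \<in> BB"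
    by (intro BBI coeffs_single)
  then show ?thesis by (simp add: pconst_def)
qed

lemma BB_sv: "sv j \<in> BB" and BB_sv_inv: "1 / sv j \<in> BB"
proof -
  have "Fract (Poly_Mapping.single (Poly_Mapping.single j 1) 1) (Poly_Mapping.single 0 1) \<in> BB"
    by (intro BBI coeffs_single B_1)
  then show "sv j \<in> BB" by (simp add: pvar_def del: One_nat_def)
  have "Fract (Poly_Mapping.single 0 1) (Poly_Mapping.single (Poly_Mapping.single j 1) 1) \<in> BB"
    by (intro BBI coeffs_single B_1)
  then show "1 / sv j \<in> BB" by (simp add: pvar_def inverse_eq_divide[symmetric] del: One_nat_def)
qed

lemma BB_0: "0 \<in> BB" and BB_kE: "kE x \<in> BB"
  using BB_lift[OF B_0] BB_lift[OF B_const] by (simp_all add: ring_hom_0[OF lift_hom])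

lemma BB_sum: "(\<And>a. a \<in> A \<Longrightarrow> f a \<in> BB) \<Longrightarrow> sum f A \<in> BB"
  by (rule sum_mem) (auto intro: BB_0 BB_add)

lemma BB_conv: "(\<And>i. f i \<in> BB) \<Longrightarrow> (\<And>i. g i \<in> BB) \<Longrightarrow> conv kE d f g i \<in> BB"
  unfolding conv_def by (intro BB_sum BB_mult BB_kE)

lemma BB_mulf: "(\<And>i. f i \<in> BB) \<Longrightarrow> mulf kE m f p \<in> BB"
  unfolding mulf_def by (cases p) (simp, intro BB_sum BB_mult BB_kE)

lemma BB_tensf: "(\<And>i. f i \<in> BB) \<Longrightarrow> (\<And>i. g i \<in> BB) \<Longrightarrow> tensf f g p \<in> BB"
  unfolding tensf_def by (cases p) (simp add: BB_mult)

text \<open>The diagonal of the matrix of s consists of variables s_{h_i}, which are units of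
  \<open>BB\<close>. Hence the inverse matrix has entries in \<open>BB\<close>, and the counit
  extracts the inverse map from it.\<close>

lemma sv_inverse:
  obtains sinv where "conv kE c sv sinv = (\<lambda>i. kE (ep i))" "conv kE c sinv sv = (\<lambda>i. kE (ep i))" "\<And>i. sinv i \<in> BB"
proof -
  have d: "comat kE c sv i i = sv (hh i)" for i by (rule comat_diag[OF kE_hom])
  have dn: "comat kE c sv i i \<noteq> 0" for i by (simp add: d pvar_nonzero)
  have ex: "\<exists>g. conv kE c g sv = (\<lambda>i. kE (ep i)) \<and> conv kE c sv g = (\<lambda>i. kE (ep i))"
    using dn by (rule conv_inverse_exists[OF kE_hom, of rk sv, rotated]) (blast, erule rk_less)
  then obtain g where g: "conv kE c g sv = (\<lambda>i. kE (ep i))" "conv kE c sv g = (\<lambda>i. kE (ep i))"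
    by blast
  have cm: "comat kE c f i j \<in> BB" if "\<And>i. f i \<in> BB" for f i j
    unfolding comat_def by (intro BB_sum BB_mult BB_kE that)
  have BBd: "x - y \<in> BB" if "x \<in> BB" "y \<in> BB" for x y
    using BB_add[OF that(1) BB_mult[OF BB_kE[of "- 1"] that(2)]]
    by (simp add: ring_hom_minus[OF kE_hom] ring_hom_1[OF kE_hom])
  have "comat kE c g i j \<in> BB" for i j
  proof (rule comat_inverse_mem[where r = rk and f = sv and h = kE and Y = "\<lambda>_. BB"])
    show "is_ring_hom kE" by (rule kE_hom)
    show "c i a b \<noteq> 0 \<Longrightarrow> a = i \<or> rk a < rk i" for i a b by (rule rk_less)
    show "comat kE c sv i i \<noteq> 0" for i by (rule dn)
    show "conv kE c g sv = (\<lambda>i. kE (ep i))" by (rule g)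
    show "0 \<in> BB" by (rule BB_0)
    show "x - y \<in> BB" if "x \<in> BB" "y \<in> BB" for x y using that by (rule BBd)
    show "1 / comat kE c sv i i \<in> BB" for i by (simp only: d BB_sv_inv)
    show "comat kE c sv i k * z / comat kE c sv i i \<in> BB" if "z \<in> BB" for i k z
    proof -
      have "comat kE c sv i k \<in> BB" by (rule cm, rule BB_sv)
      from BB_mult[OF BB_mult[OF this that] BB_sv_inv[of "hh i"]] show ?thesis by (simp add: d)
    qed
  qed
  then have "(\<Sum>a\<in>UNIV. kE (ep a) * comat kE c g i a) \<in> BB" for i
    by (intro BB_sum BB_mult BB_kE)
  then have "g i \<in> BB" for i by (simp only: sum_ep_comat[OF kE_hom])
  with g show ?thesis using that by blast
qed

text \<open>Translation replaces t by the convolution of s and t, hence t^{-1} by that of t^{-1} and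
  s^{-1}. In a translated cocycle the t-factors become adjacent and form the cocycle of t again,
  enclosed by factors in s alone; so all coefficients lie in \<open>B\<close>.\<close>

lemma trans_B: "b \<in> B \<Longrightarrow> trans b \<in> BB"
proof -
  assume "b \<in> B"
  obtain sinv where s: "conv kE c sv sinv = (\<lambda>i. kE (ep i))" "conv kE c sinv sv = (\<lambda>i. kE (ep i))"
    and sB: "\<And>i. sinv i \<in> BB" by (rule sv_inverse) blast
  let ?lt = "\<lambda>j. lift (tv j)" and ?lz = "\<lambda>j. lift (tau j)"
  have tt: "(\<lambda>i. trans (tv i)) = conv kE c sv ?lt"
    by (rule ext) (rule trans_tv)
  have lifts: "conv kE c ?lt ?lz = (\<lambda>i. kE (ep i))" "conv kE c ?lz ?lt = (\<lambda>i. kE (ep i))"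
    using arg_cong[OF fun_cong[OF conv_t_tau], of lift] arg_cong[OF fun_cong[OF conv_tau_t], of lift]
    by (auto simp: ring_hom_conv[OF lift_hom])
  have "conv kE c (\<lambda>i. trans (tau i)) (\<lambda>i. trans (tv i)) = (\<lambda>i. kE (ep i))"
    using arg_cong[OF fun_cong[OF conv_tau_t], of trans] by (auto simp: ring_hom_conv[OF trans_hom] trans_kp)
  moreover have "conv kE c (\<lambda>i. trans (tv i)) (conv kE c ?lz sinv) = (\<lambda>i. kE (ep i))"
  proof -
    have "conv kE c (\<lambda>i. trans (tv i)) (conv kE c ?lz sinv) = conv kE c sv (conv kE c (conv kE c ?lt ?lz) sinv)"
      by (simp only: tt conv_assoc[OF kE_hom])
    then show ?thesis by (simp only: lifts conv_unit_l[OF kE_hom] s)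
  qed
  ultimately have tz: "(\<lambda>i. trans (tau i)) = conv kE c ?lz sinv"
    by (rule conv_inverse_unique[OF kE_hom])
  let ?cv = "conv kE (pair_c c)"
  have mult: "mulf kE m (conv kE c f g) = ?cv (mulf kE m f) (mulf kE m g)" for f g
    by (rule conv_mulf[OF kE_hom bialg])
  have tens: "tensf (conv kE c f g) (conv kE c f' g') = ?cv (tensf f f') (tensf g g')" for f g f' g'
    by (rule conv_tensf[OF kE_hom, symmetric])
  have lsg: "?cv (tensf ?lt ?lt) (mulf kE m ?lz) = (\<lambda>p. lift (sg p))"
    by (rule ext) (simp add: sg_def ring_hom_conv[OF lift_hom] ring_hom_tensf[OF lift_hom] ring_hom_mulf[OF lift_hom])
  have lsgi: "?cv (mulf kE m ?lt) (tensf ?lz ?lz) = (\<lambda>p. lift (sgi p))"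
    by (rule ext) (simp add: sgi_def ring_hom_conv[OF lift_hom] ring_hom_tensf[OF lift_hom] ring_hom_mulf[OF lift_hom])
  have tsg: "trans (sg p) = ?cv (tensf (\<lambda>i. trans (tv i)) (\<lambda>i. trans (tv i))) (mulf kE m (\<lambda>i. trans (tau i))) p" for p
    by (simp add: sg_def ring_hom_conv[OF trans_hom] ring_hom_tensf[OF trans_hom] ring_hom_mulf[OF trans_hom] trans_kp)
  have tsgi: "trans (sgi p) = ?cv (mulf kE m (\<lambda>i. trans (tv i))) (tensf (\<lambda>i. trans (tau i)) (\<lambda>i. trans (tau i))) p" for p
    by (simp add: sgi_def ring_hom_conv[OF trans_hom] ring_hom_tensf[OF trans_hom] ring_hom_mulf[OF trans_hom] trans_kp)
  have "trans (sg p) = ?cv (tensf sv sv) (?cv (?cv (tensf ?lt ?lt) (mulf kE m ?lz)) (mulf kE m sinv)) p" for p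
    by (simp only: tsg tt tz mult tens c2.conv_assoc[OF kE_hom])
  then have sg: "trans (sg p) \<in> BB" for p
    by (simp only: lsg) (intro BB_conv BB_tensf BB_mulf BB_sv sB BB_lift sg_B)
  have "trans (sgi p) = ?cv (mulf kE m sv) (?cv (?cv (mulf kE m ?lt) (tensf ?lz ?lz)) (tensf sinv sinv)) p" for p
    by (simp only: tsgi tt tz mult tens c2.conv_assoc[OF kE_hom])
  then have sgi: "trans (sgi p) \<in> BB" for p
    by (simp only: lsgi) (intro BB_conv BB_tensf BB_mulf BB_sv sB BB_lift sgi_B)
  have "b \<in> {b. trans b \<in> BB}"
    by (rule B_induct[OF \<open>b \<in> B\<close>])
       (simp_all add: trans_kp BB_kE sg sgi ring_hom_add[OF trans_hom] ring_hom_mult[OF trans_hom] BB_add BB_mult)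
  then show ?thesis by simp
qed

lemma trans0_coeffs:
  assumes "Fract a 1 \<in> B"
  shows "Poly_Mapping.lookup (trans0 a) k \<in> B"
proof -
  have "Fract (trans0 a) 1 \<in> BB" using trans_B[OF assms] by (simp only: trans_Fract)
  then obtain q M where q: "Fract (trans0 a) 1 = Fract q (Poly_Mapping.single M 1)" "\<And>k. Poly_Mapping.lookup q k \<in> B"
    unfolding BB_def by blast
  then have "trans0 a * Poly_Mapping.single M 1 = q"
    by (simp add: eq_fract single_eq_0_iff)
  then show ?thesis using q(2)[of "k + M"] lookup_times_single[of "trans0 a" M k] by simp
qed

text \<open>By \<open>tri\<close> only variables s_a with a \<ge> i occur in the image of t_i, and
  these are at most s_i in the monomial order.\<close>

lemma wform_keys: "\<forall>k\<in>Poly_Mapping.keys (wform i). k \<le> Poly_Mapping.single i 1"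
proof
  fix k assume "k \<in> Poly_Mapping.keys (wform i)"
  then obtain a where a: "k \<in> Poly_Mapping.keys (Poly_Mapping.single (Poly_Mapping.single a (1::nat)) (comat kp c tv i a))"
    unfolding wform_def by (auto dest!: subsetD[OF keys_sum])
  then have k: "k = Poly_Mapping.single a 1" "comat kp c tv i a \<noteq> 0" by (auto split: if_splits)
  have "\<exists>b. c i a b \<noteq> 0"
    using k(2) unfolding comat_def by (metis (no_types, lifting) mult_zero_left ring_hom_0[OF kp_hom] sum.neutral)
  then show "k \<le> Poly_Mapping.single i 1"
    using tri single_le_single_iff_ge k(1) by blast
qed

lemma wform_top: "Poly_Mapping.lookup (wform i) (Poly_Mapping.single i 1) = tv (hh i)"
proof -
  have eq: "(Poly_Mapping.single a (1::nat) = Poly_Mapping.single i 1) \<longleftrightarrow> a = i" for a :: 'b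
    by (metis lookup_single_eq lookup_single_not_eq one_neq_zero)
  have "Poly_Mapping.lookup (wform i) (Poly_Mapping.single i 1) = (\<Sum>a\<in>UNIV. if a = i then comat kp c tv i i else 0)"
    unfolding wform_def lookup_sum by (rule sum.cong) (auto simp: lookup_single when_def eq simp del: One_nat_def)
  then show ?thesis by (simp add: comat_diag[OF kp_hom])
qed

text \<open>Translation turns the division into one of polynomials in s over \<open>B\<close>. The
  leading coefficient of the translated \<open>b\<close> is a constant times a monomial in the
  t_{h_i}. It lies in \<open>B\<close>, and so does the inverse of its N-th power; hence its own
  inverse lies in \<open>B\<close> and \<open>coeffs_quotient_mem\<close> applies. Specialising s
  brings the quotient back.\<close>

lemma B_divisible:
  assumes b: "b \<noteq> 0" "Fract b 1 \<in> B" and ba: "Fract (b * a) 1 \<in> B"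
  shows "Fract a 1 \<in> B"
proof -
  obtain N where N: "N > 0" "\<And>p. p \<in> P \<Longrightarrow> tv p ^ N \<in> B" "\<And>p. p \<in> P \<Longrightarrow> inverse (tv p ^ N) \<in> B"
    by (rule uniform_exponent) (rule that)
  define M where "M = Max (Poly_Mapping.keys b)"
  let ?x = "Poly_Mapping.lookup (trans0 b) M"
  have top: "\<forall>k\<in>Poly_Mapping.keys (trans0 b). k \<le> M"
    and lead: "?x = kp (Poly_Mapping.lookup b M) * mon_ev (\<lambda>i. tv (hh i)) M"
    using poly_ev_top[OF kp_hom wform_keys b(1)] unfolding trans0_def M_def by (simp_all add: wform_top del: One_nat_def)
  have "M \<in> Poly_Mapping.keys b" unfolding M_def using b(1) by simp
  then have cn: "Poly_Mapping.lookup b M \<noteq> 0" by (simp add: in_keys_iff)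
  have nz: "?x \<noteq> 0"
    unfolding lead using cn by (simp add: field_hom_eq_0_iff[OF kp_hom] mon_ev_def pvar_nonzero)
  have xB: "?x \<in> B" by (rule trans0_coeffs[OF b(2)])
  have "inverse (?x ^ N) = kp (inverse (Poly_Mapping.lookup b M ^ N)) *
      (\<Prod>i\<in>Poly_Mapping.keys M. inverse (tv (hh i) ^ N) ^ Poly_Mapping.lookup M i)"
    unfolding lead mon_ev_def
    by (simp add: power_mult_distrib field_hom_inverse[OF kp_hom] ring_hom_power[OF kp_hom] prod_power_distrib
        power_inverse prod_inversef[unfolded o_def] power_mult[symmetric] mult.commute)
  also have "\<dots> \<in> B"
    by (intro B_mult B_const prod_mem[OF B_1 B_mult] power_mem[OF B_1 B_mult] N hh_P)
  finally have "?x ^ (N - 1) * inverse (?x ^ N) \<in> B"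
    by (intro B_mult power_mem[OF B_1 B_mult] xB)
  moreover have "?x ^ (N - 1) * inverse (?x ^ N) = inverse ?x"
    using nz N(1) by (cases N) (simp_all add: field_simps)
  ultimately have inv: "inverse ?x \<in> B" by simp
  have pr: "Poly_Mapping.lookup (trans0 b * trans0 a) k \<in> B" for k
    using trans0_coeffs[OF ba, of k] by (simp add: ring_hom_mult[OF trans0_hom])
  have co: "Poly_Mapping.lookup (trans0 a) k \<in> B" for k
    by (rule coeffs_quotient_mem[OF B_0 B_diff B_mult trans0_coeffs[OF b(2)] pr top nz inv])
  have "spec (trans0 a) \<in> B"
    unfolding spec_def poly_ev_def mon_ev_def
    by (intro sum_mem[OF B_0 B_add] B_mult co prod_mem[OF B_1 B_mult] power_mem[OF B_1 B_mult] B_const)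
  then show ?thesis by (simp only: spec_trans0)
qed

section \<open>Monomials of trivial class lie in the base algebra\<close>

lemma polynomial_lmon:
  assumes "\<And>b. 0 \<le> v b"
  shows "\<exists>a. lmon tv v = Fract a 1"
proof -
  define e where "e = (\<Sum>b\<in>UNIV. Poly_Mapping.single b (nat (v b)))"
  have "int (Poly_Mapping.lookup e b) = v b" for b
    using assms by (simp add: e_def lookup_sum lookup_single when_def)
  then have "lmon tv v = mon_ev tv e" by (simp add: mon_ev_lmon)
  then show ?thesis by (metis mon_ev_pvar)
qed

text \<open>Claimed for all large exponents, so that two elements can be cleared by the same one and
  the exponent can be taken divisible by a given number.\<close>

lemma clear_denominators:
  assumes "x \<in> Asp y"
  shows "\<exists>n0. \<forall>n\<ge>n0. \<exists>a. x * lmon tv (\<lambda>b. if b \<in> P then int n else 0) = Fract a 1"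
  using assms
proof (induction rule: Asp.induct)
  case zero
  show ?case by (intro exI[of _ 0] allI impI exI[of _ 0]) (simp add: Zero_fract_def)
next
  case (step x v d)
  then obtain n0 where n0: "\<forall>n\<ge>n0. \<exists>a. x * lmon tv (\<lambda>b. if b \<in> P then int n else 0) = Fract a 1" by blast
  define n1 where "n1 = (\<Sum>b\<in>UNIV. nat \<bar>v b\<bar>)"
  have n1: "\<bar>v b\<bar> \<le> int n1" for b
  proof -
    have "nat \<bar>v b\<bar> \<le> n1" unfolding n1_def by (rule member_le_sum) auto
    then show ?thesis by linarith
  qed
  show ?case
  proof (intro exI[of _ "max n0 n1"] allI impI)
    fix n assume n: "max n0 n1 \<le> n"
    let ?U = "lmon tv (\<lambda>b. if b \<in> P then int n else 0)"
    obtain a where a: "x * ?U = Fract a 1" using n0 n by auto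
    have "0 \<le> v b + (if b \<in> P then int n else 0)" for b
      using n1[of b] n step.hyps(2) unfolding V_def by (auto split: if_splits)
    from polynomial_lmon[of "\<lambda>b. v b + (if b \<in> P then int n else 0)", OF this] obtain a' where
      "lmon tv v * ?U = Fract a' 1" by (auto simp: lmon_tv_add)
    then have "(x + kp d * lmon tv v) * ?U = Fract (a + Poly_Mapping.single 0 d * a') 1"
      using a by (simp add: distrib_right mult.assoc pconst_def)
    then show "\<exists>a. (x + kp d * lmon tv v) * ?U = Fract a 1" by blast
  qed
qed

text \<open>Let the monomial be y1 / y2 over \<open>B\<close>. Multiplying both y2 and the monomial
  by one monomial U in the t_p makes them polynomials, whose product y1 U U lies in \<open>B\<close>
  when the exponent of U is a multiple of \<open>N\<close>, since U is then a unit of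
  \<open>B\<close>. So \<open>B_divisible\<close> gives the monomial times U, and U is divided
  out.\<close>

lemma K_lmon_B:
  assumes v: "v \<in> V" and K: "lmon tv v \<in> K"
  shows "lmon tv v \<in> B"
proof -
  obtain N where N: "N > 0" "\<And>p. p \<in> P \<Longrightarrow> tv p ^ N \<in> B" "\<And>p. p \<in> P \<Longrightarrow> inverse (tv p ^ N) \<in> B"
    by (rule uniform_exponent) (rule that)
  let ?U = "\<lambda>n. lmon tv (\<lambda>b. if b \<in> P then int n else 0)"
  have U: "?U (N * n) \<in> B \<and> inverse (?U (N * n)) \<in> B" for n
  proof -
    have "?U (N * n) = (\<Prod>b\<in>UNIV. if b \<in> P then (tv b ^ N) ^ n else 1)"
      unfolding lmon_def by (rule prod.cong) (auto simp: power_mult simp flip: of_nat_mult)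
    moreover have "inverse (?U (N * n)) = (\<Prod>b\<in>UNIV. if b \<in> P then (inverse (tv b ^ N)) ^ n else 1)"
      unfolding lmon_def prod_inversef[symmetric] o_def
      by (rule prod.cong) (auto simp: power_mult power_inverse simp flip: of_nat_mult)
    ultimately show ?thesis
      by (auto intro!: prod_mem[OF B_1 B_mult] power_mem[OF B_1 B_mult] N B_1)
  qed
  obtain y1 y2 where y: "lmon tv v = y1 / y2" "y1 \<in> B" "y2 \<in> B" "y2 \<noteq> 0"
    using K unfolding K_def by blast
  have "y2 \<in> Asp 1" using y B_subset_Asp by blast
  then obtain n2 where n2: "\<forall>n\<ge>n2. \<exists>a. y2 * ?U n = Fract a 1" using clear_denominators by blast
  have "lmon tv v \<in> Asp 1" using v K by (intro Asp_mon) simp_all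
  then obtain n3 where n3: "\<forall>n\<ge>n3. \<exists>a. lmon tv v * ?U n = Fract a 1" using clear_denominators by blast
  let ?n = "N * (n2 + n3)"
  have le: "n2 \<le> ?n" "n3 \<le> ?n" using N(1) by (cases N; simp)+
  obtain a where a: "lmon tv v * ?U ?n = Fract a 1" using n3 le by blast
  obtain b where b: "y2 * ?U ?n = Fract b 1" using n2 le by blast
  have b1: "Fract b 1 \<in> B" unfolding b[symmetric] using y U by (intro B_mult) auto
  have b0: "b \<noteq> 0"
  proof
    assume "b = 0"
    then have "y2 * ?U ?n = 0" using b by (simp add: Zero_fract_def)
    then show False using y lmon_tv_nonzero by simp
  qed
  have ba: "Fract (b * a) 1 \<in> B"
  proof -
    have "Fract (b * a) 1 = (y2 * ?U ?n) * (lmon tv v * ?U ?n)" unfolding a b by simp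
    also have "\<dots> = y1 * ?U ?n * ?U ?n" using y by (simp add: field_simps)
    also have "\<dots> \<in> B" using y U by (intro B_mult) auto
    finally show ?thesis .
  qed
  have "lmon tv v * ?U ?n * inverse (?U ?n) \<in> B"
    unfolding a by (rule B_mult[OF B_divisible[OF b0 b1 ba] conjunct2[OF U]])
  then show ?thesis by (simp only: mult.assoc right_inverse[OF lmon_tv_nonzero] mult_1_right)
qed

lemma B_eq_Asp: "B = Asp 1"
proof
  show "B \<subseteq> Asp 1" by (rule B_subset_Asp)
  show "Asp 1 \<subseteq> B"
  proof
    fix x assume "x \<in> Asp 1"
    then show "x \<in> B"
      by (induction rule: Asp.induct) (auto intro: B_0 B_add B_mult B_const K_lmon_B)
  qed
qed

end

section \<open>The localization\<close>

text \<open>The isomorphism is easier to define on the localization, by numerators and denominators,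
  and has to be reversed afterwards.\<close>

lemma k_alg_iso_inv_into:
  assumes bij: "bij_betw f B A"
    and add: "\<And>x y. x \<in> B \<Longrightarrow> y \<in> B \<Longrightarrow> x + y \<in> B \<and> f (x + y) = f x + f y"
    and mult: "\<And>x y. x \<in> B \<Longrightarrow> y \<in> B \<Longrightarrow> x * y \<in> B \<and> f (x * y) = f x * f y"
    and const: "\<And>a. pconst a \<in> B \<and> f (pconst a) = pconst a"
  shows "k_alg_iso A B (inv_into B f)"
proof -
  let ?g = "inv_into B f"
  have gB: "?g x \<in> B" "f (?g x) = x" if "x \<in> A" for x
    using bij that by (auto simp: bij_betw_def inv_into_into f_inv_into_f)
  have gf: "?g (f y) = y" if "y \<in> B" for y
    using bij that by (auto simp: bij_betw_def)
  have "?g (x + y) = ?g x + ?g y" "?g (x * y) = ?g x * ?g y" if "x \<in> A" "y \<in> A" for x y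
    using gf[of "?g x + ?g y"] gf[of "?g x * ?g y"] add[OF gB(1) gB(1), OF that] mult[OF gB(1) gB(1), OF that] gB that
    by simp_all
  moreover have gc: "?g (pconst a) = pconst a" for a
    using gf[of "pconst a"] const by simp
  moreover have "pconst a \<in> A" for a
    using bij const by (metis bij_betw_apply)
  moreover have "?g 1 = 1"
    using gc[of 1] by (simp add: ring_hom_1[OF pconst_ring_hom])
  ultimately show ?thesis
    unfolding k_alg_iso_def using bij_betw_inv_into[OF bij] by simp
qed

lemma poly_ring_subring: "subring_on (poly_ring n)"
  unfolding subring_on_def
proof (intro conjI ballI)
  show "1 \<in> poly_ring n" by (simp add: poly_ring_def)
  fix a b :: "(nat, 'a) mpoly" assume ab: "a \<in> poly_ring n" "b \<in> poly_ring n"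
  show "a + b \<in> poly_ring n"
    unfolding poly_ring_def
  proof (intro CollectI ballI)
    fix k assume "k \<in> Poly_Mapping.keys (a + b)"
    then have "k \<in> Poly_Mapping.keys a \<or> k \<in> Poly_Mapping.keys b" using keys_add[of a b] by blast
    then show "Poly_Mapping.keys k \<subseteq> {..<n}" using ab by (auto simp: poly_ring_def)
  qed
  show "a * b \<in> poly_ring n"
    unfolding poly_ring_def
  proof (intro CollectI ballI)
    fix k assume "k \<in> Poly_Mapping.keys (a * b)"
    then obtain x y where xy: "k = x + y" "x \<in> Poly_Mapping.keys a" "y \<in> Poly_Mapping.keys b"
      using keys_mult[of a b] by blast
    then have "Poly_Mapping.keys x \<subseteq> {..<n}" "Poly_Mapping.keys y \<subseteq> {..<n}" using ab by (auto simp: poly_ring_def)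
    then show "Poly_Mapping.keys k \<subseteq> {..<n}" unfolding xy using keys_add[of x y] by blast
  qed
qed

lemma poly_ring_single: "Poly_Mapping.keys k \<subseteq> {..<n} \<Longrightarrow> Poly_Mapping.single k a \<in> poly_ring n"
  by (simp add: poly_ring_def)

context triangular_bialgebra
begin

text \<open>There is one variable for each basis index. Indices in \<open>P\<close> carry a basis of
  the exponents of trivial class supported on \<open>P\<close>, any other index b carries t_b /
  t_{h_b}. Monomials with coefficient 1 in the variables from \<open>P\<close> form the
  multiplicative set.\<close>

lemma localization_iso:
  "\<exists>(n::nat) (T :: (nat, 'k) mpoly set) phi. mult_subset n T \<and> k_alg_iso B (localization n T) phi"
proof -
  let ?L = "{v. lmon tv v \<in> K}"
  have LN: "\<exists>n>0. (\<lambda>b. if b = p then n else 0) \<in> ?L" if p: "p \<in> P" for p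
  proof -
    obtain n where "n > 0" "tv p ^ n \<in> B" using tv_power_unit[OF p] by blast
    then show ?thesis by (intro exI[of _ "int n"]) (simp add: lmon_delta B_K)
  qed
  have L0: "(\<lambda>_. 0) \<in> ?L" by (simp add: K_1)
  have Ld: "(\<lambda>b. v b - w b) \<in> ?L" if "v \<in> ?L" "w \<in> ?L" for v w
    using that by (simp add: lmon_tv_diff K_div)
  obtain v where v1: "\<And>p. p \<in> P \<Longrightarrow> v p \<in> ?L \<and> (\<forall>b. b \<notin> P \<longrightarrow> v p b = 0)"
    and v2: "\<And>w. w \<in> ?L \<Longrightarrow> (\<forall>b. b \<notin> P \<longrightarrow> w b = 0) \<Longrightarrow> \<exists>n. \<forall>b. w b = (\<Sum>p\<in>P. n p * v p b)"
    and v3: "\<And>n. (\<forall>b. (\<Sum>p\<in>P. n p * v p b) = 0) \<Longrightarrow> (\<forall>p\<in>P. n p = 0)"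
    by (rule lattice_basis[of ?L P, OF L0 Ld finite LN]) (assumption, assumption, assumption, rule that)
  define ex where "ex b = (if b \<in> P then v b else (\<lambda>a. (if a = b then 1 else 0) - (if a = hh b then 1 else 0)))" for b
  \<comment> \<open>In the columns outside \<open>P\<close> the exponent matrix is the identity, so
    exponents there can be read off and only those on \<open>P\<close> need the lattice
    basis.\<close>
  have ex_nonP: "ex b a = (if a = b then 1 else 0)" if "a \<notin> P" for a b
    using that v1[of b] hh_P[of b] by (auto simp: ex_def)
  have ex_K: "lmon tv (ex b) \<in> K" for b
    using v1 tv_hh_K[of b] by (auto simp: ex_def lmon_tv_diff lmon_tv_single)
  define w where "w b = lmon tv (ex b)" for b
  have wB: "w b \<in> B" for b
    unfolding w_def by (rule K_lmon_B) (auto simp: V_def ex_nonP ex_K)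
  have wiB: "inverse (w b) \<in> B" if "b \<in> P" for b
  proof -
    have "lmon tv (\<lambda>a. - ex b a) \<in> B"
    proof (rule K_lmon_B)
      show "(\<lambda>a. - ex b a) \<in> V" using that by (auto simp: V_def ex_nonP)
      show "lmon tv (\<lambda>a. - ex b a) \<in> K" using K_inverse[OF ex_K[of b]] by (simp add: lmon_minus inverse_eq_divide)
    qed
    then show ?thesis by (simp add: w_def lmon_minus)
  qed
  have expand: "\<exists>n. (\<forall>b. b \<notin> P \<longrightarrow> 0 \<le> n b) \<and> lmon tv u = (\<Prod>b\<in>UNIV. w b powi n b)" if u: "u \<in> V" "lmon tv u \<in> K" for u
  proof -
    \<comment> \<open>Removing the coordinates outside \<open>P\<close>, which are nonnegative,
      leaves a vector of trivial class supported on \<open>P\<close>.\<close>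
    define u' where "u' a = u a - (\<Sum>b\<in>-P. u b * ex b a)" for a
    have "lmon tv u' = lmon tv u / (\<Prod>b\<in>-P. w b powi u b)"
      unfolding u'_def w_def by (simp add: lmon_tv_diff lmon_sum pvar_nonzero)
    also have "(\<Prod>b\<in>-P. w b powi u b) = (\<Prod>b\<in>-P. w b ^ nat (u b))"
      using u by (intro prod.cong) (auto simp: V_def power_int_def)
    also have "lmon tv u / \<dots> \<in> K"
      by (intro K_div u prod_mem[OF K_1 K_mult] power_mem[OF K_1 K_mult]) (simp_all add: B_K wB)
    finally have "u' \<in> ?L" by simp
    moreover have "u' a = 0" if "a \<notin> P" for a
    proof -
      have "(\<Sum>b\<in>-P. u b * ex b a) = (\<Sum>b\<in>-P. if b = a then u a else 0)"
        by (rule sum.cong) (auto simp: ex_nonP[OF that])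
      then show ?thesis using that by (simp add: u'_def)
    qed
    ultimately obtain n where n: "\<forall>b. u' b = (\<Sum>p\<in>P. n p * v p b)" using v2 by blast
    define n' where "n' b = (if b \<in> P then n b else u b)" for b
    have "u a = (\<Sum>b\<in>UNIV. n' b * ex b a)" for a
    proof -
      have "(\<Sum>b\<in>UNIV. n' b * ex b a) = (\<Sum>b\<in>P. n' b * ex b a) + (\<Sum>b\<in>-P. n' b * ex b a)"
        by (subst sum.union_disjoint[symmetric]) auto
      also have "(\<Sum>b\<in>P. n' b * ex b a) = (\<Sum>b\<in>P. n b * v b a)"
        by (rule sum.cong) (auto simp: n'_def ex_def)
      also have "(\<Sum>b\<in>-P. n' b * ex b a) = (\<Sum>b\<in>-P. u b * ex b a)"
        by (rule sum.cong) (auto simp: n'_def)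
      finally show ?thesis using n[rule_format, of a] unfolding u'_def by linarith
    qed
    then have "u = (\<lambda>a. \<Sum>b\<in>UNIV. n' b * ex b a)" by (rule ext)
    then have "lmon tv u = (\<Prod>b\<in>UNIV. w b powi n' b)"
      using lmon_sum[of tv n' ex UNIV] by (simp add: w_def pvar_nonzero)
    moreover have "\<forall>b. b \<notin> P \<longrightarrow> 0 \<le> n' b" using u by (simp add: n'_def V_def)
    ultimately show ?thesis by blast
  qed
  \<comment> \<open>Coefficients outside \<open>P\<close> are read off from the columns; those on
    \<open>P\<close> vanish by independence of the lattice basis.\<close>
  have indep: "n = n'" if eq: "\<And>a. (\<Sum>b\<in>UNIV. n b * ex b a) = (\<Sum>b\<in>UNIV. n' b * ex b a)" for n n' :: "'b \<Rightarrow> int"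
  proof -
    define d where "d b = n b - n' b" for b
    have d0: "(\<Sum>b\<in>UNIV. d b * ex b a) = 0" for a
      using eq[of a] by (simp add: d_def left_diff_distrib sum_subtractf)
    have dn: "d a = 0" if "a \<notin> P" for a
    proof -
      have "(\<Sum>b\<in>UNIV. d b * ex b a) = (\<Sum>b\<in>UNIV. if b = a then d a else 0)"
        by (rule sum.cong) (auto simp: ex_nonP[OF that])
      then show ?thesis using d0[of a] by simp
    qed
    have "(\<Sum>p\<in>P. d p * v p a) = (\<Sum>b\<in>UNIV. d b * ex b a)" for a
      by (rule sum.mono_neutral_cong_left) (auto simp: dn ex_def)
    then have "\<forall>p\<in>P. d p = 0" using v3 d0 by simp
    then have "d b = 0" for b using dn by blast
    then show ?thesis by (auto simp: d_def)
  qed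
  define n where "n = card (UNIV :: 'b set)"
  obtain en where en: "bij_betw en {..<n} (UNIV :: 'b set)"
    using ex_bij_betw_nat_finite[of "UNIV :: 'b set"] by (auto simp: n_def atLeast0LessThan)
  define ix where "ix = inv_into {..<n} en"
  have ix: "ix b < n" "en (ix b) = b" for b
    using en unfolding ix_def bij_betw_def by (metis UNIV_I inv_into_into lessThan_iff, metis UNIV_I f_inv_into_f)
  have ixen: "ix (en i) = i" if "i < n" for i
    using en that unfolding ix_def bij_betw_def by simp
  define psi where "psi = poly_ev pconst (\<lambda>i. w (en i))"
  have psi_hom: "is_ring_hom psi" unfolding psi_def by (rule poly_ev_ring_hom[OF pconst_ring_hom])
  define T :: "(nat, 'k) mpoly set" where
    "T = {Poly_Mapping.single k 1 | k. Poly_Mapping.keys k \<subseteq> {i. i < n \<and> en i \<in> P}}"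
  define E where "E k a = (\<Sum>b\<in>UNIV. int (Poly_Mapping.lookup k (ix b)) * ex b a)" for k a
  have mon: "mon_ev (\<lambda>i. w (en i)) k = (\<Prod>b\<in>UNIV. w b ^ Poly_Mapping.lookup k (ix b))" if "Poly_Mapping.keys k \<subseteq> {..<n}" for k
  proof -
    have "mon_ev (\<lambda>i. w (en i)) k = (\<Prod>i<n. w (en i) ^ Poly_Mapping.lookup k i)"
      using that by (intro mon_ev_superset) auto
    also have "\<dots> = (\<Prod>i<n. w (en i) ^ Poly_Mapping.lookup k (ix (en i)))"
      by (rule prod.cong) (simp_all add: ixen)
    also have "\<dots> = (\<Prod>b\<in>UNIV. w b ^ Poly_Mapping.lookup k (ix b))"
      by (rule prod.reindex_bij_betw[OF en])
    finally show ?thesis .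
  qed
  have mon_lmon: "mon_ev (\<lambda>i. w (en i)) k = lmon tv (E k)" if "Poly_Mapping.keys k \<subseteq> {..<n}" for k
    unfolding mon[OF that] E_def by (simp add: lmon_sum pvar_nonzero flip: w_def)
  have E_inj: "k = k'" if "E k = E k'" "Poly_Mapping.keys k \<subseteq> {..<n}" "Poly_Mapping.keys k' \<subseteq> {..<n}" for k k'
  proof (rule poly_mapping_eqI)
    fix i
    have "(\<lambda>b. int (Poly_Mapping.lookup k (ix b))) = (\<lambda>b. int (Poly_Mapping.lookup k' (ix b)))"
      using fun_cong[OF that(1)] by (intro indep) (simp add: E_def)
    then have *: "Poly_Mapping.lookup k (ix b) = Poly_Mapping.lookup k' (ix b)" for b by (meson of_nat_eq_iff)
    show "Poly_Mapping.lookup k i = Poly_Mapping.lookup k' i"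
    proof (cases "i < n")
      case True
      then show ?thesis using *[of "en i"] by (simp add: ixen)
    next
      case False
      then have "i \<notin> Poly_Mapping.keys k" "i \<notin> Poly_Mapping.keys k'" using that by auto
      then show ?thesis by (simp add: in_keys_iff)
    qed
  qed
  \<comment> \<open>Distinct monomials go to Laurent monomials with distinct exponents, which are
    linearly independent.\<close>
  have psi_inj: "p = 0" if p: "p \<in> poly_ring n" "psi p = 0" for p
  proof (rule ccontr)
    assume "p \<noteq> 0"
    then obtain k0 where k0: "k0 \<in> Poly_Mapping.keys p" by fastforce
    have keys: "Poly_Mapping.keys k \<subseteq> {..<n}" if "k \<in> Poly_Mapping.keys p" for k
      using p that by (simp add: poly_ring_def)
    have inj: "inj_on E (Poly_Mapping.keys p)"
      using E_inj keys by (auto intro!: inj_onI)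
    let ?c = "\<lambda>u. Poly_Mapping.lookup p (inv_into (Poly_Mapping.keys p) E u)"
    have "(\<Sum>u\<in>E ` Poly_Mapping.keys p. pconst (?c u) * lmon tv u) =
        (\<Sum>k\<in>Poly_Mapping.keys p. pconst (Poly_Mapping.lookup p k) * lmon tv (E k))"
      using inj by (simp add: sum.reindex)
    also have "\<dots> = psi p"
      unfolding psi_def poly_ev_def by (rule sum.cong) (simp_all add: mon_lmon keys)
    finally have "(\<Sum>u\<in>E ` Poly_Mapping.keys p. pconst (?c u) * lmon tv u) = 0" using p by simp
    from lmon_pvar_independent[OF _ this, of "E k0"] k0 inj have "Poly_Mapping.lookup p k0 = 0" by simp
    then show False using k0 by (simp add: in_keys_iff)
  qed
  define Phi where "Phi = fract_ext (poly_ring n) psi"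
  have TD: "T \<subseteq> poly_ring n" "0 \<notin> T"
    unfolding T_def by (auto simp: poly_ring_def single_eq_0_iff)
  have T: "mult_subset n T"
    unfolding mult_subset_def
  proof (intro conjI ballI)
    have "Poly_Mapping.single 0 1 \<in> T" unfolding T_def by (intro CollectI exI[of _ 0]) simp
    then show "1 \<in> T" by simp
    fix s t assume "s \<in> T" "t \<in> T"
    then obtain k l where "s = Poly_Mapping.single k 1" "t = Poly_Mapping.single l 1"
      "Poly_Mapping.keys k \<subseteq> {i. i < n \<and> en i \<in> P}" "Poly_Mapping.keys l \<subseteq> {i. i < n \<and> en i \<in> P}"
      unfolding T_def by blast
    moreover from this have "Poly_Mapping.keys (k + l) \<subseteq> {i. i < n \<and> en i \<in> P}" using keys_add[of k l] by blast
    ultimately show "s * t \<in> T" unfolding T_def by (auto simp: mult_single)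
  qed (use TD in auto)
  have locE: "\<exists>a s. x = Fract a s \<and> a \<in> poly_ring n \<and> s \<in> T \<and> s \<in> poly_ring n \<and> s \<noteq> 0 \<and> Phi x = psi a / psi s"
    if xT: "x \<in> localization n T" for x
  proof -
    obtain a s where as: "x = Fract a s" "a \<in> poly_ring n" "s \<in> T"
      using xT unfolding localization_def by blast
    moreover from this have "s \<in> poly_ring n" "s \<noteq> 0" using TD by auto
    moreover from this have "Phi (Fract a s) = psi a / psi s"
      unfolding Phi_def using as by (intro fract_ext_Fract psi_hom psi_inj)
    ultimately show ?thesis by blast
  qed
  have psi_B: "psi a \<in> B" for a
    unfolding psi_def poly_ev_def mon_ev_def
    by (intro sum_mem[OF B_0 B_add] B_mult B_const prod_mem[OF B_1 B_mult] power_mem[OF B_1 B_mult] wB)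
  have psi_T: "inverse (psi s) \<in> B" if "s \<in> T" for s
  proof -
    obtain k where k: "s = Poly_Mapping.single k 1" "Poly_Mapping.keys k \<subseteq> {i. i < n \<and> en i \<in> P}"
      using \<open>s \<in> T\<close> unfolding T_def by blast
    have "inverse (psi s) = (\<Prod>i\<in>Poly_Mapping.keys k. inverse (w (en i)) ^ Poly_Mapping.lookup k i)"
      unfolding k psi_def poly_ev_single[OF pconst_ring_hom] mon_ev_def
      by (simp add: ring_hom_1[OF pconst_ring_hom] power_inverse prod_inversef[unfolded o_def])
    also have "\<dots> \<in> B" using k by (intro prod_mem[OF B_1 B_mult] power_mem[OF B_1 B_mult] wiB) auto
    finally show ?thesis .
  qed
  have add: "x + y \<in> localization n T \<and> Phi (x + y) = Phi x + Phi y"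
    and mult: "x * y \<in> localization n T \<and> Phi (x * y) = Phi x * Phi y"
    if xy: "x \<in> localization n T" "y \<in> localization n T" for x y
  proof -
    obtain a s where x: "x = Fract a s" "a \<in> poly_ring n" "s \<in> T" "s \<in> poly_ring n" "s \<noteq> 0" using locE[OF xy(1)] by blast
    obtain b t where y: "y = Fract b t" "b \<in> poly_ring n" "t \<in> T" "t \<in> poly_ring n" "t \<noteq> 0" using locE[OF xy(2)] by blast
    have st: "s * t \<in> T" using T x y by (simp add: mult_subset_def)
    have "a * t + b * s \<in> poly_ring n" "a * b \<in> poly_ring n"
      using poly_ring_subring x y unfolding subring_on_def by blast+
    then have "Fract (a * t + b * s) (s * t) \<in> localization n T" "Fract (a * b) (s * t) \<in> localization n T"
      unfolding localization_def using st by blast+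
    then show "x + y \<in> localization n T \<and> Phi (x + y) = Phi x + Phi y"
      "x * y \<in> localization n T \<and> Phi (x * y) = Phi x * Phi y"
      unfolding Phi_def using x y fract_ext_add_mult[OF psi_hom psi_inj poly_ring_subring, of n a s b t]
      by simp_all
  qed
  have mon_loc: "Fract (Poly_Mapping.single k a) (Poly_Mapping.single l 1) \<in> localization n T \<and>
      Phi (Fract (Poly_Mapping.single k a) (Poly_Mapping.single l 1)) =
        pconst a * mon_ev (\<lambda>i. w (en i)) k / mon_ev (\<lambda>i. w (en i)) l"
    if k: "Poly_Mapping.keys k \<subseteq> {..<n}" and l: "Poly_Mapping.keys l \<subseteq> {i. i < n \<and> en i \<in> P}" for k l a
  proof
    have sT: "Poly_Mapping.single l 1 \<in> T" unfolding T_def using l by blast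
    show "Fract (Poly_Mapping.single k a) (Poly_Mapping.single l 1) \<in> localization n T"
      unfolding localization_def using sT poly_ring_single[OF k] by blast
    have "Phi (Fract (Poly_Mapping.single k a) (Poly_Mapping.single l 1)) =
        psi (Poly_Mapping.single k a) / psi (Poly_Mapping.single l 1)"
      unfolding Phi_def using sT TD poly_ring_single[OF k]
      by (intro fract_ext_Fract psi_hom psi_inj) auto
    then show "Phi (Fract (Poly_Mapping.single k a) (Poly_Mapping.single l 1)) =
        pconst a * mon_ev (\<lambda>i. w (en i)) k / mon_ev (\<lambda>i. w (en i)) l"
      by (simp add: psi_def poly_ev_single[OF pconst_ring_hom] ring_hom_1[OF pconst_ring_hom])
  qed
  have const: "pconst a \<in> localization n T \<and> Phi (pconst a) = pconst a" for a
    using mon_loc[of 0 0 a] by (simp add: pconst_def)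
  have "bij_betw Phi (localization n T) B"
    unfolding bij_betw_def
  proof
    show "inj_on Phi (localization n T)"
    proof (rule inj_onI)
      fix x y assume xy: "x \<in> localization n T" "y \<in> localization n T" "Phi x = Phi y"
      obtain a s where x: "x = Fract a s" "a \<in> poly_ring n" "s \<in> T" "s \<in> poly_ring n" "s \<noteq> 0" "Phi x = psi a / psi s"
        using locE[OF xy(1)] by blast
      obtain b t where y: "y = Fract b t" "b \<in> poly_ring n" "t \<in> T" "t \<in> poly_ring n" "t \<noteq> 0" "Phi y = psi b / psi t"
        using locE[OF xy(2)] by blast
      have "psi s \<noteq> 0" "psi t \<noteq> 0" using x y psi_inj by blast+
      then have "psi a * psi t = psi b * psi s" using xy(3) x(6) y(6) by (simp add: frac_eq_eq)
      then have "psi (a * t - b * s) = 0" by (simp add: ring_hom_diff[OF psi_hom] ring_hom_mult[OF psi_hom])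
      moreover have "a * t - b * s \<in> poly_ring n"
      proof -
        have "Poly_Mapping.single 0 (- 1) \<in> poly_ring n" by (rule poly_ring_single) simp
        then have "a * t + Poly_Mapping.single 0 (- 1) * (b * s) \<in> poly_ring n"
          using poly_ring_subring x y unfolding subring_on_def by blast
        moreover have "Poly_Mapping.single 0 (- 1) = (- 1 :: (nat, 'k) mpoly)"
          by (simp add: single_uminus)
        ultimately show ?thesis by simp
      qed
      ultimately have "a * t - b * s = 0" using psi_inj by blast
      then show "x = y" using x y by (simp add: eq_fract)
    qed
    show "Phi ` localization n T = B"
    proof
      show "Phi ` localization n T \<subseteq> B"
        using locE psi_B psi_T B_mult by (force simp: divide_inverse)
      show "B \<subseteq> Phi ` localization n T"
      proof
        fix x assume "x \<in> B"
        then have "x \<in> Asp 1" by (simp add: B_eq_Asp)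
        then show "x \<in> Phi ` localization n T"
        proof (induction rule: Asp.induct)
          case zero
          show ?case using const[of 0] by (metis image_eqI ring_hom_0[OF pconst_ring_hom])
        next
          case (step x u a)
          then obtain x' where x': "x' \<in> localization n T" "x = Phi x'" by blast
          obtain e where e: "\<forall>b. b \<notin> P \<longrightarrow> 0 \<le> e b" "lmon tv u = (\<Prod>b\<in>UNIV. w b powi e b)"
            using expand[of u] step.hyps by auto
          \<comment> \<open>Positive and negative parts of the exponents. Negative exponents occur
            only at \<open>P\<close>, so the monomial of the negative part belongs to
            \<open>T\<close>.\<close>
          define k where "k = (\<Sum>b\<in>UNIV. Poly_Mapping.single (ix b) (nat (e b)))"
          define l where "l = (\<Sum>b\<in>UNIV. Poly_Mapping.single (ix b) (nat (- e b)))"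
          have ix_eq: "ix b = ix b' \<longleftrightarrow> b = b'" for b b' using ix(2) by metis
          have lk: "Poly_Mapping.lookup k (ix b) = nat (e b)" "Poly_Mapping.lookup l (ix b) = nat (- e b)" for b
            by (simp_all add: k_def l_def lookup_sum lookup_single when_def ix_eq)
          have kk: "Poly_Mapping.keys k \<subseteq> {..<n}"
            unfolding k_def using ix(1) by (auto dest!: subsetD[OF keys_sum] split: if_splits)
          have ll: "Poly_Mapping.keys l \<subseteq> {i. i < n \<and> en i \<in> P}"
          proof
            fix i assume "i \<in> Poly_Mapping.keys l"
            then obtain b where "i \<in> Poly_Mapping.keys (Poly_Mapping.single (ix b) (nat (- e b)))"
              unfolding l_def by (auto dest!: subsetD[OF keys_sum])
            then have "i = ix b" "e b < 0" by (auto split: if_splits)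
            then show "i \<in> {i. i < n \<and> en i \<in> P}" using ix e(1) by force
          qed
          then have ll': "Poly_Mapping.keys l \<subseteq> {..<n}" by auto
          have "w b powi e b = w b ^ nat (e b) / w b ^ nat (- e b)" for b
            by (auto simp: power_int_def divide_inverse power_inverse)
          then have "lmon tv u = mon_ev (\<lambda>i. w (en i)) k / mon_ev (\<lambda>i. w (en i)) l"
            unfolding e(2) mon[OF kk] mon[OF ll'] lk by (simp add: prod_dividef)
          with mon_loc[OF kk ll, of a] add[OF x'(1)] x'(2)
          have "x + pconst a * lmon tv u = Phi (x' + Fract (Poly_Mapping.single k a) (Poly_Mapping.single l 1))"
            "x' + Fract (Poly_Mapping.single k a) (Poly_Mapping.single l 1) \<in> localization n T"
            by (simp_all add: times_divide_eq_right)
          then show ?case by blast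
        qed
      qed
    qed
  qed
  from k_alg_iso_inv_into[OF this add mult const] T show ?thesis by blast
qed

end

section \<open>Triangular bases of pointed coalgebras\<close>

lemma fun_sum_apply: "(\<Sum>a\<in>A. f a) x = (\<Sum>a\<in>A. f a x)"
  by (induction A rule: infinite_finite_induct) simp_all

lemma vector_expand: "x = (\<Sum>a\<in>UNIV. vscale (x a) (h_basis a))" for x :: "'b::finite \<Rightarrow> 'k::field"
proof
  fix b
  have "(\<Sum>a\<in>UNIV. vscale (x a) (h_basis a)) b = (\<Sum>a\<in>UNIV. x a * (if b = a then 1 else 0))"
    by (simp add: fun_sum_apply vscale_def h_basis_def)
  also have "\<dots> = x b" by (simp only: sum_delta_mult)
  finally show "x b = (\<Sum>a\<in>UNIV. vscale (x a) (h_basis a)) b" by simp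
qed

lemma h_basis_inj: "h_basis a = (h_basis b :: 'b \<Rightarrow> 'k::field) \<longleftrightarrow> a = b"
  by (metis h_basis_def zero_neq_one)

interpretation fv: vector_space "vscale :: 'k::field \<Rightarrow> ('b \<Rightarrow> 'k) \<Rightarrow> ('b \<Rightarrow> 'k)"
  by unfold_locales (auto simp: vscale_def algebra_simps)

interpretation fdv: finite_dimensional_vector_space
  "vscale :: 'k::field \<Rightarrow> ('b::finite \<Rightarrow> 'k) \<Rightarrow> ('b \<Rightarrow> 'k)" "range h_basis"
proof
  show "finite (range (h_basis :: 'b \<Rightarrow> 'b \<Rightarrow> 'k))" by simp
  show "fv.independent (range (h_basis :: 'b \<Rightarrow> 'b \<Rightarrow> 'k))"
    unfolding fv.dependent_finite[OF finite_imageI[OF finite]]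
  proof (safe)
    fix u :: "('b \<Rightarrow> 'k) \<Rightarrow> 'k" and b
    assume z: "(\<Sum>v\<in>range h_basis. vscale (u v) v) = 0" and n: "u (h_basis b) \<noteq> 0"
    have "(\<Sum>v\<in>range h_basis. vscale (u v) v) = (\<Sum>a\<in>UNIV. vscale (u (h_basis a)) (h_basis a))"
      by (subst sum.reindex) (auto simp: inj_def h_basis_inj)
    then have "(\<Sum>a\<in>UNIV. vscale (u (h_basis a)) (h_basis a)) b = 0" using z by simp
    then have "(\<Sum>a\<in>UNIV. u (h_basis a) * (if b = a then 1 else 0)) = 0"
      by (simp add: fun_sum_apply vscale_def h_basis_def)
    then show False using n by (simp only: sum_delta_mult)
  qed
  show "fv.span (range (h_basis :: 'b \<Rightarrow> 'b \<Rightarrow> 'k)) = UNIV"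
  proof -
    have "x \<in> fv.span (range (h_basis :: 'b \<Rightarrow> 'b \<Rightarrow> 'k))" for x
      by (subst vector_expand[of x]) (intro fv.span_sum fv.span_scale fv.span_base rangeI)
    then show ?thesis by blast
  qed
qed

lemma subspace_of_eq: "subspace_of C \<longleftrightarrow> fv.subspace C"
  by (simp add: subspace_of_def fv.subspace_def)

lemma lin_span_eq: "lin_span S = fv.span S"
  unfolding lin_span_def fv.span_explicit by blast

lemma independent_coeffs_eq_0:
  fixes e :: "'i::finite \<Rightarrow> 'b \<Rightarrow> 'k::field"
  assumes "fv.independent (range e)" "inj e" "(\<Sum>i\<in>UNIV. vscale (u i) (e i)) = 0"
  shows "u i = 0"
proof -
  have "(\<Sum>v\<in>range e. vscale (u (inv_into UNIV e v)) v) = 0"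
    using assms(2,3) by (simp add: sum.reindex)
  then have "u (inv_into UNIV e (e i)) = 0"
    using fv.independentD[OF assms(1), of "range e" "\<lambda>v. u (inv_into UNIV e v)" "e i"] by simp
  then show ?thesis using assms(2) by simp
qed

text \<open>The operator applying the \<open>b\<close>-th coordinate functional to x_2 in x_1 (x)
  x_2: the right coregular coaction in coordinates.\<close>

definition Rop :: "('b::finite \<Rightarrow> 'b \<Rightarrow> 'b \<Rightarrow> 'k::field) \<Rightarrow> 'b \<Rightarrow> ('b \<Rightarrow> 'k) \<Rightarrow> ('b \<Rightarrow> 'k)" where
  "Rop dl b x = (\<lambda>a. h_comult dl x (a, b))"

lemma Rop_apply: "Rop dl b x a = (\<Sum>i\<in>UNIV. x i * dl i a b)"
  by (simp add: Rop_def h_comult_def)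

lemma Rop_add: "Rop dl b (x + y) = Rop dl b x + Rop dl b y"
  by (rule ext) (simp add: Rop_apply distrib_right sum.distrib)

lemma Rop_scale: "Rop dl b (vscale k x) = vscale k (Rop dl b x)"
  by (rule ext) (simp add: Rop_apply vscale_def sum_distrib_left mult.assoc)

lemma Rop_0: "Rop dl b 0 = 0"
  by (rule ext) (simp add: Rop_apply)

lemma Rop_diff: "Rop dl b (x - y) = Rop dl b x - Rop dl b y"
  by (rule ext) (simp add: Rop_apply left_diff_distrib sum_subtractf)

lemma Rop_sum: "Rop dl b (\<Sum>i\<in>A. f i) = (\<Sum>i\<in>A. Rop dl b (f i))"
  by (induction A rule: infinite_finite_induct) (simp_all only: sum.infinite sum.empty sum.insert Rop_0 Rop_add not_False_eq_True)

text \<open>Stability under all \<open>Rop\<close> expresses that \<Delta>(V) lies in V (x)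
  H.\<close>

definition rcoideal :: "('b::finite \<Rightarrow> 'b \<Rightarrow> 'b \<Rightarrow> 'k::field) \<Rightarrow> ('b \<Rightarrow> 'k) set \<Rightarrow> bool" where
  "rcoideal dl V \<longleftrightarrow> fv.subspace V \<and> (\<forall>x\<in>V. \<forall>b. Rop dl b x \<in> V)"

definition grouplike :: "('b::finite \<Rightarrow> 'b \<Rightarrow> 'b \<Rightarrow> 'k::field) \<Rightarrow> ('b \<Rightarrow> 'k) \<Rightarrow> ('b \<Rightarrow> 'k) \<Rightarrow> bool" where
  "grouplike dl ep g \<longleftrightarrow> h_comult dl g = tens g g \<and> (\<Sum>i\<in>UNIV. g i * ep i) = 1"

lemma Rop_grouplike: "grouplike dl ep g \<Longrightarrow> Rop dl b g = vscale (g b) g"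
  by (simp add: grouplike_def Rop_def tens_def vscale_def mult.commute)

lemma grouplike_nonzero: "grouplike dl ep g \<Longrightarrow> g \<noteq> 0"
  by (auto simp: grouplike_def)

definition dotf :: "('b::finite \<Rightarrow> 'k::field) \<Rightarrow> ('b \<Rightarrow> 'k) \<Rightarrow> 'k" where
  "dotf f x = (\<Sum>a\<in>UNIV. f a * x a)"

lemma dotf_add: "dotf f (x + y) = dotf f x + dotf f y"
  by (simp add: dotf_def distrib_left sum.distrib)

lemma dotf_scale: "dotf f (vscale k x) = k * dotf f x"
  by (simp add: dotf_def vscale_def sum_distrib_left mult_ac)

lemma dotf_0: "dotf f 0 = 0" by (simp add: dotf_def)

text \<open>The operator f(x_1) x_2, acting on the leg opposite to \<open>Rop\<close>; its values
  span coefficient coalgebras.\<close>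

definition Tf :: "('b::finite \<Rightarrow> 'b \<Rightarrow> 'b \<Rightarrow> 'k::field) \<Rightarrow> ('b \<Rightarrow> 'k) \<Rightarrow> ('b \<Rightarrow> 'k) \<Rightarrow> ('b \<Rightarrow> 'k)" where
  "Tf dl f x = (\<lambda>b. dotf f (Rop dl b x))"

lemma Tf_add: "Tf dl f (x + y) = Tf dl f x + Tf dl f y"
  by (rule ext) (simp add: Tf_def Rop_add dotf_add)

lemma Tf_scale: "Tf dl f (vscale k x) = vscale k (Tf dl f x)"
  by (rule ext) (simp add: Tf_def Rop_scale dotf_scale, simp add: vscale_def)

lemma Tf_0: "Tf dl f 0 = 0"
  by (rule ext) (simp add: Tf_def Rop_0 dotf_0)

lemma Tf_sum: "Tf dl f (\<Sum>i\<in>A. g i) = (\<Sum>i\<in>A. Tf dl f (g i))"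
  by (induction A rule: infinite_finite_induct) (simp_all only: sum.infinite sum.empty sum.insert Tf_0 Tf_add not_False_eq_True)

lemma Tf_diff: "Tf dl f (x - y) = Tf dl f x - Tf dl f y"
  by (rule ext) (simp add: Tf_def Rop_diff dotf_def right_diff_distrib sum_subtractf)

section \<open>One-step extensions of right coideals and independence of group-likes\<close>

locale pointed_coalgebra = coalg_consts dl ep
  for dl :: "'b::finite \<Rightarrow> 'b \<Rightarrow> 'b \<Rightarrow> 'k::field" and ep +
  assumes pointed: "pointed dl"
begin

abbreviation "R \<equiv> Rop dl"
abbreviation "Tt \<equiv> Tf dl"
abbreviation "Gl \<equiv> {g. grouplike dl ep g}"

text \<open>Coassociativity: operators on opposite legs commute, which makes \<open>Tt f\<close> a
  comodule map.\<close>

lemma Tf_Rop: "Tt f (R e x) = R e (Tt f x)"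
proof
  fix b
  have "Tt f (R e x) b = (\<Sum>a\<in>UNIV. \<Sum>p\<in>UNIV. \<Sum>i\<in>UNIV. f a * (x i * (dl i p e * dl p a b)))"
    by (simp add: Tf_def dotf_def Rop_apply sum_distrib_left sum_distrib_right mult.assoc)
  also have "\<dots> = (\<Sum>a\<in>UNIV. \<Sum>i\<in>UNIV. f a * (x i * (\<Sum>p\<in>UNIV. dl i p e * dl p a b)))"
    unfolding sum_distrib_left by (rule sum.cong[OF refl], rule sum.swap)
  also have "\<dots> = (\<Sum>a\<in>UNIV. \<Sum>i\<in>UNIV. f a * (x i * (\<Sum>p\<in>UNIV. dl i a p * dl p b e)))"
    by (simp only: coassoc)
  also have "\<dots> = (\<Sum>a\<in>UNIV. \<Sum>p\<in>UNIV. \<Sum>i\<in>UNIV. f a * (x i * (dl i a p * dl p b e)))"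
    unfolding sum_distrib_left by (rule sum.cong[OF refl], rule sum.swap)
  also have "\<dots> = (\<Sum>p\<in>UNIV. \<Sum>a\<in>UNIV. \<Sum>i\<in>UNIV. f a * (x i * (dl i a p * dl p b e)))"
    by (rule sum.swap)
  also have "\<dots> = R e (Tt f x) b"
    by (simp add: Tf_def dotf_def Rop_apply sum_distrib_left sum_distrib_right mult.assoc)
  finally show "Tt f (R e x) b = R e (Tt f x) b" .
qed

lemma Rop_counit: "(\<Sum>b\<in>UNIV. R b x a * ep b) = x a"
proof -
  have "(\<Sum>b\<in>UNIV. R b x a * ep b) = (\<Sum>b\<in>UNIV. \<Sum>i\<in>UNIV. x i * (dl i a b * ep b))"
    by (simp add: Rop_apply sum_distrib_right mult.assoc)
  also have "\<dots> = (\<Sum>i\<in>UNIV. x i * (\<Sum>b\<in>UNIV. dl i a b * ep b))"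
    unfolding sum_distrib_left by (rule sum.swap)
  also have "\<dots> = x a" by (simp only: counit_r sum_delta_mult)
  finally show ?thesis .
qed

lemma Tf_counit: "(\<Sum>b\<in>UNIV. Tt f x b * ep b) = dotf f x"
proof -
  have "(\<Sum>b\<in>UNIV. Tt f x b * ep b) = (\<Sum>b\<in>UNIV. \<Sum>a\<in>UNIV. f a * (R b x a * ep b))"
    by (simp add: Tf_def dotf_def sum_distrib_right mult.assoc)
  also have "\<dots> = (\<Sum>a\<in>UNIV. f a * (\<Sum>b\<in>UNIV. R b x a * ep b))"
    unfolding sum_distrib_left by (rule sum.swap)
  finally show ?thesis by (simp only: Rop_counit dotf_def)
qed

text \<open>A nonzero subcoalgebra of least dimension inside \<open>C\<close> is simple.\<close>

lemma simple_subcoalgebra_exists: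
  assumes C: "subcoalgebra dl C" "C \<noteq> {0}"
  obtains D where "simple_subcoalgebra dl D" "D \<subseteq> C"
proof -
  let ?P = "\<lambda>D. subcoalgebra dl D \<and> D \<subseteq> C \<and> D \<noteq> {0}"
  obtain D where D: "?P D" and min: "\<And>D'. ?P D' \<Longrightarrow> fv.dim D \<le> fv.dim D'"
    using ex_has_least_nat[of ?P C fv.dim] C by blast
  have "D' = {0} \<or> D' = D" if D': "subcoalgebra dl D'" "D' \<subseteq> D" for D'
  proof (rule disjCI)
    assume "D' \<noteq> D"
    show "D' = {0}"
    proof (rule ccontr)
      assume "D' \<noteq> {0}"
      then have "fv.dim D \<le> fv.dim D'" using D' D by (intro min) auto
      then have "D' = D"
        using D' D by (intro fdv.subspace_dim_equal) (auto simp: subcoalgebra_def subspace_of_eq)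
      then show False using \<open>D' \<noteq> D\<close> by simp
    qed
  qed
  then have "simple_subcoalgebra dl D" using D by (simp add: simple_subcoalgebra_def)
  then show ?thesis using that D by blast
qed

text \<open>Pointedness gives a line k v with \<Delta> v = l v (x) v. The counit axiom forces l
  \<epsilon>(v) = 1, so l v is the group-like element.\<close>

lemma grouplike_in_subcoalgebra:
  assumes C: "subcoalgebra dl C" "C \<noteq> {0}"
  obtains g where "grouplike dl ep g" "g \<in> C"
proof -
  obtain D where D: "simple_subcoalgebra dl D" "D \<subseteq> C" using simple_subcoalgebra_exists[OF C] by blast
  then obtain v where v: "v \<noteq> 0" "D = range (\<lambda>a. vscale a v)" using pointed by (auto simp: pointed_def)
  have vD: "vscale l v \<in> D" for l using v by blast
  have "h_comult dl v \<in> lin_span {tens p q |p q. p \<in> D \<and> q \<in> D}"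
    using D vD[of 1] by (simp add: simple_subcoalgebra_def subcoalgebra_def)
  also have "\<dots> \<subseteq> range (\<lambda>l. vscale l (tens v v))"
    unfolding lin_span_eq
  proof (rule fv.span_minimal)
    show "{tens p q |p q. p \<in> D \<and> q \<in> D} \<subseteq> range (\<lambda>l. vscale l (tens v v))"
    proof
      fix z assume "z \<in> {tens p q |p q. p \<in> D \<and> q \<in> D}"
      then obtain r s where "z = tens (vscale r v) (vscale s v)" using v by blast
      then have "z = vscale (r * s) (tens v v)" by (auto simp: tens_def vscale_def)
      then show "z \<in> range (\<lambda>l. vscale l (tens v v))" by blast
    qed
    show "fv.subspace (range (\<lambda>l. vscale l (tens v v)))"
      unfolding fv.subspace_def
    proof (intro conjI ballI allI)
      show "0 \<in> range (\<lambda>l. vscale l (tens v v))" by (rule range_eqI[of _ _ 0]) simp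
      fix x y k assume x: "x \<in> range (\<lambda>l. vscale l (tens v v))"
      then obtain l where l: "x = vscale l (tens v v)" by blast
      show "vscale k x \<in> range (\<lambda>l. vscale l (tens v v))"
        by (rule range_eqI[of _ _ "k * l"]) (simp add: l)
      assume "y \<in> range (\<lambda>l. vscale l (tens v v))"
      then obtain l' where "y = vscale l' (tens v v)" by blast
      then show "x + y \<in> range (\<lambda>l. vscale l (tens v v))"
        by (intro range_eqI[of _ _ "l + l'"]) (simp add: l fv.scale_left_distrib)
    qed
  qed
  finally obtain l where l: "h_comult dl v = vscale l (tens v v)" by blast
  let ?e = "\<Sum>b\<in>UNIV. v b * ep b"
  obtain a where a: "v a \<noteq> 0" using v by (auto simp: fun_eq_iff)
  have "v a = (\<Sum>b\<in>UNIV. l * v a * (v b * ep b))"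
    using Rop_counit[of v a] by (simp add: Rop_def l vscale_def tens_def mult.assoc)
  also have "\<dots> = v a * (l * ?e)" by (simp add: sum_distrib_left mult_ac)
  finally have le: "l * ?e = 1" using a by simp
  have "h_comult dl (vscale l v) = vscale l (h_comult dl v)"
    by (rule ext) (auto simp: h_comult_def vscale_def sum_distrib_left mult.assoc)
  then have "h_comult dl (vscale l v) = tens (vscale l v) (vscale l v)"
    by (auto simp: l tens_def vscale_def)
  moreover have "(\<Sum>i\<in>UNIV. vscale l v i * ep i) = 1"
    using le by (simp add: vscale_def sum_distrib_left mult.assoc)
  ultimately have "grouplike dl ep (vscale l v)" by (simp add: grouplike_def)
  then show ?thesis using that vD D by blast
qed

text \<open>A basis of \<open>V\<close> is enlarged to one of \<open>W\<close> and then to one of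
  the whole space; \<open>fn w\<close> is the coordinate at \<open>w\<close> in the last. So the
  functionals kill \<open>V\<close> and are still defined everywhere.\<close>

lemma dual_functionals:
  assumes V: "fv.subspace V" and W: "fv.subspace W" and VW: "V \<subseteq> W" "V \<noteq> W"
  obtains D fn where "finite D" "D \<noteq> {}" "D \<subseteq> W" "\<And>w x. w \<in> D \<Longrightarrow> x \<in> V \<Longrightarrow> dotf (fn w) x = 0"
    "\<And>w. w \<in> D \<Longrightarrow> dotf (fn w) w = 1" "\<And>y. y \<in> W \<Longrightarrow> y - (\<Sum>w\<in>D. vscale (dotf (fn w) y) w) \<in> V"
proof -
  obtain BV where BV: "BV \<subseteq> V" "fv.independent BV" "V \<subseteq> fv.span BV"
    using fv.basis_exists[of V] by metis
  have "BV \<subseteq> W" using BV VW by blast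
  then obtain BW where BW: "BV \<subseteq> BW" "BW \<subseteq> W" "fv.independent BW" "W \<subseteq> fv.span BW"
    using fv.maximal_independent_subset_extend[OF _ BV(2)] by metis
  obtain BU where BU: "BW \<subseteq> BU" "fv.independent BU" "UNIV \<subseteq> fv.span BU"
    using fv.maximal_independent_subset_extend[OF subset_UNIV BW(3)] by metis
  have fin: "finite BU" "finite BW" "finite BV"
    using BU(2) BW(3) BV(2) by (auto intro: fdv.finiteI_independent)
  have inU: "x \<in> fv.span BU" for x using BU(3) by blast
  define fn where "fn w = (\<lambda>a. fv.representation BU (h_basis a) w)" for w
  have rep: "dotf (fn w) y = fv.representation BU y w" for w y
  proof -
    have "fv.representation BU y w = fv.representation BU (\<Sum>a\<in>UNIV. vscale (y a) (h_basis a)) w"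
      by (subst vector_expand[of y]) simp
    also have "\<dots> = (\<Sum>a\<in>UNIV. y a * fv.representation BU (h_basis a) w)"
      by (simp add: fv.representation_sum[OF BU(2) inU] fv.representation_scale[OF BU(2) inU])
    finally show ?thesis by (simp add: dotf_def fn_def mult.commute)
  qed
  show ?thesis
  proof (rule that[of "BW - BV" fn])
    show "finite (BW - BV)" "BW - BV \<subseteq> W" using fin BW by auto
    show "BW - BV \<noteq> {}"
    proof
      assume "BW - BV = {}"
      then have "W \<subseteq> fv.span BV" using BW fv.span_mono[of BW BV] by blast
      also have "\<dots> \<subseteq> V" using BV V by (simp add: fv.span_minimal)
      finally show False using VW by blast
    qed
    show "dotf (fn w) x = 0" if w: "w \<in> BW - BV" and x: "x \<in> V" for w x
    proof -
      have "x \<in> fv.span BV" using BV x by blast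
      then have "fv.representation BU x = fv.representation BV x"
        using BU BW by (intro fv.representation_extend) auto
      moreover have "fv.representation BV x w = 0" using w fv.representation_ne_zero[of BV x w] by blast
      ultimately show ?thesis by (simp add: rep)
    qed
    show "dotf (fn w) w = 1" if "w \<in> BW - BV" for w
      using that BU fv.representation_basis[OF BU(2), of w] by (auto simp: rep)
    show "y - (\<Sum>w\<in>BW - BV. vscale (dotf (fn w) y) w) \<in> V" if y: "y \<in> W" for y
    proof -
      have yW: "y \<in> fv.span BW" using BW y by blast
      then have r: "fv.representation BU y = fv.representation BW y"
        using BU by (intro fv.representation_extend) auto
      have "y = (\<Sum>w\<in>BW. vscale (fv.representation BW y w) w)"
        using fv.sum_representation_eq[OF BW(3) yW fin(2) subset_refl] by simp
      also have "\<dots> = (\<Sum>w\<in>BW - BV. vscale (fv.representation BW y w) w) + (\<Sum>w\<in>BV. vscale (fv.representation BW y w) w)"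
        by (rule sum.subset_diff[OF BW(1) fin(2)])
      finally have "y - (\<Sum>w\<in>BW - BV. vscale (dotf (fn w) y) w) = (\<Sum>w\<in>BV. vscale (fv.representation BW y w) w)"
        by (simp add: rep r algebra_simps)
      also have "\<dots> \<in> V"
        using BV V by (intro fv.subspace_sum fv.subspace_scale) auto
      finally show ?thesis .
    qed
  qed
qed

text \<open>The sum of the images of \<open>W\<close> under \<open>Tt f\<close> for \<open>f\<close>
  in the list. A list allows the summands to be removed one at a time.\<close>

primrec Cl where
  "Cl W [] = {0}"
| "Cl W (f # l) = {Tt f x + y | x y. x \<in> W \<and> y \<in> Cl W l}"

lemma Cl_rcoideal:
  assumes "rcoideal dl W"
  shows "rcoideal dl (Cl W l)"
proof (induction l)
  case Nil
  then show ?case by (simp add: rcoideal_def fv.subspace_def Rop_0)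
next
  case (Cons f l)
  have W: "fv.subspace W" "\<And>x b. x \<in> W \<Longrightarrow> R b x \<in> W" and C: "fv.subspace (Cl W l)" "\<And>x b. x \<in> Cl W l \<Longrightarrow> R b x \<in> Cl W l"
    using assms Cons by (auto simp: rcoideal_def)
  show ?case
    unfolding rcoideal_def fv.subspace_def
  proof (intro conjI ballI allI)
    have "0 = Tt f 0 + 0 \<and> 0 \<in> W \<and> 0 \<in> Cl W l" using fv.subspace_0[OF W(1)] fv.subspace_0[OF C(1)] by (simp add: Tf_0)
    then show "0 \<in> Cl W (f # l)" unfolding Cl.simps by blast
    fix x assume "x \<in> Cl W (f # l)"
    then obtain z y where zy: "x = Tt f z + y" "z \<in> W" "y \<in> Cl W l" by auto
    have "R b x = Tt f (R b z) + R b y" for b using zy by (simp add: Rop_add Tf_Rop)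
    then show "R b x \<in> Cl W (f # l)" for b using W(2)[OF zy(2)] C(2)[OF zy(3)] unfolding Cl.simps by blast
    have "vscale k x = Tt f (vscale k z) + vscale k y" for k using zy by (simp add: Tf_scale fv.scale_right_distrib)
    then show "vscale k x \<in> Cl W (f # l)" for k
      using fv.subspace_scale[OF W(1) zy(2)] fv.subspace_scale[OF C(1) zy(3)] unfolding Cl.simps by blast
    fix x' assume "x' \<in> Cl W (f # l)"
    then obtain z' y' where zy': "x' = Tt f z' + y'" "z' \<in> W" "y' \<in> Cl W l" by auto
    have "x + x' = Tt f (z + z') + (y + y')" using zy zy' by (simp add: Tf_add)
    then show "x + x' \<in> Cl W (f # l)"
      using fv.subspace_add[OF W(1) zy(2) zy'(2)] fv.subspace_add[OF C(1) zy(3) zy'(3)] unfolding Cl.simps by blast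
  qed
qed

lemma Cl_append: "x \<in> Cl W l \<Longrightarrow> y \<in> Cl W l' \<Longrightarrow> x + y \<in> Cl W (l @ l')"
proof (induction l arbitrary: x)
  case (Cons f l)
  then obtain z x' where z: "x = Tt f z + x'" "z \<in> W" "x' \<in> Cl W l" by auto
  then have "x + y = Tt f z + (x' + y)" by (simp add: add.assoc)
  then show ?case using Cons.IH[OF z(3) Cons.prems(2)] z(2) unfolding append_Cons Cl.simps by blast
qed simp

text \<open>Every proper right coideal V has a one-step extension by an element x with
  Delta x in x (x) g + V (x) H: in a minimal right coideal W above V, the coefficient coalgebra of W/V
  is a sum of copies of W/V and contains a group-like element.\<close>
lemma rcoideal_extend:
  assumes V: "rcoideal dl V" and ne: "V \<noteq> UNIV"
  obtains x g where "x \<notin> V" "grouplike dl ep g" "\<And>b. R b x - vscale (g b) x \<in> V"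
proof -
  have Vs: "fv.subspace V" and VR: "\<And>x b. x \<in> V \<Longrightarrow> R b x \<in> V" using V by (auto simp: rcoideal_def)
  let ?P = "\<lambda>W. rcoideal dl W \<and> V \<subset> W"
  have "?P UNIV" using ne by (auto simp: rcoideal_def)
  then obtain W where W: "rcoideal dl W" "V \<subset> W" and min: "\<And>U. ?P U \<Longrightarrow> fv.dim W \<le> fv.dim U"
    using ex_has_least_nat[of ?P UNIV fv.dim] by blast
  have Ws: "fv.subspace W" and WR: "\<And>x b. x \<in> W \<Longrightarrow> R b x \<in> W" using W by (auto simp: rcoideal_def)
  \<comment> \<open>Minimality of \<open>W\<close> makes W / V a simple comodule.\<close>
  have between: "U = V" if U: "rcoideal dl U" "V \<subseteq> U" "U \<subseteq> W" "U \<noteq> W" for U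
  proof (rule ccontr)
    assume "U \<noteq> V"
    then have "fv.dim W \<le> fv.dim U" using U by (intro min) auto
    then have "U = W" using U Ws by (intro fdv.subspace_dim_equal) (auto simp: rcoideal_def)
    then show False using U by simp
  qed
  define Vp where "Vp = {f. \<forall>x\<in>V. dotf f x = 0}"
  have Tf_V: "Tt f x = 0" if "f \<in> Vp" "x \<in> V" for f x
    using that VR by (auto simp: Vp_def Tf_def)
  obtain D fn where D: "finite D" "D \<noteq> {}" "D \<subseteq> W" "\<And>w x. w \<in> D \<Longrightarrow> x \<in> V \<Longrightarrow> dotf (fn w) x = 0"
    "\<And>w. w \<in> D \<Longrightarrow> dotf (fn w) w = 1" "\<And>y. y \<in> W \<Longrightarrow> y - (\<Sum>w\<in>D. vscale (dotf (fn w) y) w) \<in> V"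
    by (rule dual_functionals[OF Vs Ws psubset_imp_subset[OF W(2)]]) (use W(2) in blast, rule that)
  have fnV: "fn w \<in> Vp" if "w \<in> D" for w using D(4)[OF that] by (simp add: Vp_def)
  define S where "S = {Tt f x | f x. f \<in> Vp \<and> x \<in> W}"
  define C where "C = fv.span S"
  have SC: "Tt f x \<in> C" if "f \<in> Vp" "x \<in> W" for f x
    unfolding C_def S_def using that by (intro fv.span_base) blast
  have "subcoalgebra dl C"
    unfolding subcoalgebra_def
  proof
    show "subspace_of C" by (simp add: subspace_of_eq C_def)
    let ?Q = "{z. h_comult dl z \<in> lin_span {tens u v |u v. u \<in> C \<and> v \<in> C}}"
    have lin: "h_comult dl (x + y) = h_comult dl x + h_comult dl y" "h_comult dl (vscale k x) = vscale k (h_comult dl x)"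
      "h_comult dl 0 = 0" for x y k
      by (auto simp: h_comult_def vscale_def fun_eq_iff distrib_right sum.distrib sum_distrib_left mult.assoc)
    have "fv.span S \<subseteq> ?Q"
    proof (rule fv.span_minimal)
      show "fv.subspace ?Q"
        unfolding fv.subspace_def lin_span_eq by (auto simp: lin fv.span_zero intro: fv.span_add fv.span_scale)
      show "S \<subseteq> ?Q"
      proof
        fix z assume "z \<in> S"
        then obtain f x where z: "z = Tt f x" "f \<in> Vp" "x \<in> W" unfolding S_def by blast
        \<comment> \<open>Modulo \<open>V\<close>, which \<open>f\<close> does not see,
          \<open>R b x\<close> expands in \<open>D\<close> with coefficients given by the
          functionals \<open>fn w\<close>. This writes \<Delta> z as a sum of tensors with both
          factors in \<open>C\<close>.\<close>
        have "h_comult dl z (a, b) = (\<Sum>w\<in>D. tens (Tt f w) (Tt (fn w) x) (a, b))" for a b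
        proof -
          let ?y = "R b x"
          have yV: "?y - (\<Sum>w\<in>D. vscale (dotf (fn w) ?y) w) \<in> V" by (rule D(6)[OF WR[OF z(3)]])
          have "h_comult dl z (a, b) = Tt f ?y a" unfolding z(1) Tf_Rop by (simp add: Rop_def)
          also have "Tt f ?y = Tt f (\<Sum>w\<in>D. vscale (dotf (fn w) ?y) w)"
            using Tf_V[OF z(2) yV] by (simp add: Tf_diff)
          also have "\<dots> = (\<Sum>w\<in>D. vscale (dotf (fn w) ?y) (Tt f w))"
            by (simp add: Tf_sum Tf_scale)
          finally show ?thesis
            by (simp add: fun_sum_apply vscale_def tens_def Tf_def[of dl "fn w" x for w] mult.commute)
        qed
        then have "h_comult dl z = (\<Sum>w\<in>D. tens (Tt f w) (Tt (fn w) x))"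
          by (auto simp: fun_eq_iff fun_sum_apply)
        moreover have mem: "tens (Tt f w) (Tt (fn w) x) \<in> {tens u v |u v. u \<in> C \<and> v \<in> C}" if "w \<in> D" for w
          using SC[OF z(2), of w] SC[OF fnV[OF that] z(3)] D(3) that by blast
        have "(\<Sum>w\<in>D. tens (Tt f w) (Tt (fn w) x)) \<in> fv.span {tens u v |u v. u \<in> C \<and> v \<in> C}"
          by (intro fv.span_sum fv.span_base mem)
        ultimately show "z \<in> ?Q"
          unfolding lin_span_eq by simp
      qed
    qed
    then show "\<forall>x\<in>C. h_comult dl x \<in> lin_span {tens u v |u v. u \<in> C \<and> v \<in> C}"
      unfolding C_def[symmetric] by blast
  qed
  moreover have "C \<noteq> {0}"
  proof
    assume "C = {0}"
    obtain w where w: "w \<in> D" using D by blast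
    then have "Tt (fn w) w = 0" using SC[OF fnV[OF w], of w] D(3) \<open>C = {0}\<close> by blast
    then have "dotf (fn w) w = 0" using Tf_counit[of "fn w" w] by simp
    then show False using D(5)[OF w] by simp
  qed
  ultimately obtain g where g: "grouplike dl ep g" "g \<in> C" by (rule grouplike_in_subcoalgebra)
  have "C \<subseteq> {z. \<exists>l. set l \<subseteq> Vp \<and> z \<in> Cl W l}"
    unfolding C_def
  proof (rule fv.span_minimal)
    show "S \<subseteq> {z. \<exists>l. set l \<subseteq> Vp \<and> z \<in> Cl W l}"
    proof
      fix z assume "z \<in> S"
      then obtain f x where z: "z = Tt f x" "f \<in> Vp" "x \<in> W" unfolding S_def by blast
      then have "z \<in> Cl W [f]" by auto
      then show "z \<in> {z. \<exists>l. set l \<subseteq> Vp \<and> z \<in> Cl W l}" using z(2)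
        by (intro CollectI exI[of _ "[f]"]) simp
    qed
    show "fv.subspace {z. \<exists>l. set l \<subseteq> Vp \<and> z \<in> Cl W l}"
      unfolding fv.subspace_def
    proof (intro conjI ballI allI)
      show "0 \<in> {z. \<exists>l. set l \<subseteq> Vp \<and> z \<in> Cl W l}" by (intro CollectI exI[of _ "[]"]) simp
      fix x assume "x \<in> {z. \<exists>l. set l \<subseteq> Vp \<and> z \<in> Cl W l}"
      then obtain l where l: "set l \<subseteq> Vp" "x \<in> Cl W l" by blast
      have "vscale k x \<in> Cl W l" for k
        using Cl_rcoideal[OF W(1), of l] l(2) by (simp add: rcoideal_def fv.subspace_scale)
      then show "vscale k x \<in> {z. \<exists>l. set l \<subseteq> Vp \<and> z \<in> Cl W l}" for k using l by blast
      fix y assume "y \<in> {z. \<exists>l. set l \<subseteq> Vp \<and> z \<in> Cl W l}"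
      then obtain l' where l': "set l' \<subseteq> Vp" "y \<in> Cl W l'" by blast
      then have "x + y \<in> Cl W (l @ l')" "set (l @ l') \<subseteq> Vp" using l by (simp_all add: Cl_append)
      then show "x + y \<in> {z. \<exists>l. set l \<subseteq> Vp \<and> z \<in> Cl W l}" by blast
    qed
  qed
  then obtain l where l: "set l \<subseteq> Vp" "g \<in> Cl W l" using g(2) by blast
  then have "\<exists>x. x \<notin> V \<and> (\<forall>b. R b x - vscale (g b) x \<in> V)"
  proof (induction l)
    case Nil
    then show ?case using grouplike_nonzero[OF g(1)] by simp
  next
    case (Cons f l)
    then obtain x y where xy: "g = Tt f x + y" "x \<in> W" "y \<in> Cl W l" by auto
    have f: "f \<in> Vp" using Cons by simp
    have Cr: "rcoideal dl (Cl W l)" by (rule Cl_rcoideal[OF W(1)])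
    then have Cs: "fv.subspace (Cl W l)" and CR: "\<And>x b. x \<in> Cl W l \<Longrightarrow> R b x \<in> Cl W l" by (auto simp: rcoideal_def)
    show ?case
    proof (cases "Tt f x \<in> Cl W l")
      case True
      then have "g \<in> Cl W l" unfolding xy(1) using xy(3) Cs by (intro fv.subspace_add)
      then show ?thesis using Cons by simp
    next
      case False
      let ?U = "{z \<in> W. Tt f z \<in> Cl W l}"
      have "rcoideal dl ?U"
        unfolding rcoideal_def fv.subspace_def
        using Ws Cs WR CR by (auto simp: Tf_0 Tf_add Tf_scale Tf_Rop fv.subspace_0 fv.subspace_add fv.subspace_scale)
      moreover have "V \<subseteq> ?U" using W(2) Tf_V[OF f] fv.subspace_0[OF Cs] by auto
      ultimately have U: "?U = V" using False xy(2) by (intro between) auto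
      have "R b x - vscale (g b) x \<in> V" for b
      proof -
        have "Tt f x = g - y" using xy(1) by simp
        then have "Tt f (R b x - vscale (g b) x) = vscale (g b) y - R b y"
          by (simp add: Tf_diff Tf_scale Tf_Rop Rop_diff Rop_grouplike[OF g(1)] fv.scale_right_diff_distrib)
        also have "\<dots> \<in> Cl W l" using xy(3) Cs CR by (intro fv.subspace_diff fv.subspace_scale)
        finally have "R b x - vscale (g b) x \<in> ?U"
          using Ws WR xy(2) by (auto intro: fv.subspace_diff fv.subspace_scale)
        then show ?thesis using U by simp
      qed
      moreover have "x \<notin> V" using False U xy(2) by blast
      ultimately show ?thesis by blast
    qed
  qed
  then show ?thesis using that g(1) by blast
qed

text \<open>Group-likes are simultaneous eigenvectors of the operators \<open>R b\<close> with
  eigenvalues \<open>g b\<close>, and distinct group-likes have different eigenvalues for some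
  \<open>b\<close>.\<close>

lemma grouplike_span:
  assumes S: "S \<subseteq> Gl" "fv.independent S" and g: "grouplike dl ep g" "g \<in> fv.span S"
  shows "g \<in> S"
proof (rule ccontr)
  assume "g \<notin> S"
  have fin: "finite S" using S(2) by (rule fdv.finiteI_independent)
  let ?c = "fv.representation S g"
  have gs: "g = (\<Sum>s\<in>S. vscale (?c s) s)"
    using fv.sum_representation_eq[OF S(2) g(2) fin subset_refl] by simp
  have "?c s = 0" if s: "s \<in> S" for s
  proof -
    obtain b where b: "s b \<noteq> g b" using s \<open>g \<notin> S\<close> by (metis ext)
    have "R b g = (\<Sum>s\<in>S. vscale (?c s) (R b s))"
      by (subst gs) (simp add: Rop_sum Rop_scale)
    also have "\<dots> = (\<Sum>s\<in>S. vscale (?c s * s b) s)"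
      using S(1) by (intro sum.cong) (auto simp: Rop_grouplike)
    finally have "(\<Sum>s\<in>S. vscale (?c s * s b) s) = vscale (g b) g" by (simp add: Rop_grouplike[OF g(1)])
    also have "vscale (g b) g = (\<Sum>s\<in>S. vscale (g b * ?c s) s)"
      by (subst (2) gs) (simp add: fv.scale_sum_right)
    finally have "(\<Sum>s\<in>S. vscale (?c s * s b - g b * ?c s) s) = 0"
      by (simp add: fv.scale_left_diff_distrib sum_subtractf)
    then have "?c s * s b - g b * ?c s = 0"
      using fv.independentD[OF S(2) fin subset_refl, of "\<lambda>s. ?c s * s b - g b * ?c s"] s by blast
    then have "?c s * (s b - g b) = 0" by (simp add: algebra_simps)
    then show ?thesis using b by simp
  qed
  then have "g = 0" using gs by simp
  then show False using grouplike_nonzero[OF g(1)] by simp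
qed

lemma grouplike_independent: "fv.independent Gl" and grouplike_finite: "finite Gl"
proof -
  obtain S where S: "S \<subseteq> Gl" "fv.independent S" "Gl \<subseteq> fv.span S"
    using fv.maximal_independent_subset[of Gl] by metis
  then have "Gl = S" using grouplike_span[OF S(1,2)] by blast
  then show "fv.independent Gl" "finite Gl" using S(2) fdv.finiteI_independent by auto
qed

end

text \<open>The component of degree \<open>d\<close> under the right coaction of H_ab: x_1
  \<pi>_d(x_2), where \<pi>_d is the coefficient of \<pi> at \<open>d\<close>.\<close>

definition rho :: "('b::finite \<Rightarrow> 'b \<Rightarrow> 'b \<Rightarrow> 'k::field) \<Rightarrow> ('b \<Rightarrow> 'g \<Rightarrow> 'k) \<Rightarrow> 'g \<Rightarrow> ('b \<Rightarrow> 'k) \<Rightarrow> ('b \<Rightarrow> 'k)" where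
  "rho dl pim d x = (\<Sum>b\<in>UNIV. vscale (pim b d) (Rop dl b x))"

definition rdeg :: "('b::finite \<Rightarrow> 'b \<Rightarrow> 'b \<Rightarrow> 'k::field) \<Rightarrow> ('b \<Rightarrow> 'g \<Rightarrow> 'k) \<Rightarrow> 'g \<Rightarrow> ('b \<Rightarrow> 'k) \<Rightarrow> bool" where
  "rdeg dl pim d x \<longleftrightarrow> (\<forall>d'. rho dl pim d' x = (if d' = d then x else 0))"

section \<open>Homogeneous flags\<close>

context pointed_coalgebra
begin

lemma Rop_Rop: "R b (R e x) = (\<Sum>p\<in>UNIV. vscale (dl p b e) (R p x))"
proof
  fix a
  have "R b (R e x) a = (\<Sum>p\<in>UNIV. \<Sum>i\<in>UNIV. x i * (dl i p e * dl p a b))"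
    by (simp add: Rop_apply sum_distrib_right mult.assoc)
  also have "\<dots> = (\<Sum>i\<in>UNIV. x i * (\<Sum>p\<in>UNIV. dl i p e * dl p a b))"
    unfolding sum_distrib_left by (rule sum.swap)
  also have "\<dots> = (\<Sum>i\<in>UNIV. x i * (\<Sum>p\<in>UNIV. dl i a p * dl p b e))"
    by (simp only: coassoc)
  also have "\<dots> = (\<Sum>p\<in>UNIV. \<Sum>i\<in>UNIV. x i * (dl i a p * dl p b e))"
    unfolding sum_distrib_left by (rule sum.swap)
  also have "\<dots> = (\<Sum>p\<in>UNIV. vscale (dl p b e) (R p x)) a"
    by (simp add: fun_sum_apply vscale_def Rop_apply sum_distrib_left mult_ac)
  finally show "R b (R e x) a = (\<Sum>p\<in>UNIV. vscale (dl p b e) (R p x)) a" .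
qed

text \<open>The hypothesis says that \<pi> respects comultiplication, and in a group algebra the
  coefficients at different group elements are orthogonal; so the \<open>rho\<close> are orthogonal
  idempotents.\<close>

lemma rho_rho:
  assumes pc: "\<And>p d d'. (\<Sum>a\<in>UNIV. \<Sum>b\<in>UNIV. dl p a b * pim a d' * pim b d) = (if d' = d then pim p d else 0)"
  shows "rdeg dl pim d (rho dl pim d x)"
  unfolding rdeg_def
proof
  fix d'
  have "rho dl pim d' (rho dl pim d x) = (\<Sum>b\<in>UNIV. \<Sum>e\<in>UNIV. \<Sum>p\<in>UNIV. vscale (dl p b e * pim b d' * pim e d) (R p x))"
    by (simp add: rho_def Rop_sum Rop_scale Rop_Rop fv.scale_sum_right mult_ac)
  also have "\<dots> = (\<Sum>p\<in>UNIV. \<Sum>b\<in>UNIV. \<Sum>e\<in>UNIV. vscale (dl p b e * pim b d' * pim e d) (R p x))"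
    by (rule sum_rotate)
  also have "\<dots> = (\<Sum>p\<in>UNIV. vscale (\<Sum>b\<in>UNIV. \<Sum>e\<in>UNIV. dl p b e * pim b d' * pim e d) (R p x))"
    by (simp add: fv.scale_sum_left)
  also have "\<dots> = (if d' = d then rho dl pim d x else 0)"
    by (simp add: pc rho_def)
  finally show "rho dl pim d' (rho dl pim d x) = (if d' = d then rho dl pim d x else 0)" .
qed

definition flag_step where
  "flag_step pim piG V x g \<longleftrightarrow> grouplike dl ep g \<and> (\<forall>b. R b x - vscale (g b) x \<in> V) \<and> rdeg dl pim (piG g) x"

text \<open>Modulo \<open>V\<close> the coaction on the vector x from \<open>rcoideal_extend\<close>
  is x (x) g, so projecting x to the degree of g changes it only by an element of
  \<open>V\<close>.\<close>

lemma homogeneous_extend: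
  assumes pc: "\<And>p d d'. (\<Sum>a\<in>UNIV. \<Sum>b\<in>UNIV. dl p a b * pim a d' * pim b d) = (if d' = d then pim p d else 0)"
    and pg: "\<And>g d. grouplike dl ep g \<Longrightarrow> (\<Sum>i\<in>UNIV. g i * pim i d) = (if d = piG g then 1 else 0)"
    and V: "rcoideal dl V" "V \<noteq> UNIV"
  obtains x g where "x \<notin> V" "flag_step pim piG V x g"
proof -
  obtain x g where x: "x \<notin> V" and g: "grouplike dl ep g" and Rx: "\<And>b. R b x - vscale (g b) x \<in> V"
    by (rule rcoideal_extend[OF V]) (rule that)
  have Vs: "fv.subspace V" and VR: "\<And>x b. x \<in> V \<Longrightarrow> R b x \<in> V" using V by (auto simp: rcoideal_def)
  let ?y = "rho dl pim (piG g) x"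
  have "?y - x = (\<Sum>b\<in>UNIV. vscale (pim b (piG g)) (R b x - vscale (g b) x))"
  proof -
    have "(\<Sum>b\<in>UNIV. vscale (pim b (piG g)) (R b x - vscale (g b) x)) =
        ?y - vscale (\<Sum>b\<in>UNIV. g b * pim b (piG g)) x"
      by (simp add: rho_def fv.scale_right_diff_distrib sum_subtractf fv.scale_sum_left mult.commute)
    then show ?thesis by (simp add: pg[OF g])
  qed
  also have "\<dots> \<in> V" by (intro fv.subspace_sum[OF Vs] fv.subspace_scale[OF Vs] Rx)
  finally have yx: "?y - x \<in> V" .
  have "?y \<notin> V"
  proof
    assume "?y \<in> V"
    then have "?y - (?y - x) \<in> V" using yx by (rule fv.subspace_diff[OF Vs])
    then show False using x by simp
  qed
  moreover have "R b ?y - vscale (g b) ?y \<in> V" for b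
  proof -
    have "(R b x - vscale (g b) x) + (R b (?y - x) - vscale (g b) (?y - x)) \<in> V"
      by (intro fv.subspace_add[OF Vs] fv.subspace_diff[OF Vs] fv.subspace_scale[OF Vs] Rx VR yx)
    then show ?thesis by (simp add: Rop_diff fv.scale_right_diff_distrib)
  qed
  ultimately show ?thesis
    using g rho_rho[OF pc] by (intro that[of ?y g]) (simp_all add: flag_step_def)
qed

definition good where
  "good pim piG xs \<longleftrightarrow> distinct xs \<and> fv.independent (set xs) \<and>
     (\<forall>j<length xs. \<exists>g. flag_step pim piG (fv.span (set (take j xs))) (xs ! j) g)"

lemma good_rcoideal:
  assumes "good pim piG xs"
  shows "rcoideal dl (fv.span (set xs))"
  unfolding rcoideal_def
proof (intro conjI ballI allI)
  show "fv.subspace (fv.span (set xs))" by simp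
  fix x b assume x: "x \<in> fv.span (set xs)"
  have "fv.span (set xs) \<subseteq> {x. R b x \<in> fv.span (set xs)}"
  proof (rule fv.span_minimal)
    show "fv.subspace {x. R b x \<in> fv.span (set xs)}"
      unfolding fv.subspace_def by (simp add: Rop_0 Rop_add Rop_scale fv.span_zero fv.span_add fv.span_scale)
    show "set xs \<subseteq> {x. R b x \<in> fv.span (set xs)}"
    proof
      fix x assume "x \<in> set xs"
      then obtain j where j: "j < length xs" "x = xs ! j" by (auto simp: in_set_conv_nth)
      then obtain g where "R b x - vscale (g b) x \<in> fv.span (set (take j xs))"
        using assms by (auto simp: good_def flag_step_def)
      then have "R b x - vscale (g b) x \<in> fv.span (set xs)"
        using fv.span_mono[OF set_take_subset] by blast
      moreover have "vscale (g b) x \<in> fv.span (set xs)"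
        using \<open>x \<in> set xs\<close> by (intro fv.span_scale fv.span_base)
      ultimately have "(R b x - vscale (g b) x) + vscale (g b) x \<in> fv.span (set xs)" by (rule fv.span_add)
      then show "x \<in> {x. R b x \<in> fv.span (set xs)}" by simp
    qed
  qed
  then show "R b x \<in> fv.span (set xs)" using x by blast
qed

text \<open>The group-likes, in any order, form the initial list, so all of them enter the basis. A
  longest list containing them spans everything, since a proper span could be extended by a
  homogeneous vector; lengths are bounded by the dimension.\<close>

lemma flag_list:
  assumes pc: "\<And>p d d'. (\<Sum>a\<in>UNIV. \<Sum>b\<in>UNIV. dl p a b * pim a d' * pim b d) = (if d' = d then pim p d else 0)"
    and pg: "\<And>g d. grouplike dl ep g \<Longrightarrow> (\<Sum>i\<in>UNIV. g i * pim i d) = (if d = piG g then 1 else 0)"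
  obtains xs where "good pim piG xs" "Gl \<subseteq> set xs" "fv.span (set xs) = UNIV" "length xs = card (UNIV :: 'b set)"
proof -
  have card: "length xs \<le> card (UNIV :: 'b set)" if "good pim piG xs" for xs
  proof -
    have "length xs = card (set xs)" using that by (simp add: good_def distinct_card)
    also have "\<dots> \<le> card (range (h_basis :: 'b \<Rightarrow> 'b \<Rightarrow> 'k))"
      using that fdv.independent_card_le_dim[of "set xs" UNIV] by (simp add: good_def)
    also have "\<dots> \<le> card (UNIV :: 'b set)" by (rule card_image_le) simp
    finally show ?thesis .
  qed
  obtain gs where gs: "set gs = Gl" "distinct gs" using finite_distinct_list[OF grouplike_finite] by blast
  let ?P = "\<lambda>xs. good pim piG xs \<and> Gl \<subseteq> set xs"
  have "flag_step pim piG V g g" if "grouplike dl ep g" "fv.subspace V" for g V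
  proof -
    have "rho dl pim d g = vscale (\<Sum>b\<in>UNIV. g b * pim b d) g" for d
      by (simp add: rho_def Rop_grouplike[OF that(1)] fv.scale_sum_left mult.commute)
    then show ?thesis
      using that fv.subspace_0[OF that(2)] by (auto simp: flag_step_def rdeg_def Rop_grouplike pg)
  qed
  then have "good pim piG gs"
    using gs grouplike_independent by (auto simp: good_def) (metis fv.subspace_span mem_Collect_eq nth_mem)
  then have "?P gs" using gs by simp
  moreover have "\<forall>xs. ?P xs \<longrightarrow> length xs < Suc (card (UNIV :: 'b set))" using card by (auto simp: less_Suc_eq_le)
  ultimately obtain xs where xs: "?P xs" and max: "\<And>ys. ?P ys \<Longrightarrow> length ys \<le> length xs"
    using ex_has_greatest_nat[of ?P gs length "Suc (card (UNIV :: 'b set))"] by blast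
  have span: "fv.span (set xs) = UNIV"
  proof (rule ccontr)
    assume "fv.span (set xs) \<noteq> UNIV"
    then obtain x g where x: "x \<notin> fv.span (set xs)" "flag_step pim piG (fv.span (set xs)) x g"
      using homogeneous_extend[OF pc pg good_rcoideal] xs by blast
    have "x \<notin> set xs" using x fv.span_base by blast
    moreover have "fv.independent (set (xs @ [x]))"
      using xs x by (simp add: good_def fv.independent_insert)
    moreover have "\<exists>g. flag_step pim piG (fv.span (set (take j (xs @ [x])))) ((xs @ [x]) ! j) g" if "j < length (xs @ [x])" for j
    proof (cases "j = length xs")
      case True
      then show ?thesis using x by auto
    next
      case False
      then have "j < length xs" using that by simp
      then show ?thesis using xs by (simp add: good_def nth_append)
    qed
    ultimately have "?P (xs @ [x])" using xs by (auto simp: good_def)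
    from max[OF this] show False by simp
  qed
  have "length xs = card (set xs)" using xs by (simp add: good_def distinct_card)
  also have "\<dots> = fv.dim (UNIV :: ('b \<Rightarrow> 'k) set)"
    using xs span fv.dim_eq_card[of "set xs" UNIV] by (simp add: good_def del: fdv.dim_UNIV)
  also have "\<dots> = card (range (h_basis :: 'b \<Rightarrow> 'b \<Rightarrow> 'k))"
    by simp
  also have "\<dots> = card (UNIV :: 'b set)" by (rule card_image) (auto simp: inj_def h_basis_inj)
  finally show ?thesis using that xs span by blast
qed

end

text \<open>The list is matched with the indices in reverse: the position of an index is the number
  of larger ones. Earlier vectors of the flag thus get larger indices, that is, smaller
  variables.\<close>

lemma flag_basis:
  fixes dl :: "'b::{finite,linorder} \<Rightarrow> 'b \<Rightarrow> 'b \<Rightarrow> 'k::field" and pim :: "'b \<Rightarrow> 'g \<Rightarrow> 'k"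
  assumes "pointed_coalgebra dl ep"
    and pc: "\<And>p d d'. (\<Sum>a\<in>UNIV. \<Sum>b\<in>UNIV. dl p a b * pim a d' * pim b d) = (if d' = d then pim p d else 0)"
    and pg: "\<And>g d. grouplike dl ep g \<Longrightarrow> (\<Sum>i\<in>UNIV. g i * pim i d) = (if d = piG g then 1 else 0)"
  obtains e :: "'b \<Rightarrow> 'b \<Rightarrow> 'k" and gl where "inj e" "fv.independent (range e)" "fv.span (range e) = UNIV"
    "\<And>g. grouplike dl ep g \<Longrightarrow> g \<in> range e" "\<And>i. grouplike dl ep (gl i)"
    "\<And>i b. Rop dl b (e i) - vscale (gl i b) (e i) \<in> fv.span (e ` {a. i < a})"
    "\<And>i. rdeg dl pim (piG (gl i)) (e i)"
proof -
  interpret pointed_coalgebra dl ep by fact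
  obtain xs where xs: "good pim piG xs" "Gl \<subseteq> set xs" "fv.span (set xs) = UNIV" "length xs = card (UNIV :: 'b set)"
    by (rule flag_list[where pim = pim and piG = piG]) (use pc pg in auto)
  define rank where "rank i = card {a. i < a}" for i :: 'b
  have rank_less: "rank a < rank i" if "i < a" for i a
    unfolding rank_def using that by (intro psubset_card_mono) auto
  have rank_lt: "rank i < length xs" for i
    unfolding rank_def xs(4) by (intro psubset_card_mono) auto
  have rank_inj: "inj rank"
    by (rule injI) (metis less_irrefl linorder_neqE rank_less)
  have rank_range: "range rank = {..<length xs}"
  proof (rule card_subset_eq)
    show "range rank \<subseteq> {..<length xs}" using rank_lt by auto
    show "card (range rank) = card {..<length xs}" using rank_inj by (simp add: card_image xs(4))
  qed simp
  define e where "e i = xs ! rank i" for i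
  have e_inj: "inj e"
    using xs(1) rank_inj rank_lt by (auto simp: e_def good_def inj_def nth_eq_iff_index_eq)
  have e_range: "range e = set xs"
  proof -
    have "range e = (!) xs ` range rank" by (auto simp: e_def)
    then show ?thesis by (auto simp: rank_range set_conv_nth)
  qed
  have take: "set (take (rank i) xs) \<subseteq> e ` {a. i < a}" for i
  proof
    fix x assume "x \<in> set (take (rank i) xs)"
    then obtain j where j: "j < rank i" "j < length xs" "x = xs ! j" by (auto simp: in_set_conv_nth)
    then obtain a where a: "rank a = j" using rank_range by (metis lessThan_iff rangeE)
    then have "i < a" using j rank_less by (metis less_irrefl linorder_neqE order.strict_trans)
    then show "x \<in> e ` {a. i < a}" using a j by (auto simp: e_def)
  qed
  have "\<exists>g. flag_step pim piG (fv.span (set (take (rank i) xs))) (e i) g" for i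
    using xs(1) rank_lt by (simp add: good_def e_def)
  then obtain gl where gl: "\<And>i. flag_step pim piG (fv.span (set (take (rank i) xs))) (e i) (gl i)" by metis
  show ?thesis
  proof (rule that[of e gl])
    show "inj e" by fact
    show "fv.independent (range e)" using xs(1) by (simp add: e_range good_def)
    show "fv.span (range e) = UNIV" using xs(3) by (simp add: e_range)
    show "g \<in> range e" if "grouplike dl ep g" for g using that xs(2) by (auto simp: e_range)
    show "grouplike dl ep (gl i)" for i using gl by (simp add: flag_step_def)
    show "Rop dl b (e i) - vscale (gl i b) (e i) \<in> fv.span (e ` {a. i < a})" for i b
      using gl[of i] fv.span_mono[OF take[of i]] by (auto simp: flag_step_def)
    show "rdeg dl pim (piG (gl i)) (e i)" for i using gl by (simp add: flag_step_def)
  qed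
qed

section \<open>Change of basis\<close>

text \<open>Convolution is independent of the basis: \<open>E i\<close> are the new basis vectors in
  old coordinates, and \<open>bas\<close> compares the two expressions of their comultiplication.
  The general index types admit both H and its tensor square.\<close>

lemma conv_transport:
  fixes C :: "'i::finite \<Rightarrow> 'i \<Rightarrow> 'i \<Rightarrow> 'k::field" and D :: "'j::finite \<Rightarrow> 'j \<Rightarrow> 'j \<Rightarrow> 'k" and E :: "'i \<Rightarrow> 'j \<Rightarrow> 'k"
    and h :: "'k \<Rightarrow> 'r::field"
  assumes h: "is_ring_hom h"
    and bas: "\<And>i x y. (\<Sum>s\<in>UNIV. E i s * D s x y) = (\<Sum>a\<in>UNIV. \<Sum>b\<in>UNIV. C i a b * E a x * E b y)"
  shows "conv h C (\<lambda>i. conv_dual h f (E i)) (\<lambda>i. conv_dual h g (E i)) = (\<lambda>i. conv_dual h (conv h D f g) (E i))"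
proof
  fix i
  have "conv h C (\<lambda>i. conv_dual h f (E i)) (\<lambda>i. conv_dual h g (E i)) i =
      (\<Sum>a\<in>UNIV. \<Sum>b\<in>UNIV. h (C i a b) * ((\<Sum>x\<in>UNIV. h (E a x) * f x) * (\<Sum>y\<in>UNIV. h (E b y) * g y)))"
    by (simp add: conv_def conv_dual_def mult.assoc)
  also have "\<dots> = (\<Sum>a\<in>UNIV. \<Sum>b\<in>UNIV. \<Sum>x\<in>UNIV. \<Sum>y\<in>UNIV. h (C i a b * E a x * E b y) * (f x * g y))"
    unfolding sum_product unfolding sum_distrib_left ring_hom_mult[OF h]
    by (intro sum.cong refl) (simp only: mult_ac)
  also have "\<dots> = (\<Sum>x\<in>UNIV. \<Sum>y\<in>UNIV. \<Sum>a\<in>UNIV. \<Sum>b\<in>UNIV. h (C i a b * E a x * E b y) * (f x * g y))"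
    unfolding sum.cartesian_product
    by (rule sum.reindex_bij_witness[where i = "\<lambda>(x,y,a,b). (a,b,x,y)" and j = "\<lambda>(a,b,x,y). (x,y,a,b)"]) auto
  also have "\<dots> = (\<Sum>x\<in>UNIV. \<Sum>y\<in>UNIV. h (\<Sum>s\<in>UNIV. E i s * D s x y) * (f x * g y))"
    unfolding bas ring_hom_sum[OF h] sum_distrib_right ..
  also have "\<dots> = (\<Sum>x\<in>UNIV. \<Sum>y\<in>UNIV. \<Sum>s\<in>UNIV. h (E i s) * (h (D s x y) * f x * g y))"
    unfolding ring_hom_sum[OF h] sum_distrib_right ring_hom_mult[OF h] by (intro sum.cong refl) (simp only: mult_ac)
  also have "\<dots> = (\<Sum>s\<in>UNIV. \<Sum>x\<in>UNIV. \<Sum>y\<in>UNIV. h (E i s) * (h (D s x y) * f x * g y))"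
    by (rule sum_rotate)
  also have "\<dots> = conv_dual h (conv h D f g) (E i)"
    unfolding conv_dual_def conv_def sum_distrib_left ..
  finally show "conv h C (\<lambda>i. conv_dual h f (E i)) (\<lambda>i. conv_dual h g (E i)) i = conv_dual h (conv h D f g) (E i)" .
qed

lemma single_sum: "Poly_Mapping.single k (sum g A) = (\<Sum>a\<in>A. Poly_Mapping.single k (g a))"
  by (induction A rule: infinite_finite_induct) (simp_all add: single_add)

lemma gen_subalg_image:
  assumes hom: "is_ring_hom F" and const: "\<And>a. F (pconst a) = pconst a"
  shows "F ` gen_subalg S = gen_subalg (F ` S)"
proof
  have "F x \<in> gen_subalg (F ` S)" if "x \<in> gen_subalg S" for x
    using that by (induction rule: gen_subalg.induct)
      (auto simp: const ring_hom_add[OF hom] ring_hom_mult[OF hom] intro: gen_subalg.intros)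
  then show "F ` gen_subalg S \<subseteq> gen_subalg (F ` S)" by blast
  show "gen_subalg (F ` S) \<subseteq> F ` gen_subalg S"
  proof
    fix x assume "x \<in> gen_subalg (F ` S)"
    then show "x \<in> F ` gen_subalg S"
    proof (induction rule: gen_subalg.induct)
      case (const a)
      show ?case by (rule image_eqI[of _ _ "pconst a"]) (simp_all add: assms(2) gen_subalg.const)
    next
      case (gen s)
      then show ?case by (auto intro: gen_subalg.gen)
    next
      case (add u v)
      then obtain a b where "u = F a" "v = F b" "a \<in> gen_subalg S" "b \<in> gen_subalg S" by blast
      then show ?case by (intro image_eqI[of _ _ "a + b"]) (simp_all add: ring_hom_add[OF hom] gen_subalg.add)
    next
      case (mul u v)
      then obtain a b where "u = F a" "v = F b" "a \<in> gen_subalg S" "b \<in> gen_subalg S" by blast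
      then show ?case by (intro image_eqI[of _ _ "a * b"]) (simp_all add: ring_hom_mult[OF hom] gen_subalg.mul)
    qed
  qed
qed

lemma k_alg_iso_image:
  fixes F :: "('v::linorder, 'k::field) mpoly fract \<Rightarrow> ('v, 'k) mpoly fract"
  assumes iso: "k_alg_iso A L phi" and hom: "is_ring_hom F" and const: "\<And>a. F (pconst a) = pconst a"
  shows "k_alg_iso (F ` A) L (\<lambda>x. phi (inv_into UNIV F x))"
proof -
  have "inj F"
  proof (rule injI)
    fix x y assume "F x = F y"
    then have "F (x - y) = 0" by (simp add: ring_hom_diff[OF hom])
    then show "x = y" by (simp add: field_hom_eq_0_iff[OF hom])
  qed
  then have inv: "inv_into UNIV F (F x) = x" for x by simp
  have "bij_betw (\<lambda>x. phi (inv_into UNIV F x)) (F ` A) L"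
  proof -
    have "bij_betw (inv_into UNIV F) (F ` A) A"
      by (rule bij_betw_byWitness[where f' = F]) (auto simp: inv)
    moreover have "bij_betw phi A L" using iso by (simp add: k_alg_iso_def)
    ultimately show ?thesis using bij_betw_trans by (fastforce simp: o_def)
  qed
  moreover have "inv_into UNIV F 1 = 1" using inv[of 1] by (simp add: ring_hom_1[OF hom])
  moreover have "inv_into UNIV F (F x + F y) = x + y" "inv_into UNIV F (F x * F y) = x * y"
    "inv_into UNIV F (pconst a * F x) = pconst a * x" for x y a
    using inv[of "x + y"] inv[of "x * y"] inv[of "pconst a * x"]
    by (simp_all add: ring_hom_add[OF hom] ring_hom_mult[OF hom] const)
  ultimately show ?thesis
    using iso by (auto simp: k_alg_iso_def inv)
qed

text \<open>The base algebra is defined by the given constants, whereas triangularity holds in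
  another basis. The rows \<open>e i\<close> are that basis in given coordinates and
  \<open>f\<close> is the inverse matrix.\<close>

locale basis_change = coalg_consts dl ep
  for dl :: "'b::{finite,linorder} \<Rightarrow> 'b \<Rightarrow> 'b \<Rightarrow> 'k::field" and ep :: "'b \<Rightarrow> 'k" +
  fixes mu :: "'b \<Rightarrow> 'b \<Rightarrow> 'b \<Rightarrow> 'k" and e f :: "'b \<Rightarrow> 'b \<Rightarrow> 'k"
  assumes bialg: "(\<Sum>p\<in>UNIV. mu i j p * dl p a b) =
        (\<Sum>a1\<in>UNIV. \<Sum>b1\<in>UNIV. \<Sum>a2\<in>UNIV. \<Sum>b2\<in>UNIV. dl i a1 b1 * dl j a2 b2 * mu a1 a2 a * mu b1 b2 b)"
    and ep_mult: "(\<Sum>p\<in>UNIV. mu i j p * ep p) = ep i * ep j"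
    and ef: "(\<Sum>x\<in>UNIV. e i x * f x j) = (if i = j then 1 else 0)"
    and fe: "(\<Sum>i\<in>UNIV. f x i * e i y) = (if x = y then 1 else 0)"
begin

text \<open>Structure constants with respect to the basis \<open>e\<close>; likewise
  \<open>m'\<close> and \<open>ep'\<close>.\<close>

definition C where "C i a b = (\<Sum>y\<in>UNIV. \<Sum>z\<in>UNIV. h_comult dl (e i) (y, z) * (f y a * f z b))"
definition m' where "m' i j l = (\<Sum>z\<in>UNIV. h_mult mu (e i) (e j) z * f z l)"
definition ep' where "ep' i = (\<Sum>x\<in>UNIV. e i x * ep x)"

lemma C_expand: "(\<Sum>a\<in>UNIV. \<Sum>b\<in>UNIV. C i a b * e a x * e b y) = h_comult dl (e i) (x, y)"
proof -
  have "(\<Sum>a\<in>UNIV. \<Sum>b\<in>UNIV. C i a b * e a x * e b y) =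
     (\<Sum>a\<in>UNIV. \<Sum>b\<in>UNIV. \<Sum>s\<in>UNIV. \<Sum>t\<in>UNIV. h_comult dl (e i) (s, t) * ((f s a * e a x) * (f t b * e b y)))"
    unfolding C_def sum_distrib_right by (intro sum.cong refl) (simp only: mult_ac)
  also have "\<dots> = (\<Sum>s\<in>UNIV. \<Sum>t\<in>UNIV. \<Sum>a\<in>UNIV. \<Sum>b\<in>UNIV. h_comult dl (e i) (s, t) * ((f s a * e a x) * (f t b * e b y)))"
    unfolding sum.cartesian_product
    by (rule sum.reindex_bij_witness[where i = "\<lambda>(x,y,a,b). (a,b,x,y)" and j = "\<lambda>(a,b,x,y). (x,y,a,b)"]) auto
  also have "\<dots> = (\<Sum>s\<in>UNIV. \<Sum>t\<in>UNIV. h_comult dl (e i) (s, t) * ((\<Sum>a\<in>UNIV. f s a * e a x) * (\<Sum>b\<in>UNIV. f t b * e b y)))"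
    unfolding sum_product unfolding sum_distrib_left ..
  also have "\<dots> = (\<Sum>s\<in>UNIV. \<Sum>t\<in>UNIV. (h_comult dl (e i) (s, t) * (if s = x then 1 else 0)) * (if t = y then 1 else 0))"
    by (simp only: fe mult.assoc)
  also have "\<dots> = h_comult dl (e i) (x, y)"
    by (simp only: sum_delta_mult)
  finally show ?thesis .
qed

lemma m'_expand: "(\<Sum>l\<in>UNIV. m' i j l * e l z) = h_mult mu (e i) (e j) z"
proof -
  have "(\<Sum>l\<in>UNIV. m' i j l * e l z) = (\<Sum>l\<in>UNIV. \<Sum>y\<in>UNIV. h_mult mu (e i) (e j) y * (f y l * e l z))"
    by (simp add: m'_def sum_distrib_right mult.assoc)
  also have "\<dots> = (\<Sum>y\<in>UNIV. h_mult mu (e i) (e j) y * (\<Sum>l\<in>UNIV. f y l * e l z))"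
    unfolding sum_distrib_left by (rule sum.swap)
  also have "\<dots> = h_mult mu (e i) (e j) z" by (simp only: fe sum_delta_mult)
  finally show ?thesis .
qed

lemma bas: "(\<Sum>s\<in>UNIV. e i s * dl s x y) = (\<Sum>a\<in>UNIV. \<Sum>b\<in>UNIV. C i a b * e a x * e b y)"
  unfolding C_expand by (simp add: h_comult_def)

lemma bas2: "(\<Sum>s\<in>UNIV. tens (e (fst p)) (e (snd p)) s * pair_c dl s x y) =
   (\<Sum>a\<in>UNIV. \<Sum>b\<in>UNIV. pair_c C p a b * tens (e (fst a)) (e (snd a)) x * tens (e (fst b)) (e (snd b)) y)"
proof -
  obtain i j where p: "p = (i, j)" by (cases p)
  obtain x1 x2 y1 y2 where xy: "x = (x1, x2)" "y = (y1, y2)" by (cases x; cases y)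
  have "(\<Sum>s\<in>UNIV. tens (e (fst p)) (e (snd p)) s * pair_c dl s x y) =
      (\<Sum>s\<in>UNIV. e i s * dl s x1 y1) * (\<Sum>s\<in>UNIV. e j s * dl s x2 y2)"
    by (simp add: p xy sum_UNIV_pair tens_def pair_c_def sum_product mult_ac)
  also have "\<dots> = (\<Sum>a\<in>UNIV. \<Sum>b\<in>UNIV. C i a b * e a x1 * e b y1) * (\<Sum>a\<in>UNIV. \<Sum>b\<in>UNIV. C j a b * e a x2 * e b y2)"
    by (simp only: bas)
  also have "\<dots> = (\<Sum>a1\<in>UNIV. \<Sum>a2\<in>UNIV. \<Sum>b1\<in>UNIV. \<Sum>b2\<in>UNIV. (C i a1 b1 * e a1 x1 * e b1 y1) * (C j a2 b2 * e a2 x2 * e b2 y2))"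
    by (simp only: sum_product)
  also have "\<dots> = (\<Sum>a\<in>UNIV. \<Sum>b\<in>UNIV. pair_c C p a b * tens (e (fst a)) (e (snd a)) x * tens (e (fst b)) (e (snd b)) y)"
    by (simp add: p xy sum_UNIV_pair tens_def pair_c_def mult_ac)
  finally show ?thesis .
qed

text \<open>Turns values on the given basis into values on the new one; \<open>push\<close> goes
  back.\<close>

definition pull where "pull h g = (\<lambda>i. conv_dual h g (e i))"
definition pull2 where "pull2 h g = (\<lambda>p. conv_dual h g (tens (e (fst p)) (e (snd p))))"

lemma conv_pull: "is_ring_hom h \<Longrightarrow> conv h C (pull h g) (pull h g') = pull h (conv h dl g g')"
  unfolding pull_def by (rule conv_transport[OF _ bas])

lemma conv_pull2: "is_ring_hom h \<Longrightarrow> conv h (pair_c C) (pull2 h g) (pull2 h g') = pull2 h (conv h (pair_c dl) g g')"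
  unfolding pull2_def by (rule conv_transport[OF _ bas2])

lemma pull2_apply: "is_ring_hom h \<Longrightarrow> pull2 h g (i, j) = (\<Sum>x\<in>UNIV. \<Sum>y\<in>UNIV. h (e i x) * h (e j y) * g (x, y))"
  by (simp add: pull2_def conv_dual_def sum_UNIV_pair tens_def ring_hom_mult)

lemma mulf_pull:
  assumes h: "is_ring_hom h"
  shows "mulf h m' (pull h g) = pull2 h (mulf h mu g)"
proof
  fix p :: "'b \<times> 'b"
  obtain i j where p: "p = (i, j)" by (cases p)
  have "mulf h m' (pull h g) p = (\<Sum>l\<in>UNIV. \<Sum>x\<in>UNIV. h (m' i j l * e l x) * g x)"
    by (simp add: mulf_def p pull_def conv_dual_def sum_distrib_left ring_hom_mult[OF h] mult.assoc)
  also have "\<dots> = (\<Sum>x\<in>UNIV. \<Sum>l\<in>UNIV. h (m' i j l * e l x) * g x)" by (rule sum.swap)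
  also have "\<dots> = conv_dual h g (h_mult mu (e i) (e j))"
    unfolding conv_dual_def m'_expand[symmetric] ring_hom_sum[OF h] sum_distrib_right ..
  also have "\<dots> = pull2 h (mulf h mu g) p"
    by (simp only: conv_dual_h_mult[OF h] p pull2_apply[OF h])
  finally show "mulf h m' (pull h g) p = pull2 h (mulf h mu g) p" .
qed

lemma tensf_pull:
  assumes h: "is_ring_hom h"
  shows "tensf (pull h g) (pull h g') = pull2 h (tensf g g')"
proof
  fix p :: "'b \<times> 'b"
  obtain i j where p: "p = (i, j)" by (cases p)
  have "tensf (pull h g) (pull h g') p = (\<Sum>x\<in>UNIV. \<Sum>y\<in>UNIV. (h (e i x) * g x) * (h (e j y) * g' y))"
    by (simp add: tensf_def p pull_def conv_dual_def sum_product)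
  also have "\<dots> = pull2 h (tensf g g') p"
    unfolding p pull2_apply[OF h] tensf_def prod.case by (intro sum.cong refl) (simp only: mult_ac)
  finally show "tensf (pull h g) (pull h g') p = pull2 h (tensf g g') p" .
qed

definition push where "push h g = (\<lambda>x. \<Sum>j\<in>UNIV. h (f x j) * g j)"

lemma pull_push:
  assumes h: "is_ring_hom h"
  shows "pull h (push h g) = g"
proof
  fix i
  have "pull h (push h g) i = (\<Sum>x\<in>UNIV. \<Sum>j\<in>UNIV. h (e i x * f x j) * g j)"
    by (simp add: pull_def push_def conv_dual_def sum_distrib_left ring_hom_mult[OF h] mult.assoc)
  also have "\<dots> = (\<Sum>j\<in>UNIV. h (\<Sum>x\<in>UNIV. e i x * f x j) * g j)"
    unfolding ring_hom_sum[OF h] sum_distrib_right by (rule sum.swap)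
  also have "\<dots> = (\<Sum>j\<in>UNIV. (if i = j then 1 else 0) * g j)"
    by (intro sum.cong refl) (simp add: ef ring_hom_0[OF h] ring_hom_1[OF h])
  also have "\<dots> = g i" by (simp only: sum_delta_mult)
  finally show "pull h (push h g) i = g i" .
qed

lemma push_pull:
  assumes h: "is_ring_hom h"
  shows "push h (pull h g) = g"
proof
  fix x
  have "push h (pull h g) x = (\<Sum>i\<in>UNIV. \<Sum>y\<in>UNIV. h (f x i * e i y) * g y)"
    by (simp add: pull_def push_def conv_dual_def sum_distrib_left ring_hom_mult[OF h] mult.assoc)
  also have "\<dots> = (\<Sum>y\<in>UNIV. h (\<Sum>i\<in>UNIV. f x i * e i y) * g y)"
    unfolding ring_hom_sum[OF h] sum_distrib_right by (rule sum.swap)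
  also have "\<dots> = (\<Sum>y\<in>UNIV. (if x = y then 1 else 0) * g y)"
    by (intro sum.cong refl) (simp add: fe ring_hom_0[OF h] ring_hom_1[OF h])
  also have "\<dots> = g x" by (simp only: sum_delta_mult)
  finally show "push h (pull h g) x = g x" .
qed

lemma pull_ep: "is_ring_hom h \<Longrightarrow> pull h (\<lambda>i. h (ep i)) = (\<lambda>i. h (ep' i))"
  by (auto simp: pull_def conv_dual_def ep'_def ring_hom_sum ring_hom_mult)

abbreviation "dlt a \<equiv> (\<lambda>i. if i = a then 1 else (0::'k))"

lemma conv_dlt: "conv (\<lambda>x. x) C g (dlt z) i = (\<Sum>p\<in>UNIV. C i p z * g p)"
    "conv (\<lambda>x. x) C (dlt a) g i = (\<Sum>p\<in>UNIV. C i a p * g p)"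
proof -
  show "conv (\<lambda>x. x) C g (dlt z) i = (\<Sum>p\<in>UNIV. C i p z * g p)"
    by (simp only: conv_def sum_delta_mult)
  have "conv (\<lambda>x. x) C (dlt a) g i = (\<Sum>b\<in>UNIV. \<Sum>p\<in>UNIV. (C i p b * g b) * dlt a p)"
    unfolding conv_def by (subst sum.swap) (intro sum.cong refl, simp only: mult_ac)
  then show "conv (\<lambda>x. x) C (dlt a) g i = (\<Sum>p\<in>UNIV. C i a p * g p)"
    by (simp only: sum_delta_mult)
qed

text \<open>Through \<open>pull\<close> the new convolution product is the old one in other
  coordinates. Its associativity and unit laws, evaluated at coordinate functionals, are exactly the
  axioms for the new constants.\<close>

lemma new_coalg: "coalg_consts C ep'"
proof
  note h = id_ring_hom
  let ?cv = "conv (\<lambda>x. x) C"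
  have assoc: "?cv (?cv g1 g2) g3 = ?cv g1 (?cv g2 g3)" for g1 g2 g3
  proof -
    have "?cv (?cv (pull (\<lambda>x. x) k1) (pull (\<lambda>x. x) k2)) (pull (\<lambda>x. x) k3) =
      ?cv (pull (\<lambda>x. x) k1) (?cv (pull (\<lambda>x. x) k2) (pull (\<lambda>x. x) k3))" for k1 k2 k3
      by (simp only: conv_pull[OF h] conv_assoc[OF h])
    from this[of "push (\<lambda>x. x) g1" "push (\<lambda>x. x) g2" "push (\<lambda>x. x) g3"] show ?thesis by (simp only: pull_push[OF h])
  qed
  have l: "?cv ep' g = g" and r: "?cv g ep' = g" for g
  proof -
    have "?cv (pull (\<lambda>x. x) ep) (pull (\<lambda>x. x) (push (\<lambda>x. x) g)) = pull (\<lambda>x. x) (push (\<lambda>x. x) g)"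
      "?cv (pull (\<lambda>x. x) (push (\<lambda>x. x) g)) (pull (\<lambda>x. x) ep) = pull (\<lambda>x. x) (push (\<lambda>x. x) g)"
      by (simp_all only: conv_pull[OF h] conv_unit_l[OF h] conv_unit_r[OF h])
    then show "?cv ep' g = g" "?cv g ep' = g" by (simp_all only: pull_push[OF h] pull_ep[OF h])
  qed
  fix i z a b l
  show "(\<Sum>p\<in>UNIV. C i p z * C p a b) = (\<Sum>p\<in>UNIV. C i a p * C p b z)"
    using fun_cong[OF assoc[of "dlt a" "dlt b" "dlt z"], of i] by (simp only: conv_dlt sum_delta_mult)
  show "(\<Sum>p\<in>UNIV. ep' p * C i p l) = (if i = l then 1 else 0)"
    using fun_cong[OF l[of "dlt l"], of i] by (simp only: conv_dlt mult.commute)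
  show "(\<Sum>p\<in>UNIV. C i l p * ep' p) = (if i = l then 1 else 0)"
    using fun_cong[OF r[of "dlt l"], of i] by (simp only: conv_dlt)
qed

lemma new_bialg: "(\<Sum>p\<in>UNIV. m' i j p * C p a b) =
        (\<Sum>a1\<in>UNIV. \<Sum>b1\<in>UNIV. \<Sum>a2\<in>UNIV. \<Sum>b2\<in>UNIV. C i a1 b1 * C j a2 b2 * m' a1 a2 a * m' b1 b2 b)"
proof -
  note h = id_ring_hom
  have eq: "mulf (\<lambda>x. x) m' (conv (\<lambda>x. x) C g1 g2) = conv (\<lambda>x. x) (pair_c C) (mulf (\<lambda>x. x) m' g1) (mulf (\<lambda>x. x) m' g2)" for g1 g2
  proof -
    have "mulf (\<lambda>x. x) m' (conv (\<lambda>x. x) C (pull (\<lambda>x. x) k1) (pull (\<lambda>x. x) k2)) =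
      conv (\<lambda>x. x) (pair_c C) (mulf (\<lambda>x. x) m' (pull (\<lambda>x. x) k1)) (mulf (\<lambda>x. x) m' (pull (\<lambda>x. x) k2))" for k1 k2
      by (simp only: conv_pull[OF h] mulf_pull[OF h] conv_mulf[OF h bialg] conv_pull2[OF h])
    from this[of "push (\<lambda>x. x) g1" "push (\<lambda>x. x) g2"] show ?thesis by (simp only: pull_push[OF h])
  qed
  have md: "mulf (\<lambda>x. x) m' (dlt a) (i, j) = m' i j a" for a i j
    by (simp only: mulf_def prod.case sum_delta_mult)
  have "(\<Sum>p\<in>UNIV. m' i j p * C p a b) = mulf (\<lambda>x. x) m' (conv (\<lambda>x. x) C (dlt a) (dlt b)) (i, j)"
    by (simp only: mulf_def prod.case conv_dlt sum_delta_mult)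
  also have "\<dots> = (\<Sum>a1\<in>UNIV. \<Sum>a2\<in>UNIV. \<Sum>b1\<in>UNIV. \<Sum>b2\<in>UNIV. C i a1 b1 * C j a2 b2 * m' a1 a2 a * m' b1 b2 b)"
    by (simp only: eq conv_def sum_UNIV_pair pair_c_def prod.case md)
  also have "\<dots> = (\<Sum>a1\<in>UNIV. \<Sum>b1\<in>UNIV. \<Sum>a2\<in>UNIV. \<Sum>b2\<in>UNIV. C i a1 b1 * C j a2 b2 * m' a1 a2 a * m' b1 b2 b)"
    by (rule sum.cong[OF refl], rule sum.swap)
  finally show ?thesis .
qed

lemma new_ep_mult: "(\<Sum>p\<in>UNIV. m' i j p * ep' p) = ep' i * ep' j"
proof -
  note h = id_ring_hom
  have "mulf (\<lambda>x. x) m' ep' = mulf (\<lambda>x. x) m' (pull (\<lambda>x. x) ep)" by (simp only: pull_ep[OF h])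
  also have "\<dots> = pull2 (\<lambda>x. x) (mulf (\<lambda>x. x) mu ep)" by (rule mulf_pull[OF h])
  also have "mulf (\<lambda>x. x) mu ep = tensf ep ep" by (auto simp: mulf_def tensf_def ep_mult)
  also have "pull2 (\<lambda>x. x) (tensf ep ep) = tensf (pull (\<lambda>x. x) ep) (pull (\<lambda>x. x) ep)" by (simp only: tensf_pull[OF h])
  finally have "mulf (\<lambda>x. x) m' ep' (i, j) = tensf ep' ep' (i, j)" by (simp only: pull_ep[OF h])
  then show ?thesis by (simp add: mulf_def tensf_def)
qed

text \<open>The vector whose coordinates in the new basis are \<open>x\<close>.\<close>

definition lc where "lc x = (\<lambda>z. \<Sum>i\<in>UNIV. x i * e i z)"

lemma lc_surj: "\<exists>x. y = lc x"
proof
  show "y = lc (\<lambda>i. \<Sum>x\<in>UNIV. y x * f x i)"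
  proof
    fix z
    have "lc (\<lambda>i. \<Sum>x\<in>UNIV. y x * f x i) z = (\<Sum>i\<in>UNIV. \<Sum>x\<in>UNIV. y x * (f x i * e i z))"
      by (simp add: lc_def sum_distrib_right mult.assoc)
    also have "\<dots> = (\<Sum>x\<in>UNIV. y x * (\<Sum>i\<in>UNIV. f x i * e i z))"
      unfolding sum_distrib_left by (rule sum.swap)
    also have "\<dots> = y z" by (simp only: fe sum_delta_mult)
    finally show "y z = lc (\<lambda>i. \<Sum>x\<in>UNIV. y x * f x i) z" by simp
  qed
qed

lemma lc_inj: "lc x = lc y \<Longrightarrow> x = y"
proof
  fix j assume eq: "lc x = lc y"
  have "(\<Sum>z\<in>UNIV. lc x z * f z j) = x j" for x
  proof -
    have "(\<Sum>z\<in>UNIV. lc x z * f z j) = (\<Sum>z\<in>UNIV. \<Sum>i\<in>UNIV. x i * (e i z * f z j))"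
      by (simp add: lc_def sum_distrib_right mult.assoc)
    also have "\<dots> = (\<Sum>i\<in>UNIV. x i * (\<Sum>z\<in>UNIV. e i z * f z j))"
      unfolding sum_distrib_left by (rule sum.swap)
    also have "\<dots> = x j" by (simp only: ef sum_delta_mult)
    finally show ?thesis .
  qed
  from this[of x] this[of y] show "x j = y j" by (simp add: eq)
qed

lemma lc_mult: "lc (h_mult m' x y) = h_mult mu (lc x) (lc y)"
proof
  fix z
  have "lc (h_mult m' x y) z = (\<Sum>l\<in>UNIV. \<Sum>i\<in>UNIV. \<Sum>j\<in>UNIV. x i * y j * (m' i j l * e l z))"
    by (simp add: lc_def h_mult_def sum_distrib_right mult.assoc)
  also have "\<dots> = (\<Sum>i\<in>UNIV. \<Sum>j\<in>UNIV. \<Sum>l\<in>UNIV. x i * y j * (m' i j l * e l z))"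
    by (subst sum.swap, rule sum.cong[OF refl], rule sum.swap)
  also have "\<dots> = (\<Sum>i\<in>UNIV. \<Sum>j\<in>UNIV. x i * y j * h_mult mu (e i) (e j) z)"
    unfolding m'_expand[symmetric] sum_distrib_left ..
  also have "\<dots> = (\<Sum>i\<in>UNIV. \<Sum>j\<in>UNIV. \<Sum>p\<in>UNIV. \<Sum>q\<in>UNIV. (x i * e i p) * (y j * e j q) * mu p q z)"
    unfolding h_mult_def sum_distrib_left by (intro sum.cong refl) (simp only: mult_ac)
  also have "\<dots> = (\<Sum>p\<in>UNIV. \<Sum>q\<in>UNIV. \<Sum>i\<in>UNIV. \<Sum>j\<in>UNIV. (x i * e i p) * (y j * e j q) * mu p q z)"
    unfolding sum.cartesian_product
    by (rule sum.reindex_bij_witness[where i = "\<lambda>(x,y,a,b). (a,b,x,y)" and j = "\<lambda>(a,b,x,y). (x,y,a,b)"]) auto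
  also have "\<dots> = h_mult mu (lc x) (lc y) z"
    unfolding h_mult_def lc_def unfolding sum_product unfolding sum_distrib_right ..
  finally show "lc (h_mult m' x y) z = h_mult mu (lc x) (lc y) z" .
qed

section \<open>The change of variables and its effect on the base algebra\<close>

definition lform :: "('b \<Rightarrow> 'b \<Rightarrow> 'k) \<Rightarrow> 'b \<Rightarrow> ('b, 'k) mpoly" where
  "lform E i = (\<Sum>x\<in>UNIV. Poly_Mapping.single (Poly_Mapping.single x 1) (E i x))"

definition subst :: "('b \<Rightarrow> 'b \<Rightarrow> 'k) \<Rightarrow> ('b, 'k) mpoly \<Rightarrow> ('b, 'k) mpoly" where
  "subst E = poly_ev (\<lambda>x. Poly_Mapping.single 0 x) (lform E)"

lemma subst_hom: "is_ring_hom (subst E)"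
  unfolding subst_def by (rule poly_ev_ring_hom[OF single_0_ring_hom])

lemma subst_const: "subst E (Poly_Mapping.single 0 a) = Poly_Mapping.single 0 a"
  by (simp add: subst_def poly_ev_single[OF single_0_ring_hom])

lemma subst_var: "subst E (Poly_Mapping.single (Poly_Mapping.single i 1) a) = Poly_Mapping.single 0 a * lform E i"
  by (simp add: subst_def poly_ev_single[OF single_0_ring_hom])

text \<open>Provides the injectivity that the extension of \<open>subst e\<close> to fractions
  requires.\<close>

lemma subst_subst: "subst f (subst e p) = p"
proof (rule ring_hom_poly_eqI[OF ring_hom_comp[OF subst_hom subst_hom] id_ring_hom])
  show "subst f (subst e (Poly_Mapping.single 0 a)) = Poly_Mapping.single 0 a" for a
    by (simp only: subst_const)
  show "subst f (subst e (Poly_Mapping.single (Poly_Mapping.single i 1) 1)) = Poly_Mapping.single (Poly_Mapping.single i 1) 1" for i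
  proof -
    have "subst f (subst e (Poly_Mapping.single (Poly_Mapping.single i 1) 1)) = (\<Sum>x\<in>UNIV. Poly_Mapping.single 0 (e i x) * lform f x)"
      unfolding subst_var lform_def[of e]
      by (simp add: ring_hom_sum[OF subst_hom] subst_var del: One_nat_def)
    also have "\<dots> = (\<Sum>x\<in>UNIV. \<Sum>j\<in>UNIV. Poly_Mapping.single (Poly_Mapping.single j 1) (e i x * f x j))"
      by (simp add: lform_def sum_distrib_left mult_single)
    also have "\<dots> = (\<Sum>j\<in>UNIV. \<Sum>x\<in>UNIV. Poly_Mapping.single (Poly_Mapping.single j 1) (e i x * f x j))"
      by (rule sum.swap)
    also have "\<dots> = (\<Sum>j\<in>UNIV. Poly_Mapping.single (Poly_Mapping.single j 1) (\<Sum>x\<in>UNIV. e i x * f x j))"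
      by (simp add: single_sum)
    also have "\<dots> = (\<Sum>j\<in>UNIV. if i = j then Poly_Mapping.single (Poly_Mapping.single j 1) 1 else 0)"
      by (rule sum.cong) (simp_all add: ef)
    finally show ?thesis by simp
  qed
qed

text \<open>The field map with t_i -> t_x, where x is the i-th new basis vector.\<close>

definition psi where "psi = fract_ext UNIV (\<lambda>p. Fract (subst e p) 1)"

lemma subst_inj: "subst e p = 0 \<Longrightarrow> p = 0"
  using subst_subst[of p] ring_hom_0[OF subst_hom] by metis

lemma psi_hom: "is_ring_hom psi"
  unfolding psi_def
  by (rule fract_ext_UNIV_ring_hom[OF ring_hom_comp[OF Fract_1_ring_hom subst_hom]])
     (simp add: Fract_1_eq_0_iff subst_inj)

lemma psi_Fract: "psi (Fract p 1) = Fract (subst e p) 1"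
proof -
  have "psi (Fract p 1) = Fract (subst e p) 1 / Fract (subst e 1) 1"
    unfolding psi_def
    by (rule fract_ext_Fract[OF ring_hom_comp[OF Fract_1_ring_hom subst_hom]])
       (simp_all add: Fract_1_eq_0_iff subst_inj)
  then show ?thesis by (simp add: ring_hom_1[OF subst_hom])
qed

lemma psi_const: "psi (pconst a) = pconst a"
  by (simp add: pconst_def psi_Fract subst_const)

lemma psi_pvar: "(\<lambda>i. psi (pvar i)) = pull pconst pvar"
proof
  fix i
  have "psi (pvar i) = Fract (Poly_Mapping.single 0 1 * lform e i) 1"
    unfolding pvar_def psi_Fract subst_var ..
  also have "\<dots> = (\<Sum>x\<in>UNIV. pconst (e i x) * pvar x)"
    unfolding lform_def by (simp add: ring_hom_sum[OF Fract_1_ring_hom] pconst_def pvar_def mult_single)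
  finally show "psi (pvar i) = pull pconst pvar i" by (simp add: pull_def conv_dual_def)
qed

text \<open>The image under \<open>psi\<close> of the new t^{-1}, pushed to the given basis, inverts
  the given t and so equals the given t^{-1} by uniqueness. The cocycles then correspond, and with
  them the generated algebras. The inverse equations appear as hypotheses because they come from
  triangularity.\<close>

lemma base_algebra_image:
  assumes inv1: "conv pconst C pvar (tinv_fun C ep') = (\<lambda>i. pconst (ep' i))"
    and inv2: "conv pconst C (tinv_fun C ep') pvar = (\<lambda>i. pconst (ep' i))"
  shows "generic_base_algebra mu dl ep = psi ` generic_base_algebra m' C ep'"
proof -
  note k = pconst_ring_hom
  let ?tn = "tinv_fun C ep'"
  define to where "to = push pconst (\<lambda>i. psi (?tn i))"
  have to: "pull pconst to = (\<lambda>i. psi (?tn i))" unfolding to_def by (rule pull_push[OF k])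
  have psi_conv: "conv pconst D (\<lambda>i. psi (g1 i)) (\<lambda>i. psi (g2 i)) = (\<lambda>i. psi (conv pconst D g1 g2 i))"
    for D :: "'j::finite \<Rightarrow> 'j \<Rightarrow> 'j \<Rightarrow> 'k" and g1 g2
    by (rule ext) (simp add: ring_hom_conv[OF psi_hom] psi_const)
  have "pull pconst (conv pconst dl pvar to) = pull pconst (\<lambda>i. pconst (ep i))"
    by (simp only: conv_pull[OF k, symmetric] to psi_pvar[symmetric] psi_conv inv1 psi_const pull_ep[OF k])
  then have c1: "conv pconst dl pvar to = (\<lambda>i. pconst (ep i))" by (metis push_pull[OF k])
  have "pull pconst (conv pconst dl to pvar) = pull pconst (\<lambda>i. pconst (ep i))"
    by (simp only: conv_pull[OF k, symmetric] to psi_pvar[symmetric] psi_conv inv2 psi_const pull_ep[OF k])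
  then have c2: "conv pconst dl to pvar = (\<lambda>i. pconst (ep i))" by (metis push_pull[OF k])
  have tinv_to: "tinv_fun dl ep = to"
    unfolding tinv_fun_def
  proof (rule the_equality)
    show "tinv_cond dl ep to" by (simp add: tinv_cond_iff c1 c2)
    show "g = to" if "tinv_cond dl ep g" for g
      using that c1 conv_inverse_unique[OF k, of g pvar to] by (simp add: tinv_cond_iff)
  qed
  have psi_mulf: "mulf pconst m' (\<lambda>i. psi (g i)) = (\<lambda>p. psi (mulf pconst m' g p))" for g
    by (rule ext) (simp add: ring_hom_mulf[OF psi_hom] psi_const)
  have psi_tensf: "tensf (\<lambda>i. psi (g i)) (\<lambda>i. psi (g' i)) = (\<lambda>p. psi (tensf g g' p))" for g g' :: "'b \<Rightarrow> _"
    by (rule ext) (simp add: ring_hom_tensf[OF psi_hom])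
  let ?s = "conv pconst (pair_c C) (tensf pvar pvar) (mulf pconst m' ?tn)"
  let ?so = "conv pconst (pair_c dl) (tensf pvar pvar) (mulf pconst mu to)"
  let ?r = "conv pconst (pair_c C) (mulf pconst m' pvar) (tensf ?tn ?tn)"
  let ?ro = "conv pconst (pair_c dl) (mulf pconst mu pvar) (tensf to to)"
  have s: "(\<lambda>p. psi (?s p)) = pull2 pconst ?so"
    by (simp only: psi_conv[symmetric] psi_tensf[symmetric] psi_mulf[symmetric] psi_pvar to[symmetric]
        tensf_pull[OF k] mulf_pull[OF k] conv_pull2[OF k])
  have r: "(\<lambda>p. psi (?r p)) = pull2 pconst ?ro"
    by (simp only: psi_conv[symmetric] psi_tensf[symmetric] psi_mulf[symmetric] psi_pvar to[symmetric]
        tensf_pull[OF k] mulf_pull[OF k] conv_pull2[OF k])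
  have bil: "(\<Sum>p\<in>UNIV. \<Sum>q\<in>UNIV. pconst (lc x p) * pconst (lc y q) * S (p, q)) =
      (\<Sum>i\<in>UNIV. \<Sum>j\<in>UNIV. pconst (x i) * pconst (y j) * pull2 pconst S (i, j))" for x y and S :: "_ \<Rightarrow> ('b, 'k) mpoly fract"
  proof -
    have "(\<Sum>p\<in>UNIV. \<Sum>q\<in>UNIV. pconst (lc x p) * pconst (lc y q) * S (p, q)) =
       (\<Sum>p\<in>UNIV. \<Sum>q\<in>UNIV. \<Sum>i\<in>UNIV. \<Sum>j\<in>UNIV. pconst (x i) * pconst (y j) * (pconst (e i p) * pconst (e j q) * S (p, q)))"
      unfolding lc_def ring_hom_sum[OF k] ring_hom_mult[OF k] unfolding sum_product unfolding sum_distrib_right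
      by (intro sum.cong refl) (simp only: mult_ac)
    also have "\<dots> = (\<Sum>i\<in>UNIV. \<Sum>j\<in>UNIV. \<Sum>p\<in>UNIV. \<Sum>q\<in>UNIV. pconst (x i) * pconst (y j) * (pconst (e i p) * pconst (e j q) * S (p, q)))"
      unfolding sum.cartesian_product
      by (rule sum.reindex_bij_witness[where i = "\<lambda>(x,y,a,b). (a,b,x,y)" and j = "\<lambda>(a,b,x,y). (x,y,a,b)"]) auto
    also have "\<dots> = (\<Sum>i\<in>UNIV. \<Sum>j\<in>UNIV. pconst (x i) * pconst (y j) * pull2 pconst S (i, j))"
      unfolding pull2_apply[OF k] sum_distrib_left ..
    finally show ?thesis .
  qed
  have S: "gen_sigma mu dl ep (lc x) (lc y) = psi (gen_sigma m' C ep' x y)" for x y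
    unfolding gen_sigma_eq tinv_to bil s[symmetric]
    by (simp add: ring_hom_sum[OF psi_hom] ring_hom_mult[OF psi_hom] psi_const)
  have Rr: "gen_sigma_inv mu dl ep (lc x) (lc y) = psi (gen_sigma_inv m' C ep' x y)" for x y
    unfolding gen_sigma_inv_eq tinv_to bil r[symmetric]
    by (simp add: ring_hom_sum[OF psi_hom] ring_hom_mult[OF psi_hom] psi_const)
  have surj: "{F x y | x y. True} = psi ` {F' x y | x y. True}"
    if "\<And>x y. F (lc x) (lc y) = psi (F' x y)" for F F'
    using that lc_surj by (auto simp: image_iff) metis+
  show ?thesis
    unfolding generic_base_algebra_def gen_subalg_image[OF psi_hom psi_const] image_Un
      surj[of "gen_sigma mu dl ep", OF S] surj[of "gen_sigma_inv mu dl ep", OF Rr] ..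
qed

end

section \<open>The theorem\<close>

text \<open>Expanding the coordinate vectors in the basis gives one matrix identity; the other
  follows because the difference of its sides would be a linear relation among the basis
  vectors.\<close>

lemma dual_basis_matrix:
  fixes e :: "'b::finite \<Rightarrow> 'b \<Rightarrow> 'k::field"
  assumes e: "inj e" "fv.independent (range e)" "fv.span (range e) = UNIV"
  obtains f where "\<And>i j. (\<Sum>x\<in>UNIV. e i x * f x j) = (if i = j then 1 else 0)"
    "\<And>x y. (\<Sum>i\<in>UNIV. f x i * e i y) = (if x = y then 1 else 0)"
proof -
  define f where "f x i = fv.representation (range e) (h_basis x) (e i)" for x i
  have hb: "h_basis x = (\<Sum>i\<in>UNIV. vscale (f x i) (e i))" for x
  proof -
    have "(\<Sum>b\<in>range e. vscale (fv.representation (range e) (h_basis x) b) b) = h_basis x"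
      using e by (intro fv.sum_representation_eq) auto
    then show ?thesis using e(1) by (simp add: f_def sum.reindex)
  qed
  have fe: "(\<Sum>i\<in>UNIV. f x i * e i y) = (if x = y then 1 else 0)" for x y
    using fun_cong[OF hb[of x], of y] by (simp add: h_basis_def fun_sum_apply vscale_def eq_commute)
  moreover have "(\<Sum>x\<in>UNIV. e i x * f x j) = (if i = j then 1 else 0)" for i j
  proof -
    define u where "u j = (\<Sum>x\<in>UNIV. e i x * f x j) - (if i = j then 1 else 0)" for j
    have "(\<Sum>j\<in>UNIV. vscale (u j) (e j)) = 0"
    proof
      fix y
      have "(\<Sum>j\<in>UNIV. u j * e j y) = (\<Sum>j\<in>UNIV. \<Sum>x\<in>UNIV. e i x * (f x j * e j y)) - (\<Sum>j\<in>UNIV. (if i = j then 1 else 0) * e j y)"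
        by (simp add: u_def left_diff_distrib sum_subtractf sum_distrib_right mult.assoc)
      also have "(\<Sum>j\<in>UNIV. \<Sum>x\<in>UNIV. e i x * (f x j * e j y)) = (\<Sum>x\<in>UNIV. e i x * (\<Sum>j\<in>UNIV. f x j * e j y))"
        unfolding sum_distrib_left by (rule sum.swap)
      also have "\<dots> = e i y" by (simp only: fe sum_delta_mult)
      also have "(\<Sum>j\<in>UNIV. (if i = j then 1 else 0) * e j y) = e i y" by (simp only: sum_delta_mult)
      finally show "(\<Sum>j\<in>UNIV. vscale (u j) (e j)) y = 0 y"
        by (simp add: fun_sum_apply vscale_def)
    qed
    from independent_coeffs_eq_0[OF e(2,1) this, of j] show ?thesis by (simp add: u_def)
  qed
  ultimately show ?thesis using that by blast
qed

lemma lin_map_apply: "lin_map pim x d = (\<Sum>i\<in>UNIV. x i * pim i d)"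
  by (simp add: lin_map_def fun_sum_apply vscale_def)

lemma h_mult_assoc:
  assumes "\<And>i j k l. (\<Sum>p\<in>UNIV. mu i j p * mu p k l) = (\<Sum>p\<in>UNIV. mu j k p * mu i p l)"
  shows "h_mult mu (h_mult mu x y) z = h_mult mu x (h_mult mu y z)"
proof
  fix l
  have "h_mult mu (h_mult mu x y) z l = (\<Sum>p\<in>UNIV. \<Sum>k\<in>UNIV. \<Sum>i\<in>UNIV. \<Sum>j\<in>UNIV. x i * y j * z k * (mu i j p * mu p k l))"
    unfolding h_mult_def sum_distrib_right by (intro sum.cong refl) (simp only: mult_ac)
  also have "\<dots> = (\<Sum>i\<in>UNIV. \<Sum>j\<in>UNIV. \<Sum>k\<in>UNIV. \<Sum>p\<in>UNIV. x i * y j * z k * (mu i j p * mu p k l))"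
    unfolding sum.cartesian_product
    by (rule sum.reindex_bij_witness[where i = "\<lambda>(i,j,k,p). (p,k,i,j)" and j = "\<lambda>(p,k,i,j). (i,j,k,p)"]) auto
  also have "\<dots> = (\<Sum>i\<in>UNIV. \<Sum>j\<in>UNIV. \<Sum>k\<in>UNIV. x i * y j * z k * (\<Sum>p\<in>UNIV. mu j k p * mu i p l))"
    unfolding assms[symmetric] sum_distrib_left ..
  also have "\<dots> = (\<Sum>i\<in>UNIV. \<Sum>p\<in>UNIV. \<Sum>j\<in>UNIV. \<Sum>k\<in>UNIV. x i * y j * z k * (mu j k p * mu i p l))"
    unfolding sum_distrib_left by (rule sum.cong[OF refl], rule sum_rotate)
  also have "\<dots> = h_mult mu x (h_mult mu y z) l"
    unfolding h_mult_def sum_distrib_left sum_distrib_right by (intro sum.cong refl) (simp only: mult_ac)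
  finally show "h_mult mu (h_mult mu x y) z l = h_mult mu x (h_mult mu y z) l" .
qed

text \<open>Multiplicativity of \<Delta> and \<epsilon>; for \<Delta> it is evaluated on pairs of
  coordinate functionals by means of \<open>conv_mulf\<close>.\<close>

lemma grouplike_mult:
  assumes bialg: "\<And>i j a b. (\<Sum>p\<in>UNIV. mu i j p * dl p a b) =
        (\<Sum>a1\<in>UNIV. \<Sum>b1\<in>UNIV. \<Sum>a2\<in>UNIV. \<Sum>b2\<in>UNIV. dl i a1 b1 * dl j a2 b2 * mu a1 a2 a * mu b1 b2 b)"
    and ep_mult: "\<And>i j. (\<Sum>p\<in>UNIV. mu i j p * ep p) = ep i * ep j"
    and g: "grouplike dl ep g" and k: "grouplike dl ep k"
  shows "grouplike dl ep (h_mult mu g k)"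
proof -
  note h = id_ring_hom
  let ?d = "\<lambda>a i. if i = a then 1 else 0"
  have dd: "conv (\<lambda>x. x) dl (?d a) (?d b) i = dl i a b" for a b i
  proof -
    have "conv (\<lambda>x. x) dl (?d a) (?d b) i = (\<Sum>p\<in>UNIV. dl i p b * ?d a p)"
      by (simp only: conv_def sum_delta_mult)
    then show ?thesis by (simp only: sum_delta_mult)
  qed
  have md: "mulf (\<lambda>x. x) mu (?d a) (i, j) = mu i j a" for a i j
    by (simp only: mulf_def prod.case sum_delta_mult)
  have gk: "h_comult dl g (a, b) = g a * g b" "h_comult dl k (a, b) = k a * k b" for a b
    using g k by (simp_all add: grouplike_def tens_def)
  have "h_comult dl (h_mult mu g k) (a, b) = h_mult mu g k a * h_mult mu g k b" for a b
  proof -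
    have "h_comult dl (h_mult mu g k) (a, b) = conv_dual (\<lambda>x. x) (conv (\<lambda>x. x) dl (?d a) (?d b)) (h_mult mu g k)"
      by (simp add: h_comult_def conv_dual_def dd)
    also have "\<dots> = (\<Sum>i\<in>UNIV. \<Sum>j\<in>UNIV. g i * k j * conv (\<lambda>x. x) (pair_c dl) (mulf (\<lambda>x. x) mu (?d a)) (mulf (\<lambda>x. x) mu (?d b)) (i, j))"
      unfolding conv_dual_h_mult[OF h] conv_mulf[OF h bialg] ..
    also have "\<dots> = (\<Sum>s\<in>UNIV. \<Sum>t\<in>UNIV. \<Sum>u\<in>UNIV. \<Sum>v\<in>UNIV. (g s * g t) * (k u * k v) * mu s u a * mu t v b)"
      unfolding bilinear_sum[OF h, symmetric] gk md ..
    also have "\<dots> = h_mult mu g k a * h_mult mu g k b"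
      unfolding h_mult_def unfolding sum_product by (intro sum.cong refl) (simp only: mult_ac)
    finally show ?thesis .
  qed
  then have "h_comult dl (h_mult mu g k) = tens (h_mult mu g k) (h_mult mu g k)"
    by (auto simp: fun_eq_iff tens_def)
  moreover have "(\<Sum>l\<in>UNIV. h_mult mu g k l * ep l) = 1"
  proof -
    have "(\<Sum>l\<in>UNIV. h_mult mu g k l * ep l) = conv_dual (\<lambda>x. x) ep (h_mult mu g k)" by (simp add: conv_dual_def)
    also have "\<dots> = (\<Sum>i\<in>UNIV. \<Sum>j\<in>UNIV. g i * k j * (ep i * ep j))"
      unfolding conv_dual_h_mult[OF h] mulf_def prod.case ep_mult ..
    also have "\<dots> = (\<Sum>i\<in>UNIV. g i * ep i) * (\<Sum>j\<in>UNIV. k j * ep j)"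
      unfolding sum_product by (intro sum.cong refl) (simp only: mult_ac)
    also have "\<dots> = 1" using g k by (simp add: grouplike_def)
    finally show ?thesis .
  qed
  ultimately show ?thesis by (simp add: grouplike_def)
qed

text \<open>The image under \<open>lc\<close> of an ideal containing all commutators is such an
  ideal for \<open>mu\<close>, so it contains the commutator ideal; injectivity of \<open>lc\<close>
  returns to coordinates.\<close>

lemma two_sided_ideal_lc:
  assumes "basis_change dl ep mu e f"
    and I: "two_sided_ideal (basis_change.m' mu e f) I"
    and comm: "\<forall>x y. h_mult (basis_change.m' mu e f) x y - h_mult (basis_change.m' mu e f) y x \<in> I"
    and x: "basis_change.lc e x \<in> commutator_ideal mu"
  shows "x \<in> I"
proof -
  interpret basis_change dl ep mu e f by fact
  have lc0: "lc 0 = 0" and lcadd: "lc (x + y) = lc x + lc y" and lcs: "lc (vscale k x) = vscale k (lc x)"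
    and lcd: "lc (x - y) = lc x - lc y" for x y k
    by (rule ext, simp add: lc_def vscale_def distrib_right left_diff_distrib sum.distrib sum_subtractf
        sum_distrib_left mult.assoc)+
  have I': "0 \<in> I" "\<And>x y. x \<in> I \<Longrightarrow> y \<in> I \<Longrightarrow> x + y \<in> I" "\<And>k x. x \<in> I \<Longrightarrow> vscale k x \<in> I"
    "\<And>x y. x \<in> I \<Longrightarrow> h_mult m' x y \<in> I" "\<And>x y. x \<in> I \<Longrightarrow> h_mult m' y x \<in> I"
    using I by (auto simp: two_sided_ideal_def subspace_of_def)
  have "two_sided_ideal mu (lc ` I)"
    unfolding two_sided_ideal_def subspace_of_def
  proof (intro conjI ballI allI)
    show "0 \<in> lc ` I" using I'(1) lc0 by (metis imageI)
    fix x assume "x \<in> lc ` I"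
    then obtain a where a: "x = lc a" "a \<in> I" by blast
    show "vscale k x \<in> lc ` I" for k using I'(3)[OF a(2)] a(1) lcs by (metis imageI)
    show "h_mult mu x y \<in> lc ` I" for y
      using lc_surj[of y] I'(4)[OF a(2)] a(1) lc_mult by (metis imageI)
    show "h_mult mu y x \<in> lc ` I" for y
      using lc_surj[of y] I'(5)[OF a(2)] a(1) lc_mult by (metis imageI)
    fix y assume "y \<in> lc ` I"
    then obtain b where b: "y = lc b" "b \<in> I" by blast
    show "x + y \<in> lc ` I" using I'(2)[OF a(2) b(2)] a(1) b(1) lcadd by (metis imageI)
  qed
  moreover have "h_mult mu x y - h_mult mu y x \<in> lc ` I" for x y
  proof -
    obtain a b where "x = lc a" "y = lc b" using lc_surj by metis
    then have "h_mult mu x y - h_mult mu y x = lc (h_mult m' a b - h_mult m' b a)" by (simp add: lcd lc_mult)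
    then show ?thesis using comm by blast
  qed
  ultimately have "commutator_ideal mu \<subseteq> lc ` I" unfolding commutator_ideal_def by blast
  then obtain y where "y \<in> I" "lc x = lc y" using x by blast
  then show ?thesis using lc_inj by metis
qed

theorem theorem4p4:
  fixes mu :: "'b::{finite,linorder} \<Rightarrow> 'b \<Rightarrow> 'b \<Rightarrow> 'k::field"
    and eta :: "'b \<Rightarrow> 'k" and dl :: "'b \<Rightarrow> 'b \<Rightarrow> 'b \<Rightarrow> 'k"
    and ep :: "'b \<Rightarrow> 'k" and an :: "'b \<Rightarrow> 'b \<Rightarrow> 'k"
    and G :: "('g, 'm) monoid_scheme"
  assumes "hopf_algebra mu eta dl ep an"
    and "pointed dl"
    and "group G" and "finite (carrier G)"
    and "hab_iso_group_algebra mu eta dl ep G"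
  shows "\<exists>(m::nat) (T :: (nat, 'k) mpoly set) \<phi>.
           mult_subset m T \<and>
           k_alg_iso (generic_base_algebra mu dl ep) (localization m T) \<phi>"
proof -
  note hopf = assms(1)[unfolded hopf_algebra_def]
  note assoc = hopf[THEN conjunct1, rule_format]
  note hopf1 = hopf[THEN conjunct2]
  note unit_l = hopf1[THEN conjunct1, rule_format]
  note hopf2 = hopf1[THEN conjunct2]
  note unit_r = hopf2[THEN conjunct1, rule_format]
  note hopf3 = hopf2[THEN conjunct2]
  note coassoc = hopf3[THEN conjunct1, rule_format]
  note hopf4 = hopf3[THEN conjunct2]
  note counit_l = hopf4[THEN conjunct1, rule_format]
  note hopf5 = hopf4[THEN conjunct2]
  note counit_r = hopf5[THEN conjunct1, rule_format]
  note hopf6 = hopf5[THEN conjunct2]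
  note bialg = hopf6[THEN conjunct1, rule_format]
  note hopf7 = hopf6[THEN conjunct2]
  note eta_dl = hopf7[THEN conjunct1, rule_format]
  note hopf8 = hopf7[THEN conjunct2]
  note ep_mult = hopf8[THEN conjunct1, rule_format]
  note hopf9 = hopf8[THEN conjunct2]
  note eta_ep = hopf9[THEN conjunct1]
  note antipode = hopf9[THEN conjunct2, THEN conjunct1, rule_format]
  have coalg: "coalg_consts dl ep"
    by unfold_locales (rule coassoc counit_l counit_r)+
  interpret pointed_coalgebra dl ep
    using coalg assms(2) by (simp add: pointed_coalgebra_def pointed_coalgebra_axioms_def)
  interpret G: group G by fact
  obtain pim where pim: "\<And>i. pim i \<in> galg G"
    "\<And>x y. lin_map pim (h_mult mu x y) = galg_mult G (lin_map pim x) (lin_map pim y)"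
    "\<And>x. galg_comult G (lin_map pim x) = (\<lambda>(g, h). \<Sum>a\<in>UNIV. \<Sum>b\<in>UNIV. h_comult dl x (a, b) * pim a g * pim b h)"
    "\<And>x. galg_counit G (lin_map pim x) = (\<Sum>i\<in>UNIV. x i * ep i)"
    "{x. lin_map pim x = 0} = commutator_ideal mu"
    using assms(5) unfolding hab_iso_group_algebra_def by blast

  have unit_r': "h_mult mu x eta = x" and unit_l': "h_mult mu eta x = x" for x
  proof -
    have "h_mult mu x eta l = (\<Sum>i\<in>UNIV. x i * (\<Sum>j\<in>UNIV. eta j * mu i j l))" for l
      by (simp add: h_mult_def sum_distrib_left mult.assoc)
    then show "h_mult mu x eta = x" by (intro ext) (simp only: unit_r sum_delta_mult)
    have "h_mult mu eta x l = (\<Sum>i\<in>UNIV. x i * (\<Sum>j\<in>UNIV. eta j * mu j i l))" for l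
      unfolding h_mult_def sum_distrib_left by (subst sum.swap) (simp add: mult_ac)
    then show "h_mult mu eta x = x" by (intro ext) (simp only: unit_l sum_delta_mult)
  qed
  note assoc' = h_mult_assoc[of mu, OF assoc]
  have gl_mult: "grouplike dl ep (h_mult mu g k)" if "grouplike dl ep g" "grouplike dl ep k" for g k
    using that by (rule grouplike_mult[OF bialg ep_mult])
  have gl_eta: "grouplike dl ep eta"
    by (auto simp: grouplike_def h_comult_def tens_def eta_dl eta_ep)
  \<comment> \<open>The antipode of a group-like; the left inverse is used for cancellation in the
    powers of p.\<close>
  have gl_left_inverse: "\<exists>s. h_mult mu s g = eta" if g: "grouplike dl ep g" for g
  proof
    have gg: "(\<Sum>i\<in>UNIV. g i * dl i a b) = g a * g b" for a b
      using g by (auto simp: grouplike_def h_comult_def tens_def fun_eq_iff)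
    show "h_mult mu (\<lambda>c. \<Sum>a\<in>UNIV. g a * an a c) g = eta"
    proof
      fix l
      have "h_mult mu (\<lambda>c. \<Sum>a\<in>UNIV. g a * an a c) g l = (\<Sum>c\<in>UNIV. \<Sum>b\<in>UNIV. \<Sum>a\<in>UNIV. (g a * g b) * (an a c * mu c b l))"
        unfolding h_mult_def sum_distrib_right by (intro sum.cong refl) (simp only: mult_ac)
      also have "\<dots> = (\<Sum>c\<in>UNIV. \<Sum>b\<in>UNIV. \<Sum>a\<in>UNIV. \<Sum>i\<in>UNIV. g i * (dl i a b * an a c * mu c b l))"
        unfolding gg[symmetric] sum_distrib_right by (simp only: mult.assoc)
      also have "\<dots> = (\<Sum>i\<in>UNIV. \<Sum>a\<in>UNIV. \<Sum>b\<in>UNIV. \<Sum>c\<in>UNIV. g i * (dl i a b * an a c * mu c b l))"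
        unfolding sum.cartesian_product
        by (rule sum.reindex_bij_witness[where i = "\<lambda>(i,a,b,c). (c,b,a,i)" and j = "\<lambda>(c,b,a,i). (i,a,b,c)"]) auto
      also have "\<dots> = (\<Sum>i\<in>UNIV. g i * (ep i * eta l))"
        unfolding antipode[symmetric] sum_distrib_left ..
      also have "\<dots> = (\<Sum>i\<in>UNIV. g i * ep i) * eta l" by (simp add: sum_distrib_right mult.assoc)
      also have "\<dots> = eta l" using g by (simp add: grouplike_def)
      finally show "h_mult mu (\<lambda>c. \<Sum>a\<in>UNIV. g a * an a c) g l = eta l" .
    qed
  qed

  have pc: "(\<Sum>a\<in>UNIV. \<Sum>b\<in>UNIV. dl p a b * pim a d' * pim b d) = (if d' = d then pim p d else 0)" for p d d'
  proof -
    have "lin_map pim (h_basis p) = pim p"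
      by (rule ext) (simp only: lin_map_apply h_basis_def sum_delta_mult)
    moreover have "h_comult dl (h_basis p) (a, b) = dl p a b" for a b
      by (simp only: h_comult_def prod.case h_basis_def sum_delta_mult)
    ultimately show ?thesis
      using fun_cong[OF pim(3)[of "h_basis p"], of "(d', d)"] by (simp add: galg_comult_def split: if_splits)
  qed
  \<comment> \<open>The image of a group-like in kG is a single group element: its coefficients are
    orthogonal idempotents of the field with sum 1.\<close>
  have "\<exists>d0. d0 \<in> carrier G \<and> (\<forall>d. (\<Sum>i\<in>UNIV. g i * pim i d) = (if d = d0 then 1 else 0))" if g: "grouplike dl ep g" for g
  proof -
    define F where "F d = (\<Sum>i\<in>UNIV. g i * pim i d)" for d
    have FF: "F a * F b = (if a = b then F a else 0)" for a b
    proof -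
      have "(\<Sum>x\<in>UNIV. \<Sum>y\<in>UNIV. h_comult dl g (x, y) * pim x a * pim y b) = F a * F b"
        using g by (simp add: grouplike_def tens_def F_def sum_product mult_ac)
      moreover have "lin_map pim g a = F a" for a by (simp add: lin_map_apply F_def)
      ultimately show ?thesis
        using fun_cong[OF pim(3)[of g], of "(a, b)"] by (simp add: galg_comult_def split: if_splits)
    qed
    have "(\<Sum>a\<in>carrier G. F a) = 1"
      using pim(4)[of g] g by (simp add: galg_counit_def lin_map_apply grouplike_def flip: F_def)
    then obtain d0 where d0: "d0 \<in> carrier G" "F d0 \<noteq> 0" by (metis sum.neutral zero_neq_one)
    have "F d = (if d = d0 then 1 else 0)" for d
      using FF[of d0 d0] FF[of d d0] d0(2) by (auto split: if_splits)
    then show ?thesis using d0(1) by (auto simp: F_def)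
  qed
  then obtain piG where piG: "\<And>g. grouplike dl ep g \<Longrightarrow> piG g \<in> carrier G"
    and pg: "\<And>g d. grouplike dl ep g \<Longrightarrow> (\<Sum>i\<in>UNIV. g i * pim i d) = (if d = piG g then 1 else 0)"
    by metis
  obtain e :: "'b \<Rightarrow> 'b \<Rightarrow> 'k" and gl where e: "inj e" "fv.independent (range e)" "fv.span (range e) = UNIV"
    and gl_range: "\<And>g. grouplike dl ep g \<Longrightarrow> g \<in> range e" and gl: "\<And>i. grouplike dl ep (gl i)"
    and step: "\<And>i b. Rop dl b (e i) - vscale (gl i b) (e i) \<in> fv.span (e ` {a. i < a})"
    and hom: "\<And>i. rdeg dl pim (piG (gl i)) (e i)"
    by (rule flag_basis[OF pointed_coalgebra_axioms pc pg]) (assumption, rule that)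
  obtain f where ef: "\<And>i j. (\<Sum>x\<in>UNIV. e i x * f x j) = (if i = j then 1 else 0)"
    and fe: "\<And>x y. (\<Sum>i\<in>UNIV. f x i * e i y) = (if x = y then 1 else 0)"
    by (rule dual_basis_matrix[OF e]) (rule that)
  interpret bc: basis_change dl ep mu e f
    using coalg bialg ep_mult ef fe by (simp add: basis_change_def basis_change_axioms_def)
  interpret nc: coalg_consts bc.C bc.ep' by (rule bc.new_coalg)
  define P where "P = {i. grouplike dl ep (e i)}"
  have ex_ix: "\<exists>i. e i = g \<and> i \<in> P" if "grouplike dl ep g" for g
    using gl_range[OF that] that by (auto simp: P_def)
  define ixg where "ixg g = (SOME i. e i = g)" for g
  have ixg: "e (ixg g) = g" "ixg g \<in> P" if "grouplike dl ep g" for g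
  proof -
    show eq: "e (ixg g) = g" unfolding ixg_def by (rule someI_ex) (use ex_ix[OF that] in blast)
    then show "ixg g \<in> P" using that by (simp add: P_def)
  qed
  have ixg_e: "ixg (e i) = i" if "i \<in> P" for i
    using ixg(1)[of "e i"] that e(1) by (auto simp: P_def inj_def)
  have Pgl: "grouplike dl ep (e p)" if "p \<in> P" for p using that by (simp add: P_def)
  define pm where "pm p q = ixg (h_mult mu (e p) (e q))" for p q
  define u where "u = ixg eta"
  define hh where "hh i = ixg (gl i)" for i
  have e_pm: "e (pm p q) = h_mult mu (e p) (e q)" "pm p q \<in> P" if "p \<in> P" "q \<in> P" for p q
    unfolding pm_def using ixg[OF gl_mult[OF Pgl[OF that(1)] Pgl[OF that(2)]]] by auto
  have e_u: "e u = eta" "u \<in> P" unfolding u_def using ixg[OF gl_eta] by auto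
  have e_hh: "e (hh i) = gl i" "hh i \<in> P" for i unfolding hh_def using ixg[OF gl] by auto
  define dg where "dg i = piG (gl i)" for i
  have dgG: "dg i \<in> carrier G" for i unfolding dg_def by (rule piG[OF gl])

  have P_c: "bc.C p a b = (if a = p \<and> b = p then 1 else 0)" if "p \<in> P" for p a b
  proof -
    have "bc.C p a b = (\<Sum>y\<in>UNIV. e p y * f y a) * (\<Sum>z\<in>UNIV. e p z * f z b)"
      using Pgl[OF that] by (simp add: bc.C_def grouplike_def tens_def sum_product mult_ac)
    then show ?thesis by (auto simp: ef)
  qed
  have P_m: "bc.m' p q l = (if l = pm p q then 1 else 0)" if "p \<in> P" "q \<in> P" for p q l
    unfolding bc.m'_def e_pm(1)[OF that, symmetric] ef by auto
  have C_Rop: "bc.C i a b = (\<Sum>z\<in>UNIV. (\<Sum>y\<in>UNIV. Rop dl z (e i) y * f y a) * f z b)" for i a b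
    unfolding bc.C_def Rop_def sum_distrib_right by (subst sum.swap) (simp only: mult.assoc)
  \<comment> \<open>The flag property in coordinates: the correction term involves only indices
    above \<open>i\<close>, so elsewhere the leading part alone contributes.\<close>
  have R_coord: "(\<Sum>y\<in>UNIV. Rop dl z (e i) y * f y a) = (if a = i then gl i z else 0)" if "\<not> i < a" for z i a
  proof -
    have sub: "(\<Sum>y\<in>UNIV. x y * f y a) = 0" if x: "x \<in> fv.span (e ` {a. i < a})" for x
    proof -
      have "fv.span (e ` {a. i < a}) \<subseteq> {x. (\<Sum>y\<in>UNIV. x y * f y a) = 0}"
      proof (rule fv.span_minimal)
        show "e ` {a. i < a} \<subseteq> {x. (\<Sum>y\<in>UNIV. x y * f y a) = 0}" using \<open>\<not> i < a\<close> by (auto simp: ef)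
        show "fv.subspace {x. (\<Sum>y\<in>UNIV. x y * f y a) = 0}"
          by (auto simp: fv.subspace_def vscale_def distrib_right sum.distrib mult.assoc simp flip: sum_distrib_left)
      qed
      then show ?thesis using x by blast
    qed
    have "(\<Sum>y\<in>UNIV. Rop dl z (e i) y * f y a) = (\<Sum>y\<in>UNIV. (Rop dl z (e i) - vscale (gl i z) (e i)) y * f y a) +
        gl i z * (\<Sum>y\<in>UNIV. e i y * f y a)"
      by (simp add: left_diff_distrib sum_subtractf vscale_def sum_distrib_left mult.assoc)
    then show ?thesis unfolding sub[OF step] ef by auto
  qed
  have tri: "i \<le> a" if "bc.C i a b \<noteq> 0" for i a b
  proof (rule ccontr)
    assume "\<not> i \<le> a"
    then have "\<not> i < a" "a \<noteq> i" by auto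
    then have "bc.C i a b = 0" unfolding C_Rop by (simp add: R_coord)
    then show False using that by simp
  qed
  have diag: "bc.C i i b = (if b = hh i then 1 else 0)" for i b
  proof -
    have "bc.C i i b = (\<Sum>z\<in>UNIV. e (hh i) z * f z b)"
      unfolding C_Rop R_coord[of i i, OF less_irrefl] e_hh by simp
    then show ?thesis unfolding ef by auto
  qed
  have hhP: "hh p = p" if "p \<in> P" for p
    using diag[of p p] P_c[OF that, of p p] by (auto split: if_splits)
  have dg_hh: "dg (hh i) = dg i" for i
  proof -
    have "gl (hh i) = e (hh (hh i))" by (simp only: e_hh)
    also have "\<dots> = gl i" by (simp only: hhP[OF e_hh(2)] e_hh)
    finally show ?thesis by (simp add: dg_def)
  qed
  have glP: "gl p = e p" if "p \<in> P" for p using e_hh(1)[of p] hhP[OF that] by simp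

  define pe where "pe d b = lin_map pim (e b) d" for d b
  \<comment> \<open>Homogeneity of the basis as a matrix identity: x_1 \<pi>_d(x_2) is the
    projection to the span of the basis vectors of degree d.\<close>
  have cm: "comat (\<lambda>x. x) bc.C (pe d) i a = (if d = dg i \<and> a = i then 1 else 0)" for d i a
  proof -
    have "bc.pull (\<lambda>x. x) (\<lambda>x. pim x d) = pe d"
      by (rule ext) (simp add: bc.pull_def conv_dual_def pe_def lin_map_apply)
    then have fp: "(\<Sum>b\<in>UNIV. f z b * pe d b) = pim z d" for z
      using fun_cong[OF bc.push_pull[OF id_ring_hom, of "\<lambda>x. pim x d"], of z] by (simp add: bc.push_def)
    have "comat (\<lambda>x. x) bc.C (pe d) i a = (\<Sum>b\<in>UNIV. \<Sum>z\<in>UNIV. (\<Sum>y\<in>UNIV. Rop dl z (e i) y * f y a) * (f z b * pe d b))"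
      by (simp add: comat_def C_Rop sum_distrib_right mult.assoc)
    also have "\<dots> = (\<Sum>z\<in>UNIV. (\<Sum>y\<in>UNIV. Rop dl z (e i) y * f y a) * (\<Sum>b\<in>UNIV. f z b * pe d b))"
      unfolding sum_distrib_left by (rule sum.swap)
    also have "\<dots> = (\<Sum>z\<in>UNIV. \<Sum>y\<in>UNIV. (pim z d * Rop dl z (e i) y) * f y a)"
      unfolding fp sum_distrib_right by (intro sum.cong refl) (simp only: mult_ac)
    also have "\<dots> = (\<Sum>y\<in>UNIV. (\<Sum>z\<in>UNIV. pim z d * Rop dl z (e i) y) * f y a)"
      unfolding sum_distrib_right by (rule sum.swap)
    also have "\<dots> = (\<Sum>y\<in>UNIV. rho dl pim d (e i) y * f y a)"
      by (simp add: rho_def fun_sum_apply vscale_def)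
    also have "\<dots> = (\<Sum>y\<in>UNIV. (if d = dg i then e i else 0) y * f y a)"
      using hom[of i] by (simp only: rdeg_def dg_def)
    also have "\<dots> = (if d = dg i then (\<Sum>y\<in>UNIV. e i y * f y a) else 0)" by simp
    finally show ?thesis by (auto simp: ef)
  qed
  \<comment> \<open>Coassociativity with \<pi>_d on the last leg, d being the degree of b:
    projecting the second leg keeps the coefficient at b, whereas projecting e_i first gives 0
    unless \<open>i\<close> has degree d.\<close>
  have dg_c: "dg b = dg i" if "bc.C i a b \<noteq> 0" for i a b
  proof -
    have "(\<Sum>b'\<in>UNIV. bc.C i a b' * comat (\<lambda>x. x) bc.C (pe (dg b)) b' b) = bc.C i a b"
    proof -
      have "(\<Sum>b'\<in>UNIV. bc.C i a b' * comat (\<lambda>x. x) bc.C (pe (dg b)) b' b) = (\<Sum>b'\<in>UNIV. bc.C i a b' * (if b' = b then 1 else 0))"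
        by (intro sum.cong refl) (auto simp: cm)
      then show ?thesis by (simp only: sum_delta_mult)
    qed
    moreover have "(\<Sum>b'\<in>UNIV. bc.C i a b' * comat (\<lambda>x. x) bc.C (pe (dg b)) b' b) =
        (\<Sum>p\<in>UNIV. comat (\<lambda>x. x) bc.C (pe (dg b)) i p * bc.C p a b)"
    proof -
      have "(\<Sum>b'\<in>UNIV. bc.C i a b' * comat (\<lambda>x. x) bc.C (pe (dg b)) b' b) =
          (\<Sum>b'\<in>UNIV. \<Sum>r\<in>UNIV. (bc.C i a b' * bc.C b' b r) * pe (dg b) r)"
        by (simp add: comat_def sum_distrib_left mult.assoc)
      also have "\<dots> = (\<Sum>r\<in>UNIV. (\<Sum>b'\<in>UNIV. bc.C i a b' * bc.C b' b r) * pe (dg b) r)"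
        unfolding sum_distrib_right by (rule sum.swap)
      also have "\<dots> = (\<Sum>r\<in>UNIV. (\<Sum>p\<in>UNIV. bc.C i p r * bc.C p a b) * pe (dg b) r)"
        by (simp only: nc.coassoc)
      also have "\<dots> = (\<Sum>p\<in>UNIV. \<Sum>r\<in>UNIV. (bc.C i p r * bc.C p a b) * pe (dg b) r)"
        unfolding sum_distrib_right by (rule sum.swap)
      also have "\<dots> = (\<Sum>p\<in>UNIV. comat (\<lambda>x. x) bc.C (pe (dg b)) i p * bc.C p a b)"
        unfolding comat_def sum_distrib_right by (intro sum.cong refl) (simp only: mult_ac)
      finally show ?thesis .
    qed
    ultimately have "bc.C i a b = (\<Sum>p\<in>UNIV. comat (\<lambda>x. x) bc.C (pe (dg b)) i p * bc.C p a b)" by simp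
    then show ?thesis using that unfolding cm by (cases "dg b = dg i") auto
  qed
  have mulf_pe: "mulf (\<lambda>x. x) bc.m' (pe d) (p, q) =
      (\<Sum>x\<in>carrier G. \<Sum>y\<in>carrier G. if x \<otimes>\<^bsub>G\<^esub> y = d then pe x p * pe y q else 0)" if "d \<in> carrier G" for d p q
  proof -
    have eq: "mulf (\<lambda>x. x) bc.m' (pe d) (p, q) = lin_map pim (h_mult mu (e p) (e q)) d"
    proof -
      have "mulf (\<lambda>x. x) bc.m' (pe d) (p, q) = (\<Sum>l\<in>UNIV. \<Sum>x\<in>UNIV. bc.m' p q l * e l x * pim x d)"
        by (simp add: mulf_def pe_def lin_map_apply sum_distrib_left mult.assoc)
      also have "\<dots> = (\<Sum>x\<in>UNIV. (\<Sum>l\<in>UNIV. bc.m' p q l * e l x) * pim x d)"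
        unfolding sum_distrib_right by (rule sum.swap)
      finally show ?thesis by (simp only: bc.m'_expand lin_map_apply)
    qed
    show ?thesis unfolding eq pim(2) galg_mult_def pe_def using that by simp
  qed
  \<comment> \<open>The coordinate functional at \<open>l\<close> is unchanged by convolution with
    \<pi>_d for d the degree of \<open>l\<close>. Composed with the multiplication, and since \<pi>
    is multiplicative, this projects to pairs of basis vectors whose degrees multiply to d.\<close>
  have dg_mult: "dg l = dg i \<otimes>\<^bsub>G\<^esub> dg j" if "bc.m' i j l \<noteq> 0" for i j l
  proof -
    let ?d = "dg l" and ?dl = "\<lambda>i. if i = l then 1 else 0"
    have "comat (\<lambda>x. x) (pair_c bc.C) (mulf (\<lambda>x. x) bc.m' (pe ?d)) (i, j) (a1, a2) =
        (\<Sum>x\<in>carrier G. \<Sum>y\<in>carrier G. if x \<otimes>\<^bsub>G\<^esub> y = ?d then comat (\<lambda>x. x) bc.C (pe x) i a1 * comat (\<lambda>x. x) bc.C (pe y) j a2 else 0)" for a1 a2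
    proof -
      let ?X = "\<lambda>p q x y. bc.C i a1 p * bc.C j a2 q * (if x \<otimes>\<^bsub>G\<^esub> y = ?d then pe x p * pe y q else 0)"
      have "comat (\<lambda>x. x) (pair_c bc.C) (mulf (\<lambda>x. x) bc.m' (pe ?d)) (i, j) (a1, a2) =
        (\<Sum>p\<in>UNIV. \<Sum>q\<in>UNIV. \<Sum>x\<in>carrier G. \<Sum>y\<in>carrier G. ?X p q x y)"
        by (simp add: comat_def sum_UNIV_pair pair_c_def mulf_pe[OF dgG] sum_distrib_left)
      also have "\<dots> = (\<Sum>x\<in>carrier G. \<Sum>y\<in>carrier G. \<Sum>p\<in>UNIV. \<Sum>q\<in>UNIV. ?X p q x y)"
        unfolding sum.cartesian_product
        by (rule sum.reindex_bij_witness[where i = "\<lambda>(x,y,a,b). (a,b,x,y)" and j = "\<lambda>(a,b,x,y). (x,y,a,b)"]) auto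
      also have "\<dots> = (\<Sum>x\<in>carrier G. \<Sum>y\<in>carrier G. if x \<otimes>\<^bsub>G\<^esub> y = ?d then comat (\<lambda>x. x) bc.C (pe x) i a1 * comat (\<lambda>x. x) bc.C (pe y) j a2 else 0)"
        by (intro sum.cong refl) (auto simp: comat_def sum_product mult_ac)
      finally show ?thesis .
    qed
    moreover have "(\<Sum>x\<in>carrier G. \<Sum>y\<in>carrier G. if x \<otimes>\<^bsub>G\<^esub> y = ?d then comat (\<lambda>x. x) bc.C (pe x) i a1 * comat (\<lambda>x. x) bc.C (pe y) j a2 else 0)
        = (if dg i \<otimes>\<^bsub>G\<^esub> dg j = ?d \<and> a1 = i \<and> a2 = j then 1 else 0)" for a1 a2
    proof -
      have "(\<Sum>x\<in>carrier G. \<Sum>y\<in>carrier G. if x \<otimes>\<^bsub>G\<^esub> y = ?d then comat (\<lambda>x. x) bc.C (pe x) i a1 * comat (\<lambda>x. x) bc.C (pe y) j a2 else 0)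
        = (\<Sum>x\<in>carrier G. \<Sum>y\<in>carrier G. if y = dg j then (if x = dg i then (if dg i \<otimes>\<^bsub>G\<^esub> dg j = ?d \<and> a1 = i \<and> a2 = j then 1 else 0) else 0) else 0)"
        by (intro sum.cong refl) (auto simp: cm)
      also have "\<dots> = (if dg i \<otimes>\<^bsub>G\<^esub> dg j = ?d \<and> a1 = i \<and> a2 = j then 1 else 0)"
        using assms(4) dgG by (simp add: sum.delta)
      finally show ?thesis .
    qed
    ultimately have cp: "comat (\<lambda>x. x) (pair_c bc.C) (mulf (\<lambda>x. x) bc.m' (pe ?d)) (i, j) a =
        (if dg i \<otimes>\<^bsub>G\<^esub> dg j = ?d then (if a = (i, j) then 1 else 0) else 0)" for a
      by (cases a) simp
    have ml: "mulf (\<lambda>x. x) bc.m' ?dl (i, j) = bc.m' i j l"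
      by (simp only: mulf_def prod.case sum_delta_mult)
    have "conv (\<lambda>x. x) bc.C ?dl (pe ?d) = ?dl"
    proof
      fix i
      have "conv (\<lambda>x. x) bc.C ?dl (pe ?d) i = (\<Sum>a\<in>UNIV. comat (\<lambda>x. x) bc.C (pe ?d) i a * (if a = l then 1 else 0))"
        by (simp only: nc.conv_comat mult.commute)
      also have "\<dots> = comat (\<lambda>x. x) bc.C (pe ?d) i l" by (simp only: sum_delta_mult)
      also have "\<dots> = ?dl i" by (auto simp: cm)
      finally show "conv (\<lambda>x. x) bc.C ?dl (pe ?d) i = ?dl i" .
    qed
    then have "bc.m' i j l = mulf (\<lambda>x. x) bc.m' (conv (\<lambda>x. x) bc.C ?dl (pe ?d)) (i, j)" by (simp only: ml)
    also have "\<dots> = conv (\<lambda>x. x) (pair_c bc.C) (mulf (\<lambda>x. x) bc.m' ?dl) (mulf (\<lambda>x. x) bc.m' (pe ?d)) (i, j)"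
      by (simp only: conv_mulf[OF id_ring_hom bc.new_bialg])
    also have "\<dots> = (\<Sum>a\<in>UNIV. mulf (\<lambda>x. x) bc.m' ?dl a * (if dg i \<otimes>\<^bsub>G\<^esub> dg j = ?d then (if a = (i, j) then 1 else 0) else 0))"
      by (simp only: coalg_consts.conv_comat[OF nc.pair_coalg] cp)
    finally show ?thesis using that by (cases "dg i \<otimes>\<^bsub>G\<^esub> dg j = ?d") auto
  qed
  have dg_m: "dg l = dg (pm (hh i) (hh j))" if "bc.m' i j l \<noteq> 0" for i j l
  proof -
    have "bc.m' (hh i) (hh j) (pm (hh i) (hh j)) \<noteq> 0" by (simp add: P_m e_hh)
    from dg_mult[OF this] dg_mult[OF that] show ?thesis by (simp add: dg_hh)
  qed

  have pm_u: "pm p u = p" if "p \<in> P" for p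
    unfolding pm_def e_u unit_r' by (rule ixg_e[OF that])
  \<comment> \<open>Two powers of p coincide because the index set is finite, and the common part is
    cancelled.\<close>
  have torsion: "\<exists>n>0. (pm p ^^ n) u = u" if p: "p \<in> P" for p
  proof -
    have inP: "(pm p ^^ n) u \<in> P" for n by (induction n) (simp_all add: e_u e_pm p)
    obtain s where s: "h_mult mu s (e p) = eta" using gl_left_inverse[OF Pgl[OF p]] by blast
    have inj: "q = r" if "pm p q = pm p r" "q \<in> P" "r \<in> P" for q r
    proof -
      have "h_mult mu (e p) (e q) = h_mult mu (e p) (e r)" using e_pm(1)[OF p] that by metis
      then have "h_mult mu s (h_mult mu (e p) (e q)) = h_mult mu s (h_mult mu (e p) (e r))" by simp
      then have "e q = e r" by (simp only: assoc'[symmetric] s unit_l')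
      then show ?thesis using e(1) by (simp add: inj_eq)
    qed
    have cancel: "(pm p ^^ k) q = (pm p ^^ k) r \<Longrightarrow> q \<in> P \<Longrightarrow> r \<in> P \<Longrightarrow> q = r" for k q r
    proof (induction k)
      case (Suc k)
      have "(pm p ^^ k) q \<in> P" "(pm p ^^ k) r \<in> P" using Suc.prems(2,3) by (induction k) (simp_all add: e_pm p)
      then show ?case using Suc inj by simp
    qed simp
    have "\<not> inj (\<lambda>n. (pm p ^^ n) u)"
      using finite_imageD[of "\<lambda>n. (pm p ^^ n) u" UNIV] by (metis finite infinite_UNIV_nat)
    then obtain a b where ab: "a < b" "(pm p ^^ a) u = (pm p ^^ b) u"
      unfolding inj_def by (metis linorder_neqE_nat)
    have split: "(pm p ^^ b) u = (pm p ^^ a) ((pm p ^^ (b - a)) u)"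
      using ab(1) funpow_add[of a "b - a" "pm p"] by simp
    have "u = (pm p ^^ (b - a)) u" by (rule cancel[OF trans[OF ab(2) split] e_u(2) inP])
    then have "(pm p ^^ (b - a)) u = u" by (rule sym)
    moreover have "b - a > 0" using ab(1) by simp
    ultimately show ?thesis by blast
  qed
  \<comment> \<open>A vector with \<pi>-image 0 lies in the commutator ideal, hence in every ideal
    that contains all commutators.\<close>
  have ker: "x \<in> I" if I: "two_sided_ideal bc.m' I" "\<forall>x y. h_mult bc.m' x y - h_mult bc.m' y x \<in> I"
    and x: "\<And>d. (\<Sum>b\<in>UNIV. x b * pe d b) = 0" for I x
  proof -
    have "lin_map pim (bc.lc x) d = (\<Sum>b\<in>UNIV. x b * pe d b)" for d
    proof -
      have "lin_map pim (bc.lc x) d = (\<Sum>z\<in>UNIV. \<Sum>b\<in>UNIV. x b * (e b z * pim z d))"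
        by (simp add: lin_map_apply bc.lc_def sum_distrib_right mult.assoc)
      also have "\<dots> = (\<Sum>b\<in>UNIV. x b * pe d b)"
        unfolding pe_def lin_map_apply sum_distrib_left by (rule sum.swap)
      finally show ?thesis .
    qed
    then have "lin_map pim (bc.lc x) = 0" using x by (auto simp: fun_eq_iff)
    then have "bc.lc x \<in> commutator_ideal mu" using pim(5) by blast
    then show ?thesis by (rule two_sided_ideal_lc[OF bc.basis_change_axioms I])
  qed
  have pe_P: "pe d p = (if d = dg p then 1 else 0)" if "p \<in> P" for d p
    using pg[OF Pgl[OF that]] glP[OF that] by (simp add: pe_def lin_map_apply dg_def)
  interpret tb: triangular_bialgebra bc.C bc.ep' bc.m' P pm u hh dg
  proof
    show "(\<Sum>p\<in>UNIV. bc.m' i j p * bc.C p a b) =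
        (\<Sum>a1\<in>UNIV. \<Sum>b1\<in>UNIV. \<Sum>a2\<in>UNIV. \<Sum>b2\<in>UNIV. bc.C i a1 b1 * bc.C j a2 b2 * bc.m' a1 a2 a * bc.m' b1 b2 b)" for i j a b
      by (rule bc.new_bialg)
    show "(\<Sum>p\<in>UNIV. bc.m' i j p * bc.ep' p) = bc.ep' i * bc.ep' j" for i j by (rule bc.new_ep_mult)
    show "bc.C p a b = (if a = p \<and> b = p then 1 else 0)" if "p \<in> P" for p a b by (rule P_c[OF that])
    show "bc.ep' p = 1" if "p \<in> P" for p using Pgl[OF that] by (simp add: bc.ep'_def grouplike_def)
    show "pm p q \<in> P" if "p \<in> P" "q \<in> P" for p q using e_pm[OF that] by simp
    show "bc.m' p q l = (if l = pm p q then 1 else 0)" if "p \<in> P" "q \<in> P" for p q l by (rule P_m[OF that])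
    show "u \<in> P" by (rule e_u)
    show "pm p u = p" if "p \<in> P" for p by (rule pm_u[OF that])
    show "\<exists>n>0. (pm p ^^ n) u = u" if "p \<in> P" for p by (rule torsion[OF that])
    show "i \<le> a" if "bc.C i a b \<noteq> 0" for i a b by (rule tri[OF that])
    show "hh i \<in> P" for i by (rule e_hh)
    show "bc.C i i b = (if b = hh i then 1 else 0)" for i b by (rule diag)
    show "dg (hh i) = dg i" for i by (rule dg_hh)
    show "dg b = dg i" if "bc.C i a b \<noteq> 0" for i a b by (rule dg_c[OF that])
    show "dg l = dg (pm (hh i) (hh j))" if "bc.m' i j l \<noteq> 0" for i j l by (rule dg_m[OF that])
    \<comment> \<open>By \<open>cm\<close>, \<pi> annihilates the second leg of \<Delta> e_i at
      every index other than \<open>i\<close>.\<close>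
    show "bc.C i a \<in> I" if "two_sided_ideal bc.m' I" "\<forall>x y. h_mult bc.m' x y - h_mult bc.m' y x \<in> I" "a \<noteq> i" for I a i
    proof (rule ker[OF that(1,2)])
      show "(\<Sum>b\<in>UNIV. bc.C i a b * pe d b) = 0" for d using cm[of d i a] that(3) by (simp add: comat_def)
    qed
    show "h_basis p - h_basis q \<in> I" if "two_sided_ideal bc.m' I" "\<forall>x y. h_mult bc.m' x y - h_mult bc.m' y x \<in> I"
      "p \<in> P" "q \<in> P" "dg p = dg q" for I p q
    proof (rule ker[OF that(1,2)])
      fix d
      have "(\<Sum>b\<in>UNIV. (h_basis p - h_basis q) b * pe d b) = conv_dual (\<lambda>x. x) (pe d) (h_basis p - h_basis q)"
        by (simp add: conv_dual_def)
      also have "\<dots> = pe d p - pe d q"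
        by (simp only: conv_dual_diff[OF id_ring_hom] conv_dual_basis[OF id_ring_hom])
      also have "\<dots> = 0" using that by (simp add: pe_P)
      finally show "(\<Sum>b\<in>UNIV. (h_basis p - h_basis q) b * pe d b) = 0" .
    qed
  qed
  obtain n T phi where T: "mult_subset n T" and iso: "k_alg_iso (generic_base_algebra bc.m' bc.C bc.ep') (localization n T) phi"
    using tb.localization_iso unfolding tb.B_def by blast
  have "generic_base_algebra mu dl ep = bc.psi ` generic_base_algebra bc.m' bc.C bc.ep'"
    using tb.tau_inverse unfolding tb.tau_def by (rule bc.base_algebra_image)
  then show ?thesis
    using T k_alg_iso_image[OF iso bc.psi_hom bc.psi_const] by metis
qed

end
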